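(* There exists $r>0$ such that for every function $\omega:(0,1]\to(0,\infty)$ with $\omega(\delta)/\sqrt\delta\to0$ as $\delta\to0$ there exists $\delta_0>0$ such that for all $0<\delta\le\delta_0$ and all $\Phi\in Z$ with $\|\Phi-\Phi_{LSW}\|_Z\le r$ the following holds. The compatibility conditions $$\varepsilon\int_0^\infty z\,I[\Phi;\varepsilon,\tilde\varepsilon,\delta](z)\,dz=\varepsilon,\qquad \varepsilon\int_0^\infty I[\Phi;\varepsilon,\tilde\varepsilon,\delta](z)\,dz=\tilde\varepsilon$$ have a solution $(\varepsilon,\tilde\varepsilon)$ with $\varepsilon,\tilde\varepsilon>0$ that belongs to $$U_\delta=\Big\{(\varepsilon,\tilde\varepsilon):\ \tfrac12\epsilon_\delta\le\varepsilon\le2\epsilon_\delta,\ \tfrac12\tilde\epsilon_\delta\le\tilde\varepsilon\le2\tilde\epsilon_\delta\Big\},$$ and every solution with $0<\varepsilon\le\omega(\delta)$, $0<\tilde\varepsilon\le\omega(\delta)$ coincides with it. Here $\epsilon_\delta$ and $\tilde\epsilon_\delta$ (defined in the context) are both exponentially small in $1/\sqrt\delta$: there are constants $c,C>0$ independent of $\delta$ such that $\epsilon_\delta$ and $\tilde\epsilon_\delta$ lie between $c\exp(-C/\sqrt\delta)$ and $C\exp(-c/\sqrt\delta)$ for all $0<\delta\le1$.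
   Context: Let $\lambda_{LSW}=3(1/2)^{2/3}$. For $\delta\ge0$ let $$a_\delta(z)=\frac1{1+z-\lambda_{LSW}z^{1/3}+\delta z^{1/3}},\qquad b_\delta(z)=2-\tfrac13\lambda_{LSW}z^{-2/3}+\tfrac13\delta z^{-2/3}$$ (for $\delta=0$, $a_0$ is singular at $z=\tfrac12$). Function space: fix constants $\beta_1>0$, $\beta_2>1$. $Z$ is the space of real-valued measurable functions $\Phi$ on $[0,\infty)$ with finite norm $\|\Phi\|_Z=\lceil\Phi\rceil_Z+\lfloor\Phi\rfloor_Z$, where $\lceil\Phi\rceil_Z=\sup_{0\le z\le1}|\Phi(z)|$ and $\lfloor\Phi\rfloor_Z=\sup_{z\ge1}|\Phi(z)e^{\beta_1z}z^{\beta_2}|$. Convolution (note the factor $\tfrac12$): $(\Phi_1*\Phi_2)(z)=\tfrac12\int_0^z\Phi_1(z-y)\Phi_2(y)\,dy$. LSW solution: $\Phi_{LSW}(z)=C_*\exp\big(-\int_0^z a_0(\xi)b_0(\xi)\,d\xi\big)$ for $0\le z<\tfrac12$, $\Phi_{LSW}(z)=0$ for $z\ge\tfrac12$, with $C_*$ chosen such that $\int_0^\infty z\Phi_{LSW}\,dz=1$. For $\delta>0$, $z\mapsto\psi(z;\varepsilon,\tilde\varepsilon,\delta)$ is the solution of $\psi'=-a_\delta(z)\big(b_\delta(z)-\tilde\varepsilon z-\varepsilon\big)\psi$ on $[0,\infty)$ normalized by $\int_0^1z\psi\,dz=1$, and $$I[\Phi;\varepsilon,\tilde\varepsilon,\delta](z)=\varepsilon\int_z^\infty\xi\,a_\delta(\xi)\,\frac{\psi(z;\varepsilon,\tilde\varepsilon,\delta)}{\psi(\xi;\varepsilon,\tilde\varepsilon,\delta)}\,(\Phi*\Phi)(\xi)\,d\xi.$$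 Put $\gamma_1(z)=z$, $\gamma_2(z)=1$, $$K_{i,\delta}=\int_0^1\gamma_i(z)\exp\Big(\int_z^1a_\delta(y)b_\delta(y)\,dy\Big)dz,\qquad R_0[h]=\int_{1/2}^1\xi\,a_0(\xi)\,h(\xi)\exp\Big(-\int_\xi^1a_0(y)b_0(y)\,dy\Big)d\xi,$$ $$\epsilon_\delta=\frac1{K_{1,\delta}\,R_0[\Phi_{LSW}*\Phi_{LSW}]},\qquad\tilde\epsilon_\delta=\epsilon_\delta\,\frac{K_{2,\delta}}{K_{1,\delta}}.$$ *)

theory Defs
  imports "HOL-Analysis.Analysis"
begin

text \<open>
  Functions on $[0,\infty)$ are represented by functions of type \<^typ>\<open>real \<Rightarrow> real\<close> whose values on
  the negative half-line are never used. All integrals are Lebesgue integrals over the stated sets.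
\<close>

definition lambda_LSW :: real where
  "lambda_LSW = 3 * (1/2) powr (2/3)"

definition a_coef :: "real \<Rightarrow> real \<Rightarrow> real" where
  "a_coef \<delta> z = 1 / (1 + z - lambda_LSW * z powr (1/3) + \<delta> * z powr (1/3))"

definition b_coef :: "real \<Rightarrow> real \<Rightarrow> real" where
  "b_coef \<delta> z = 2 - 1/3 * lambda_LSW * z powr (-2/3) + 1/3 * \<delta> * z powr (-2/3)"


text \<open>The suprema are real-valued, so finiteness of the norm is expressed by \<^const>\<open>bdd_above\<close>.\<close>

definition Z_space :: "real \<Rightarrow> real \<Rightarrow> (real \<Rightarrow> real) set" where
  "Z_space \<beta>1 \<beta>2 = {\<Phi>. \<Phi> \<in> borel_measurable (lebesgue_on {0..}) \<and>
     bdd_above ((\<lambda>z. \<bar>\<Phi> z\<bar>) ` {0..1}) \<and>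
     bdd_above ((\<lambda>z. \<bar>\<Phi> z * exp (\<beta>1 * z) * z powr \<beta>2\<bar>) ` {1..})}"

definition Z_norm :: "real \<Rightarrow> real \<Rightarrow> (real \<Rightarrow> real) \<Rightarrow> real" where
  "Z_norm \<beta>1 \<beta>2 \<Phi> =
     (SUP z\<in>{0..1}. \<bar>\<Phi> z\<bar>) + (SUP z\<in>{1..}. \<bar>\<Phi> z * exp (\<beta>1 * z) * z powr \<beta>2\<bar>)"

definition conv :: "(real \<Rightarrow> real) \<Rightarrow> (real \<Rightarrow> real) \<Rightarrow> real \<Rightarrow> real" where
  "conv \<Phi>1 \<Phi>2 z = 1/2 * (LINT y:{0..z}|lebesgue. \<Phi>1 (z - y) * \<Phi>2 y)"


definition LSW_profile :: "real \<Rightarrow> real \<Rightarrow> real" where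
  "LSW_profile C z =
     (if 0 \<le> z \<and> z < 1/2 then C * exp (- (LINT \<xi>:{0..z}|lebesgue. a_coef 0 \<xi> * b_coef 0 \<xi>)) else 0)"

definition C_star :: real where
  "C_star = (THE C. (LINT z:{0..}|lebesgue. z * LSW_profile C z) = 1)"

definition Phi_LSW :: "real \<Rightarrow> real" where
  "Phi_LSW = LSW_profile C_star"


text \<open>
  The coefficient $b_\delta$ has an integrable singularity at $0$, so a solution on $[0,\infty)$ is
  continuous there and satisfies the equation on $(0,\infty)$. The condition on negative
  arguments only makes the solution unique as a function on all of \<^typ>\<open>real\<close>.
\<close>

definition is_psi :: "real \<Rightarrow> real \<Rightarrow> real \<Rightarrow> (real \<Rightarrow> real) \<Rightarrow> bool" where
  "is_psi \<epsilon> \<epsilon>t \<delta> \<psi> \<longleftrightarrow>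
     continuous_on {0..} \<psi> \<and>
     (\<forall>z>0. (\<psi> has_real_derivative - a_coef \<delta> z * (b_coef \<delta> z - \<epsilon>t * z - \<epsilon>) * \<psi> z) (at z)) \<and>
     (LINT z:{0..1}|lebesgue. z * \<psi> z) = 1 \<and>
     (\<forall>z<0. \<psi> z = 0)"

definition psi :: "real \<Rightarrow> real \<Rightarrow> real \<Rightarrow> real \<Rightarrow> real" where
  "psi \<epsilon> \<epsilon>t \<delta> = (THE \<psi>. is_psi \<epsilon> \<epsilon>t \<delta> \<psi>)"

definition I_op :: "(real \<Rightarrow> real) \<Rightarrow> real \<Rightarrow> real \<Rightarrow> real \<Rightarrow> real \<Rightarrow> real" where
  "I_op \<Phi> \<epsilon> \<epsilon>t \<delta> z =
     \<epsilon> * (LINT \<xi>:{z..}|lebesgue. \<xi> * a_coef \<delta> \<xi> * (psi \<epsilon> \<epsilon>t \<delta> z / psi \<epsilon> \<epsilon>t \<delta> \<xi>) * conv \<Phi> \<Phi> \<xi>)"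

text \<open>
  For positive parameters these equations force both integrals to exist, since a
  non-integrable function has integral $0$.
\<close>

definition compatible :: "(real \<Rightarrow> real) \<Rightarrow> real \<Rightarrow> real \<Rightarrow> real \<Rightarrow> bool" where
  "compatible \<Phi> \<delta> \<epsilon> \<epsilon>t \<longleftrightarrow>
     \<epsilon> * (LINT z:{0..}|lebesgue. z * I_op \<Phi> \<epsilon> \<epsilon>t \<delta> z) = \<epsilon> \<and>
     \<epsilon> * (LINT z:{0..}|lebesgue. I_op \<Phi> \<epsilon> \<epsilon>t \<delta> z) = \<epsilon>t"


definition K_int :: "(real \<Rightarrow> real) \<Rightarrow> real \<Rightarrow> real" where
  "K_int \<gamma> \<delta> =
     (LINT z:{0..1}|lebesgue. \<gamma> z * exp (LINT y:{z..1}|lebesgue. a_coef \<delta> y * b_coef \<delta> y))"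

definition K1 :: "real \<Rightarrow> real" where "K1 = K_int (\<lambda>z. z)"

definition K2 :: "real \<Rightarrow> real" where "K2 = K_int (\<lambda>z. 1)"

definition R0 :: "(real \<Rightarrow> real) \<Rightarrow> real" where
  "R0 h = (LINT \<xi>:{1/2..1}|lebesgue.
     \<xi> * a_coef 0 \<xi> * h \<xi> * exp (- (LINT y:{\<xi>..1}|lebesgue. a_coef 0 y * b_coef 0 y)))"

definition eps :: "real \<Rightarrow> real" where
  "eps \<delta> = 1 / (K1 \<delta> * R0 (conv Phi_LSW Phi_LSW))"

definition epst :: "real \<Rightarrow> real" where
  "epst \<delta> = eps \<delta> * (K2 \<delta> / K1 \<delta>)"

definition U_set :: "real \<Rightarrow> (real \<times> real) set" where
  "U_set \<delta> = {(\<epsilon>, \<epsilon>t). 1/2 * eps \<delta> \<le> \<epsilon> \<and> \<epsilon> \<le> 2 * eps \<delta> \<and>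
                        1/2 * epst \<delta> \<le> \<epsilon>t \<and> \<epsilon>t \<le> 2 * epst \<delta>}"

end

theory Submission
  imports Defs "HOL-Real_Asymp.Real_Asymp"
begin

text \<open>
  The coefficients satisfy $b_\delta = 1 + D'$, where $D = 1/a_\delta$ is the denominator of
  $a_\delta$. Hence $a_\delta b_\delta = 1/D + (\ln D)'$, and everything can be integrated
  explicitly: with $A(z) = \int_0^z 1/D$ and $B(z) = \int_0^z y/D$ one finds
  $\psi(z) = c\, e^{-(1-\varepsilon)A(z) + \tilde\varepsilon B(z)} / D(z)$. In $I[\Phi]$ only
  quotients of $\psi$ occur, and exchanging the order of integration (\<open>moment_eq\<close>) turns the
  compatibility conditions into
  $\varepsilon M_z = 1$ and $\varepsilon^2 M_1 = \tilde\varepsilon$, where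
  $M_\gamma(\varepsilon,\tilde\varepsilon) = \int_0^\infty \xi\,(\Phi*\Phi)(\xi)\,G_\gamma(\xi)\,d\xi$
  and $G_\gamma(\xi)$ is the $\gamma$-moment of the response to a unit source at $\xi$.

  At $z = 1/2$ the denominator $D_0$ has a double zero, so $D$ is comparable to
  $(z-1/2)^2 + \delta$ there and $A(1)$ is of exact order $1/\sqrt\delta$. A source beyond $1/2$ is
  amplified by a factor of the order of $e^{A(1)}$, and this is why $\epsilon_\delta$, which is
  essentially $1/M_z$, is exponentially small. Three estimates make this precise as long as
  $\varepsilon$ and $\tilde\varepsilon$ are at most $\eta\sqrt\delta$ with a small constant $\eta$,
  so that $\varepsilon A$ and $\tilde\varepsilon B$ are small on $[0,1]$:

  \<^item> for $\Phi = \Phi_{LSW}$, $M_\gamma$ is close to $K_{\gamma,\delta} R_0[\Phi_{LSW}*\Phi_{LSW}]$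
    in the sense that the quotient is close to 1 (\<open>moment_LSW_sandwich\<close>);
  \<^item> replacing $\Phi_{LSW}$ by $\Phi$ changes $M_\gamma$ by at most a constant times
    $r\,e^{A(1)}$ (\<open>moment_perturbation\<close>);
  \<^item> $M_\gamma$ is Lipschitz in $(\varepsilon,\tilde\varepsilon)$ with a constant of order
    $e^{A(1)}/\sqrt\delta$ (\<open>moment_lipschitz\<close>).

  Solutions are the fixed points of $(\varepsilon,\tilde\varepsilon) \mapsto (1/M_z, M_1/M_z^2)$. By the
  first two estimates this map sends every pair with components at most $\eta\sqrt\delta$ into
  $U_\delta$, so all such solutions lie in $U_\delta$. Its Lipschitz constant is of order
  $\epsilon_\delta^2\,e^{A(1)}/\sqrt\delta$, hence of order $e^{-A(1)}/\sqrt\delta$, and tends to 0. The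
  contraction principle (\<open>compatibility_fixed_point\<close>) therefore gives existence and uniqueness at
  once. The constants $r$ and $\eta$ depend only on $\beta_1$; a given $\omega$ enters only through the
  fact that $\omega(\delta) \le \eta\sqrt\delta$ for small $\delta$.
\<close>


section \<open>The denominator and its double zero\<close>

text \<open>
  The denominator $D$ of $a_\delta$, in terms of which both coefficients are expressed.
\<close>

definition den :: "real \<Rightarrow> real \<Rightarrow> real" where
  "den \<delta> z = 1 + z - lambda_LSW * z powr (1/3) + \<delta> * z powr (1/3)"

text \<open>
  The cube root of the critical point $1/2$; in the variable $z^{1/3}$ the denominator is a polynomial.
\<close>

definition x0 :: real where "x0 = (1/2) powr (1/3)"

lemma x0_cube: "x0 ^ 3 = 1/2"
  unfolding x0_def by (simp add: powr_power)

lemma lambda_eq: "lambda_LSW = 3 * x0\<^sup>2"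
  unfolding x0_def lambda_LSW_def by (simp add: powr_power)

lemma x0_bounds: "1/2 < x0" "x0 < 1"
proof -
  have p: "x0 \<ge> 0" by (simp add: x0_def)
  show "1/2 < x0"
  proof (rule ccontr)
    assume "\<not> 1/2 < x0"
    then have "x0 ^ 3 \<le> (1/2) ^ 3" using p by (intro power_mono) auto
    then show False unfolding x0_cube by (simp add: power3_eq_cube)
  qed
  show "x0 < 1"
  proof (rule ccontr)
    assume "\<not> x0 < 1"
    then have "1 ^ 3 \<le> x0 ^ 3" by (intro power_mono) auto
    then show False by (simp add: x0_cube)
  qed
qed

lemma cbrt_cube: "z \<ge> 0 \<Longrightarrow> (z powr (1/3)) ^ 3 = (z::real)"
  by (cases "z = 0") (simp_all add: powr_power)

lemma den_eq_den0: "den \<delta> z = den 0 z + \<delta> * z powr (1/3)"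
  by (simp add: den_def)

text \<open>
  The critical value of $\lambda$ is the one for which the cubic in $x = z^{1/3}$ acquires a double
  root, at $x_0$.
\<close>

lemma den0_factor:
  assumes "z \<ge> 0"
  shows "den 0 z = (z powr (1/3) - x0)\<^sup>2 * (z powr (1/3) + 2 * x0)"
proof -
  define x where "x = z powr (1/3)"
  have z: "z = x ^ 3" using cbrt_cube[OF assms] by (simp add: x_def)
  have "den 0 z = 2 * x0 ^ 3 + x ^ 3 - 3 * x0\<^sup>2 * x"
    by (simp add: den_def lambda_eq x0_cube cbrt_cube assms flip: x_def) (simp add: z)
  also have "\<dots> = (x - x0)\<^sup>2 * (x + 2 * x0)"
    by (simp add: power2_eq_square power3_eq_cube algebra_simps)
  finally show ?thesis by (simp add: x_def)
qed

lemma half_cbrt: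
  assumes "z \<ge> 0"
  shows "z - 1/2 = (z powr (1/3) - x0) * ((z powr (1/3))\<^sup>2 + z powr (1/3) * x0 + x0\<^sup>2)"
proof -
  define x where "x = z powr (1/3)"
  have "z - 1/2 = x ^ 3 - x0 ^ 3" using cbrt_cube[OF assms] by (simp add: x_def x0_cube)
  also have "\<dots> = (x - x0) * (x\<^sup>2 + x * x0 + x0\<^sup>2)"
    by (simp add: power2_eq_square power3_eq_cube algebra_simps)
  finally show ?thesis by (simp add: x_def)
qed

lemma den0_pos: "z \<ge> 0 \<Longrightarrow> z \<noteq> 1/2 \<Longrightarrow> den 0 z > 0"
  using half_cbrt[of z] x0_bounds unfolding den0_factor
  by (intro mult_pos_pos add_nonneg_pos) auto

lemma den0_nonneg: "z \<ge> 0 \<Longrightarrow> den 0 z \<ge> 0"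
  using x0_bounds unfolding den0_factor by (intro mult_nonneg_nonneg add_nonneg_nonneg) auto

lemma den_mono_delta: "\<delta> \<le> \<delta>' \<Longrightarrow> den \<delta> z \<le> den \<delta>' z"
  by (simp add: den_def mult_right_mono)

lemma den_pos: "\<delta> > 0 \<Longrightarrow> z \<ge> 0 \<Longrightarrow> den \<delta> z > 0"
  using den0_nonneg[of z] by (cases "z = 0") (auto simp: den_eq_den0[of \<delta>] den_def intro!: add_nonneg_pos)

lemma cbrt_le_1: "0 \<le> z \<Longrightarrow> z \<le> 1 \<Longrightarrow> z powr (1/3) \<le> (1::real)"
  using powr_mono2[of "1/3" z 1] by simp

text \<open>
  The double zero at $1/2$ is lifted to height of order $\delta$. The comparison with
  $(z-1/2)^2 + \delta$ reduces integrals of $1/D$ to arc tangents.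
\<close>

lemma den_upper:
  assumes "0 \<le> z" "z \<le> 1" "\<delta> > 0"
  shows "den \<delta> z \<le> 48 * ((z - 1/2)\<^sup>2 + \<delta>)"
proof -
  define x where "x = z powr (1/3)"
  have x: "0 \<le> x" "x \<le> 1" using assms cbrt_le_1 by (auto simp: x_def)
  have q: "1/4 \<le> x\<^sup>2 + x * x0 + x0\<^sup>2"
  proof -
    have "(1/2)\<^sup>2 \<le> x0\<^sup>2" using x0_bounds by (intro power_mono) auto
    then show ?thesis using x x0_bounds by (simp add: power2_eq_square add_increasing)
  qed
  have "\<bar>x - x0\<bar> * (1/4) \<le> \<bar>z - 1/2\<bar>"
    using half_cbrt[OF assms(1)] q unfolding x_def[symmetric]
    by (simp only: abs_mult) (intro mult_left_mono, auto)
  then have "(\<bar>x - x0\<bar> * (1/4))\<^sup>2 \<le> \<bar>z - 1/2\<bar>\<^sup>2" by (intro power_mono) auto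
  then have a: "(x - x0)\<^sup>2 \<le> 16 * (z - 1/2)\<^sup>2" by (simp add: power_mult_distrib power_divide)
  have "den 0 z \<le> (16 * (z - 1/2)\<^sup>2) * 3"
    unfolding den0_factor[OF assms(1)] x_def[symmetric]
    using a x x0_bounds by (intro mult_mono) auto
  moreover have "\<delta> * x \<le> \<delta>" using x assms by (simp add: mult_left_le)
  moreover have "den \<delta> z = den 0 z + \<delta> * x" unfolding x_def by (rule den_eq_den0)
  ultimately show ?thesis using assms(3) by argo
qed

lemma den_lower:
  assumes "0 \<le> z" "z \<le> 1" "0 < \<delta>" "\<delta> \<le> 1"
  shows "((z - 1/2)\<^sup>2 + \<delta>) / 128 \<le> den \<delta> z"
proof -
  define x where "x = z powr (1/3)"
  have x: "0 \<le> x" "x \<le> 1" using assms cbrt_le_1 by (auto simp: x_def)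
  have q: "x\<^sup>2 + x * x0 + x0\<^sup>2 \<le> 3"
    using x x0_bounds mult_le_one[of x x0] power_le_one[of x 2] power_le_one[of x0 2] by simp
  have q0: "0 \<le> x\<^sup>2 + x * x0 + x0\<^sup>2" using x x0_bounds by simp
  have "\<bar>z - 1/2\<bar> \<le> \<bar>x - x0\<bar> * 3"
    using half_cbrt[OF assms(1)] q q0 unfolding x_def[symmetric]
    by (simp only: abs_mult) (intro mult_left_mono, auto)
  then have "\<bar>z - 1/2\<bar>\<^sup>2 \<le> (\<bar>x - x0\<bar> * 3)\<^sup>2" by (intro power_mono) auto
  then have a: "(z - 1/2)\<^sup>2 / 9 \<le> (x - x0)\<^sup>2" by (simp add: power_mult_distrib)
  have "(z - 1/2)\<^sup>2 / 9 * 1 \<le> den 0 z"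
    unfolding den0_factor[OF assms(1)] x_def[symmetric]
    using a x x0_bounds by (intro mult_mono) auto
  then have d0: "(z - 1/2)\<^sup>2 / 9 \<le> den 0 z" by simp
  have eq: "den \<delta> z = den 0 z + \<delta> * x" unfolding x_def by (rule den_eq_den0)
  have sq: "0 \<le> (z - 1/2)\<^sup>2" by simp
  \<comment> \<open>Away from the origin the term $\delta z^{1/3}$ supplies the $\delta$; near it $D_0$ alone is bounded below.\<close>
  show ?thesis
  proof (cases "x \<ge> 1/2")
    case True
    then have "\<delta> * (1/2) \<le> \<delta> * x" using assms by (intro mult_left_mono) auto
    then show ?thesis using d0 eq sq assms by argo
  next
    case False
    have "z = x ^ 3" using cbrt_cube assms by (simp add: x_def)
    also have "\<dots> \<le> (1/2) ^ 3" using False x by (intro power_mono) auto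
    finally have "z \<le> 1/8" by (simp add: power3_eq_cube)
    then have "(3/8)\<^sup>2 \<le> (1/2 - z)\<^sup>2" by (intro power_mono) auto
    then have "9/64 \<le> (z - 1/2)\<^sup>2" unfolding power2_commute[of z] by (simp add: power2_eq_square)
    moreover have "0 \<le> \<delta> * x" using assms x by simp
    ultimately show ?thesis using d0 eq assms by argo
  qed
qed

text \<open>
  The bound is uniform in $\delta$; it makes the integral of $1/D$ over $[1,z]$ grow only
  logarithmically.
\<close>

lemma den_ge_linear:
  assumes "1 \<le> z" "\<delta> \<ge> 0"
  shows "(1 - x0)\<^sup>2 * z \<le> den \<delta> z"
proof -
  define x where "x = z powr (1/3)"
  have x: "1 \<le> x" using assms by (simp add: x_def ge_one_powr_ge_zero)
  have z: "z = x ^ 3" using cbrt_cube assms by (simp add: x_def)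
  have "x0 * 1 \<le> x0 * x" using x x0_bounds by (intro mult_left_mono) auto
  then have "(1 - x0) * x \<le> x - x0" by (simp add: algebra_simps)
  then have "((1 - x0) * x)\<^sup>2 * x \<le> (x - x0)\<^sup>2 * (x + 2 * x0)"
    using x x0_bounds by (intro mult_mono power_mono) auto
  also have "\<dots> = den 0 z" using den0_factor[of z] assms by (simp add: x_def)
  also have "\<dots> \<le> den \<delta> z" using assms by (intro den_mono_delta)
  finally have "((1 - x0) * x)\<^sup>2 * x \<le> den \<delta> z" .
  moreover have "((1 - x0) * x)\<^sup>2 * x = (1 - x0)\<^sup>2 * z"
    by (simp add: z power_mult_distrib power2_eq_square power3_eq_cube)
  ultimately show ?thesis by simp
qed

lemma den0_antimono:
  assumes "0 \<le> z" "z \<le> w" "w \<le> 1/2"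
  shows "den 0 w \<le> den 0 z"
proof -
  define x y where "x = z powr (1/3)" and "y = w powr (1/3)"
  have xy: "0 \<le> x" "x \<le> y" "y \<le> x0" unfolding x_def y_def x0_def using assms by (auto intro!: powr_mono2)
  have "den 0 z - den 0 w = (y - x) * (3 * x0\<^sup>2 - (x\<^sup>2 + x * y + y\<^sup>2))"
    using assms cbrt_cube[of z] cbrt_cube[of w] unfolding x_def[symmetric] y_def[symmetric]
    by (simp add: den_def lambda_eq algebra_simps power2_eq_square power3_eq_cube flip: x_def y_def)
  moreover have "x\<^sup>2 \<le> x0\<^sup>2" "y\<^sup>2 \<le> x0\<^sup>2" "x * y \<le> x0 * x0"
    using xy by (auto intro!: power_mono mult_mono)
  ultimately have "den 0 z - den 0 w \<ge> 0" using xy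
    by (auto simp: power2_eq_square)
  then show ?thesis by simp
qed

lemma den0_mono:
  assumes "1/2 \<le> z" "z \<le> w"
  shows "den 0 z \<le> den 0 w"
proof -
  define x y where "x = z powr (1/3)" and "y = w powr (1/3)"
  have xy: "x0 \<le> x" "x \<le> y" unfolding x_def y_def x0_def using assms by (auto intro!: powr_mono2)
  have "den 0 z = (x - x0)\<^sup>2 * (x + 2 * x0)" "den 0 w = (y - x0)\<^sup>2 * (y + 2 * x0)"
    using den0_factor[of z] den0_factor[of w] assms by (auto simp: x_def y_def)
  then show ?thesis using xy x0_bounds by (auto intro!: mult_mono power_mono)
qed

lemma continuous_on_den: "continuous_on {0..} (den \<delta>)"
  unfolding den_def by (intro continuous_intros continuous_on_powr') auto

text \<open>
  This identity between the two coefficients is what makes all the integrals explicit.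
\<close>

lemma den_deriv:
  assumes "z > 0"
  shows "(den \<delta> has_real_derivative (b_coef \<delta> z - 1)) (at z)"
proof -
  have "((\<lambda>z. 1 + z - lambda_LSW * z powr (1/3) + \<delta> * z powr (1/3)) has_real_derivative (b_coef \<delta> z - 1)) (at z)"
    using assms unfolding b_coef_def
    by (auto intro!: derivative_eq_intros simp: powr_diff field_simps)
  then show ?thesis by (simp add: den_def[abs_def])
qed

lemma a_coef_den: "a_coef \<delta> z = 1 / den \<delta> z"
  by (simp add: a_coef_def den_def)

section \<open>Travel times through the bottleneck\<close>

lemma indefinite_integral_half_line:
  fixes f :: "real \<Rightarrow> real"
  assumes f: "continuous_on {0..} f"
  shows "continuous_on {0..} (\<lambda>x. integral {0..x} f)"
    and "x > 0 \<Longrightarrow> ((\<lambda>x. integral {0..x} f) has_real_derivative f x) (at x)"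
proof -
  have D: "((\<lambda>x. integral {0..x} f) has_real_derivative f x) (at x within {0..})" if "x \<ge> 0" for x
  proof -
    have "((\<lambda>x. integral {0..x} f) has_real_derivative f x) (at x within {0..x + 1})"
      using that by (intro integral_has_real_derivative continuous_on_subset[OF f]) auto
    moreover have "at x within {0..x + 1} = at x within {0..}"
      using at_within_nhd[of x "{x - 1<..<x + 1}" "{0..x + 1}" "{0..}"] by force
    ultimately show ?thesis by simp
  qed
  then show "continuous_on {0..} (\<lambda>x. integral {0..x} f)"
    by (intro DERIV_continuous_on) auto
  show "((\<lambda>x. integral {0..x} f) has_real_derivative f x) (at x)" if "x > 0"
  proof -
    have "at x within {0..} = at x" using that by (intro at_within_interior) simp
    then show ?thesis using D[of x] that by simp
  qed
qed

text \<open>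
  The integrals $A$ and $B$: the travel time from $0$ to $z$ along $\dot z = D(z)$ and its first
  moment. All integrating factors below are exponentials of combinations of them.
\<close>

definition age :: "real \<Rightarrow> real \<Rightarrow> real" where
  "age \<delta> z = integral {0..z} (\<lambda>y. 1 / den \<delta> y)"

definition amass :: "real \<Rightarrow> real \<Rightarrow> real" where
  "amass \<delta> z = integral {0..z} (\<lambda>y. y / den \<delta> y)"

lemma continuous_on_recip_den:
  assumes "\<And>z. z \<in> S \<Longrightarrow> den \<delta> z > 0" "S \<subseteq> {0..}" "continuous_on S g"
  shows "continuous_on S (\<lambda>z. g z / den \<delta> z)"
  using assms continuous_on_subset[OF continuous_on_den] by (intro continuous_intros) force+

context
  fixes \<delta> :: real assumes \<delta>: "\<delta> > 0"
begin

lemma continuous_on_age: "continuous_on {0..} (age \<delta>)"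
  and age_deriv: "z > 0 \<Longrightarrow> (age \<delta> has_real_derivative 1 / den \<delta> z) (at z)"
  using indefinite_integral_half_line[of "\<lambda>y. 1 / den \<delta> y"] continuous_on_recip_den[of "{0..}" \<delta> "\<lambda>_. 1"] \<delta> den_pos
  unfolding age_def[abs_def] by auto

lemma continuous_on_amass: "continuous_on {0..} (amass \<delta>)"
  and amass_deriv: "z > 0 \<Longrightarrow> (amass \<delta> has_real_derivative z / den \<delta> z) (at z)"
  using indefinite_integral_half_line[of "\<lambda>y. y / den \<delta> y"] continuous_on_recip_den[of "{0..}" \<delta> "\<lambda>y. y"] \<delta> den_pos
  unfolding amass_def[abs_def] by auto

lemma recip_den_integrable:
  assumes "0 \<le> u" "continuous_on {u..v} g"
  shows "(\<lambda>y. g y / den \<delta> y) integrable_on {u..v}"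
  using assms \<delta> den_pos
  by (intro integrable_continuous_real continuous_on_recip_den) auto

lemma age_diff:
  assumes "0 \<le> u" "u \<le> v"
  shows "age \<delta> v - age \<delta> u = integral {u..v} (\<lambda>y. 1 / den \<delta> y)"
  using Henstock_Kurzweil_Integration.integral_combine[of 0 u v "\<lambda>y. 1 / den \<delta> y"] assms
    recip_den_integrable[of 0 v "\<lambda>_. 1"]
  by (simp add: age_def)

lemma amass_diff:
  assumes "0 \<le> u" "u \<le> v"
  shows "amass \<delta> v - amass \<delta> u = integral {u..v} (\<lambda>y. y / den \<delta> y)"
  using Henstock_Kurzweil_Integration.integral_combine[of 0 u v "\<lambda>y. y / den \<delta> y"] assms
    recip_den_integrable[of 0 v "\<lambda>y. y"]
  by (simp add: amass_def)

lemma age_mono: "0 \<le> u \<Longrightarrow> u \<le> v \<Longrightarrow> age \<delta> u \<le> age \<delta> v"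
  using age_diff[of u v] integral_nonneg[OF recip_den_integrable[of u v "\<lambda>_. 1"]] den_pos[OF \<delta>]
  by (auto simp: less_imp_le)

lemma amass_mono: "0 \<le> u \<Longrightarrow> u \<le> v \<Longrightarrow> amass \<delta> u \<le> amass \<delta> v"
  using amass_diff[of u v] integral_nonneg[OF recip_den_integrable[of u v "\<lambda>y. y"]] den_pos[OF \<delta>]
  by (auto simp: less_imp_le)

lemma age_0 [simp]: "age \<delta> 0 = 0" and amass_0 [simp]: "amass \<delta> 0 = 0"
  by (simp_all add: age_def amass_def)

lemma age_nonneg: "0 \<le> z \<Longrightarrow> 0 \<le> age \<delta> z" and amass_nonneg: "0 \<le> z \<Longrightarrow> 0 \<le> amass \<delta> z"
  using age_mono[of 0 z] amass_mono[of 0 z] by auto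

lemma amass_le: assumes "0 \<le> z" shows "amass \<delta> z \<le> z * age \<delta> z"
proof -
  have "amass \<delta> z \<le> integral {0..z} (\<lambda>y. z * (1 / den \<delta> y))"
    unfolding amass_def using recip_den_integrable[of 0 z "\<lambda>y. y"] recip_den_integrable[of 0 z "\<lambda>y. 1"] den_pos[OF \<delta>]
    by (intro integral_le integrable_on_mult_right) (auto intro!: divide_right_mono simp: less_imp_le)
  then show ?thesis unfolding Henstock_Kurzweil_Integration.integral_mult_right by (simp add: age_def)
qed

lemma integral_lorentz:
  assumes "u \<le> v"
  shows "((\<lambda>y. 1 / ((y - 1/2)\<^sup>2 + \<delta>)) has_integral
           (arctan ((v - 1/2) / sqrt \<delta>) - arctan ((u - 1/2) / sqrt \<delta>)) / sqrt \<delta>) {u..v}"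
proof -
  have D: "((\<lambda>y. arctan ((y - 1/2) / sqrt \<delta>) / sqrt \<delta>) has_real_derivative 1 / ((y - 1/2)\<^sup>2 + \<delta>)) (at y within {u..v})" for y
  proof -
    have "((\<lambda>y. arctan ((y - 1/2) / sqrt \<delta>) / sqrt \<delta>) has_real_derivative
        inverse (1 + ((y - 1/2) / sqrt \<delta>)\<^sup>2) * (1 / sqrt \<delta>) / sqrt \<delta>) (at y within {u..v})"
      by (intro DERIV_cdivide DERIV_chain2[OF DERIV_arctan]) (auto intro!: derivative_eq_intros)
    moreover have "inverse (1 + ((y - 1/2) / sqrt \<delta>)\<^sup>2) * (1 / sqrt \<delta>) / sqrt \<delta> = 1 / ((y - 1/2)\<^sup>2 + \<delta>)"
    proof -
      have "inverse (1 + ((y - 1/2) / sqrt \<delta>)\<^sup>2) * (1 / sqrt \<delta>) / sqrt \<delta> = inverse (\<delta> * (1 + ((y - 1/2) / sqrt \<delta>)\<^sup>2))"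
      proof -
        have "inverse X * (1 / s) / s = inverse ((s * s) * X)" for X s :: real
          by (simp add: divide_inverse)
        from this[of _ "sqrt \<delta>"] show ?thesis using \<delta> by simp
      qed
      also have "\<delta> * (1 + ((y - 1/2) / sqrt \<delta>)\<^sup>2) = (y - 1/2)\<^sup>2 + \<delta>"
        using \<delta> by (simp add: power_divide algebra_simps)
      finally show ?thesis by (simp add: inverse_eq_divide)
    qed
    ultimately show ?thesis by simp
  qed
  from fundamental_theorem_of_calculus[OF assms, of "\<lambda>y. arctan ((y - 1/2) / sqrt \<delta>) / sqrt \<delta>" "\<lambda>y. 1 / ((y - 1/2)\<^sup>2 + \<delta>)"]
  show ?thesis using D
    by (simp add: has_real_derivative_iff_has_vector_derivative diff_divide_distrib)
qed

lemma age_diff_lower: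
  assumes "0 \<le> u" "u \<le> v" "v \<le> 1"
  shows "(arctan ((v - 1/2) / sqrt \<delta>) - arctan ((u - 1/2) / sqrt \<delta>)) / (48 * sqrt \<delta>) \<le> age \<delta> v - age \<delta> u"
proof -
  have "integral {u..v} (\<lambda>y. 1/48 * (1 / ((y - 1/2)\<^sup>2 + \<delta>))) \<le> integral {u..v} (\<lambda>y. 1 / den \<delta> y)"
  proof (intro integral_le integrable_on_mult_right)
    show "(\<lambda>y. 1 / ((y - 1/2)\<^sup>2 + \<delta>)) integrable_on {u..v}" using integral_lorentz[OF assms(2)] by blast
    show "(\<lambda>y. 1 / den \<delta> y) integrable_on {u..v}" using recip_den_integrable[of u v "\<lambda>_. 1"] assms by simp
    show "1/48 * (1 / ((y - 1/2)\<^sup>2 + \<delta>)) \<le> 1 / den \<delta> y" if "y \<in> {u..v}" for y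
    proof -
      have "1 / (48 * ((y - 1/2)\<^sup>2 + \<delta>)) \<le> 1 / den \<delta> y"
        using den_upper[of y \<delta>] den_pos[of \<delta> y] that assms \<delta> by (intro divide_left_mono mult_pos_pos add_nonneg_pos) auto
      then show ?thesis by simp
    qed
  qed
  also have "\<dots> = age \<delta> v - age \<delta> u" using age_diff assms by simp
  finally show ?thesis
    unfolding Henstock_Kurzweil_Integration.integral_mult_right integral_unique[OF integral_lorentz[OF assms(2)]]
    by simp
qed

text \<open>
  Each side of the bottleneck at $1/2$ contributes a travel time of order $1/\sqrt\delta$. Both are
  needed later: the first half bounds the mass that passes $1/2$, the second half is the
  amplification lost by sources below $1/2$.
\<close>

lemma age_half_lower:
  assumes "\<delta> \<le> 1"
  shows "arctan (1/2) / (48 * sqrt \<delta>) \<le> age \<delta> (1/2)"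
    and "arctan (1/2) / (48 * sqrt \<delta>) \<le> age \<delta> 1 - age \<delta> (1/2)"
proof -
  have "arctan (1/2) \<le> arctan (1 / (2 * sqrt \<delta>))"
    using assms \<delta> by (intro arctan_monotone') (auto simp: field_simps)
  then have le: "arctan (1/2) / (48 * sqrt \<delta>) \<le> arctan (1 / (2 * sqrt \<delta>)) / (48 * sqrt \<delta>)"
    using \<delta> by (intro divide_right_mono) auto
  have m: "arctan (-1 / (2 * sqrt \<delta>)) = - arctan (1 / (2 * sqrt \<delta>))"
    using arctan_minus[of "1 / (2 * sqrt \<delta>)"] by simp
  show "arctan (1/2) / (48 * sqrt \<delta>) \<le> age \<delta> (1/2)"
    using age_diff_lower[of 0 "1/2"] le m by (simp add: field_simps)
  show "arctan (1/2) / (48 * sqrt \<delta>) \<le> age \<delta> 1 - age \<delta> (1/2)"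
    using age_diff_lower[of "1/2" 1] le by simp
qed

lemma age_1_upper:
  assumes "\<delta> \<le> 1"
  shows "age \<delta> 1 \<le> 128 * pi / sqrt \<delta>"
proof -
  have "integral {0..1} (\<lambda>y. 1 / den \<delta> y) \<le> integral {0..1} (\<lambda>y. 128 * (1 / ((y - 1/2)\<^sup>2 + \<delta>)))"
  proof (intro integral_le integrable_on_mult_right)
    show "(\<lambda>y. 1 / ((y - 1/2)\<^sup>2 + \<delta>)) integrable_on {0..1}" using integral_lorentz[of 0 1] by auto
    show "(\<lambda>y. 1 / den \<delta> y) integrable_on {0..1}" using recip_den_integrable[of 0 1 "\<lambda>_. 1"] by simp
    show "1 / den \<delta> y \<le> 128 * (1 / ((y - 1/2)\<^sup>2 + \<delta>))" if "y \<in> {0..1}" for y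
    proof -
      have "1 / den \<delta> y \<le> 1 / (((y - 1/2)\<^sup>2 + \<delta>) / 128)"
        using den_lower[of y \<delta>] den_pos[of \<delta> y] that assms \<delta> by (intro divide_left_mono mult_pos_pos divide_pos_pos add_nonneg_pos) auto
      then show ?thesis by simp
    qed
  qed
  then have "age \<delta> 1 \<le> 128 * ((arctan (1 / (2 * sqrt \<delta>)) - arctan (- 1 / (2 * sqrt \<delta>))) / sqrt \<delta>)"
    unfolding Henstock_Kurzweil_Integration.integral_mult_right integral_unique[OF integral_lorentz[of 0 1, simplified]]
    by (simp add: age_def)
  also have "\<dots> \<le> 128 * (pi / sqrt \<delta>)"
    using arctan_ubound[of "1 / (2 * sqrt \<delta>)"] arctan_lbound[of "- 1 / (2 * sqrt \<delta>)"] \<delta>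
    by (intro mult_left_mono divide_right_mono) auto
  finally show ?thesis by simp
qed

lemma age_diff_log:
  assumes "1 \<le> z"
  shows "age \<delta> z \<le> age \<delta> 1 + ln z / (1 - x0)\<^sup>2"
proof -
  have I: "((\<lambda>y. 1 / (1 - x0)\<^sup>2 * (1 / y)) has_integral 1 / (1 - x0)\<^sup>2 * (ln z - ln 1)) {1..z}"
    using assms by (intro has_integral_mult_right fundamental_theorem_of_calculus)
      (auto intro!: derivative_eq_intros simp flip: has_real_derivative_iff_has_vector_derivative)
  have "integral {1..z} (\<lambda>y. 1 / den \<delta> y) \<le> integral {1..z} (\<lambda>y. 1 / (1 - x0)\<^sup>2 * (1 / y))"
  proof (intro integral_le)
    show "(\<lambda>y. 1 / (1 - x0)\<^sup>2 * (1 / y)) integrable_on {1..z}" using I by blast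
    show "(\<lambda>y. 1 / den \<delta> y) integrable_on {1..z}" using recip_den_integrable[of 1 z "\<lambda>_. 1"] by simp
    show "1 / den \<delta> y \<le> 1 / (1 - x0)\<^sup>2 * (1 / y)" if "y \<in> {1..z}" for y
    proof -
      have "1 / den \<delta> y \<le> 1 / ((1 - x0)\<^sup>2 * y)"
        using den_ge_linear[of y \<delta>] den_pos[of \<delta> y] that \<delta> x0_bounds
        by (intro divide_left_mono mult_pos_pos) auto
      then show ?thesis by simp
    qed
  qed
  then show ?thesis using age_diff[of 1 z] assms integral_unique[OF I] by simp
qed

end

text \<open>
  Beyond $1$ the travel time is logarithmic, so any exponential weight absorbs $e^{A}$, with a constant
  that does not depend on $\delta$.
\<close>

lemma age_growth:
  assumes "\<beta> > 0"
  obtains K where "K \<ge> 0" "\<And>\<delta> z. \<delta> > 0 \<Longrightarrow> z \<ge> 0 \<Longrightarrow> age \<delta> z \<le> age \<delta> 1 + K + \<beta> * z"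
proof -
  define c where "c = 1 / (1 - x0)\<^sup>2"
  have c: "c > 0" using x0_bounds by (simp add: c_def)
  define K where "K = c * \<bar>ln (c / \<beta>)\<bar>"
  show ?thesis
  proof (rule that[of K])
    show "K \<ge> 0" using c by (simp add: K_def)
    fix \<delta> z :: real assume \<delta>: "\<delta> > 0" and z: "z \<ge> 0"
    show "age \<delta> z \<le> age \<delta> 1 + K + \<beta> * z"
    proof (cases "z \<le> 1")
      case True
      then show ?thesis using age_mono[OF \<delta> z] \<open>K \<ge> 0\<close> assms z by (simp add: add_increasing2)
    next
      case False
      \<comment> \<open>Rescaling before using $\ln t \le t$ turns the logarithm into a multiple of $z$ with slope exactly $\beta$.\<close>
      have "ln z = ln (\<beta> * z / c) + ln (c / \<beta>)"
        using assms c False by (simp add: ln_div ln_mult)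
      also have "ln (\<beta> * z / c) \<le> \<beta> * z / c"
        using assms c False ln_le_minus_one[of "\<beta> * z / c"] by simp
      also have "ln (c / \<beta>) \<le> \<bar>ln (c / \<beta>)\<bar>" by simp
      finally have "c * ln z \<le> c * (\<beta> * z / c + \<bar>ln (c / \<beta>)\<bar>)" using c by (intro mult_left_mono) auto
      also have "\<dots> = \<beta> * z + K" using c by (simp add: K_def algebra_simps)
      finally show ?thesis using age_diff_log[OF \<delta>, of z] False by (simp add: c_def)
    qed
  qed
qed

section \<open>Integrating factors\<close>

text \<open>
  Since $b = 1 + D'$, an antiderivative of $ab$ is $\int 1/D + \ln D$. At $0$ the integrand has the
  integrable singularity $z^{-2/3}$, so the fundamental theorem is applied with derivatives in the
  interior only, and absolute integrability is shown separately.
\<close>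

lemma integral_a_b:
  assumes uv: "0 \<le> u" "u \<le> v" and pos: "\<And>z. z \<in> {u..v} \<Longrightarrow> den \<delta> z > 0"
  shows "(LINT y:{u..v}|lebesgue. a_coef \<delta> y * b_coef \<delta> y)
           = integral {u..v} (\<lambda>y. 1 / den \<delta> y) + ln (den \<delta> v) - ln (den \<delta> u)"
proof -
  have cd: "continuous_on {u..v} (den \<delta>)" using uv by (intro continuous_on_subset[OF continuous_on_den]) auto
  have cr: "continuous_on {u..v} (\<lambda>y. 1 / den \<delta> y)"
    using uv pos by (intro continuous_on_recip_den) auto
  have der: "((\<lambda>x. integral {u..x} (\<lambda>y. 1 / den \<delta> y) + ln (den \<delta> x)) has_real_derivative a_coef \<delta> x * b_coef \<delta> x) (at x)"
    if "x \<in> {u<..<v}" for x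
  proof -
    have "((\<lambda>x. integral {u..x} (\<lambda>y. 1 / den \<delta> y)) has_real_derivative 1 / den \<delta> x) (at x)"
      using integral_has_real_derivative[OF cr, of x] that at_within_Icc_at[of u x v] by simp
    moreover have "((\<lambda>x. ln (den \<delta> x)) has_real_derivative 1 / den \<delta> x * (b_coef \<delta> x - 1)) (at x)"
      using den_deriv[of x \<delta>] pos[of x] that uv by (intro DERIV_chain2[OF DERIV_ln_divide]) auto
    ultimately have "((\<lambda>x. integral {u..x} (\<lambda>y. 1 / den \<delta> y) + ln (den \<delta> x)) has_real_derivative
        1 / den \<delta> x + 1 / den \<delta> x * (b_coef \<delta> x - 1)) (at x)"
      by (rule DERIV_add)
    moreover have "1 / den \<delta> x + 1 / den \<delta> x * (b_coef \<delta> x - 1) = a_coef \<delta> x * b_coef \<delta> x"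
      by (simp add: a_coef_den diff_divide_distrib)
    ultimately show ?thesis by simp
  qed
  have HI: "((\<lambda>y. a_coef \<delta> y * b_coef \<delta> y) has_integral
      (integral {u..v} (\<lambda>y. 1 / den \<delta> y) + ln (den \<delta> v)) - (integral {u..u} (\<lambda>y. 1 / den \<delta> y) + ln (den \<delta> u))) {u..v}"
    using der pos
    by (intro fundamental_theorem_of_calculus_interior[OF uv(2), of "\<lambda>x. integral {u..x} (\<lambda>y. 1 / den \<delta> y) + ln (den \<delta> x)"]
       continuous_intros indefinite_integral_continuous_1 integrable_continuous_real cr cd)
       (force simp: has_real_derivative_iff_has_vector_derivative)+
  have "(\<lambda>y. a_coef \<delta> y * b_coef \<delta> y) absolutely_integrable_on {u..v}"
  proof -
    have "((\<lambda>y. y powr (-2/3)) has_integral (3 * v powr (1/3) - 3 * u powr (1/3))) {u..v}"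
      using uv by (intro fundamental_theorem_of_calculus_interior continuous_intros continuous_on_powr')
        (auto intro!: derivative_eq_intros simp flip: has_real_derivative_iff_has_vector_derivative)
    then have p: "(\<lambda>y. y powr (-2/3)) absolutely_integrable_on {u..v}"
      by (intro nonnegative_absolutely_integrable_1) auto
    have "(\<lambda>y. (2 / den \<delta> y)) absolutely_integrable_on {u..v}"
      using uv pos by (intro absolutely_integrable_continuous_real continuous_on_recip_den) auto
    moreover have "(\<lambda>y. ((\<delta> - lambda_LSW) / 3 / den \<delta> y) * y powr (-2/3)) absolutely_integrable_on {u..v}"
    proof (intro absolutely_integrable_bounded_measurable_product_real p)
      have c: "continuous_on {u..v} (\<lambda>y. (\<delta> - lambda_LSW) / 3 / den \<delta> y)"
        using uv pos by (intro continuous_on_recip_den) auto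
      show "(\<lambda>y. (\<delta> - lambda_LSW) / 3 / den \<delta> y) \<in> borel_measurable (lebesgue_on {u..v})"
        using c by (intro continuous_imp_measurable_on_sets_lebesgue) auto
      show "bounded ((\<lambda>y. (\<delta> - lambda_LSW) / 3 / den \<delta> y) ` {u..v})"
        using c by (intro compact_imp_bounded compact_continuous_image) auto
    qed auto
    ultimately have "(\<lambda>y. 2 / den \<delta> y + ((\<delta> - lambda_LSW) / 3 / den \<delta> y) * y powr (-2/3)) absolutely_integrable_on {u..v}"
      by (rule set_integral_add(1))
    then show ?thesis
    proof (rule set_integrable_cong[THEN iffD1, rotated -1])
      fix y
      have "r * (2 - 1/3 * l * p + 1/3 * d * p) = 2 * r + ((d - l) / 3 * r) * p" for r l p d :: real
        by (simp add: field_simps)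
      from this[of "1 / den \<delta> y"]
      show "2 / den \<delta> y + ((\<delta> - lambda_LSW) / 3 / den \<delta> y) * y powr (-2/3) = a_coef \<delta> y * b_coef \<delta> y"
        by (simp add: a_coef_den b_coef_def)
    qed auto
  qed
  from set_lebesgue_integral_eq_integral(2)[OF this] integral_unique[OF HI]
  show ?thesis by simp
qed

text \<open>
  The number $K_{\gamma,\delta}$ without its prefactor $D(1)\,e^{A(1)}$, and for a variable upper
  limit. The prefactor carries all of the exponential growth: the remaining integral stays between
  positive constants, because $e^{-A}/D = (-e^{-A})'$ has total mass at most $1$.
\<close>

definition kap :: "(real \<Rightarrow> real) \<Rightarrow> real \<Rightarrow> real \<Rightarrow> real" where
  "kap \<gamma> \<delta> s = integral {0..s} (\<lambda>z. \<gamma> z * (exp (- age \<delta> z) / den \<delta> z))"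

context
  fixes \<delta> :: real assumes \<delta>: "\<delta> > 0"
begin

lemma continuous_on_mass_density:
  "continuous_on {0..} \<gamma> \<Longrightarrow> continuous_on {0..} (\<lambda>z. \<gamma> z * (exp (- age \<delta> z) / den \<delta> z))"
  using den_pos[OF \<delta>] continuous_on_age[OF \<delta>]
  by (intro continuous_intros continuous_on_recip_den) auto

lemma integral_mass_density:
  assumes "0 \<le> u" "u \<le> v"
  shows "((\<lambda>z. exp (- age \<delta> z) / den \<delta> z) has_integral (exp (- age \<delta> u) - exp (- age \<delta> v))) {u..v}"
proof -
  have "((\<lambda>z. exp (- age \<delta> z) / den \<delta> z) has_integral (- exp (- age \<delta> v) - (- exp (- age \<delta> u)))) {u..v}"
  proof (rule fundamental_theorem_of_calculus_interior[OF assms(2)])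
    show "continuous_on {u..v} (\<lambda>z. - exp (- age \<delta> z))"
      using assms by (intro continuous_intros continuous_on_subset[OF continuous_on_age[OF \<delta>]]) auto
    show "((\<lambda>z. - exp (- age \<delta> z)) has_vector_derivative exp (- age \<delta> z) / den \<delta> z) (at z)" if "z \<in> {u<..<v}" for z
      using age_deriv[OF \<delta>, of z] that assms
      by (auto intro!: derivative_eq_intros simp flip: has_real_derivative_iff_has_vector_derivative)
  qed
  then show ?thesis by simp
qed

lemma kap_integrable:
  assumes "continuous_on {0..} \<gamma>" "0 \<le> u"
  shows "(\<lambda>z. \<gamma> z * (exp (- age \<delta> z) / den \<delta> z)) integrable_on {u..v}"
  using assms by (intro integrable_continuous_real continuous_on_subset[OF continuous_on_mass_density[OF assms(1)]]) auto

lemma kap_diff: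
  assumes "continuous_on {0..} \<gamma>" "0 \<le> u" "u \<le> v"
  shows "kap \<gamma> \<delta> v - kap \<gamma> \<delta> u = integral {u..v} (\<lambda>z. \<gamma> z * (exp (- age \<delta> z) / den \<delta> z))"
  using Henstock_Kurzweil_Integration.integral_combine[OF assms(2,3) kap_integrable[OF assms(1), of 0 v]]
  by (simp add: kap_def)

lemma kap_diff_le:
  assumes "continuous_on {0..} \<gamma>" "0 \<le> u" "u \<le> v" "\<And>z. u \<le> z \<Longrightarrow> z \<le> v \<Longrightarrow> \<gamma> z \<le> c"
  shows "kap \<gamma> \<delta> v - kap \<gamma> \<delta> u \<le> c * (exp (- age \<delta> u) - exp (- age \<delta> v))"
  unfolding kap_diff[OF assms(1-3)]
proof (rule has_integral_le[OF integrable_integral[OF kap_integrable] has_integral_mult_right[OF integral_mass_density]])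
  show "\<gamma> z * (exp (- age \<delta> z) / den \<delta> z) \<le> c * (exp (- age \<delta> z) / den \<delta> z)" if "z \<in> {u..v}" for z
    using assms(4)[of z] that assms(2) den_pos[OF \<delta>, of z] by (intro mult_right_mono) auto
qed (use assms in auto)

lemma kap_mono:
  assumes "continuous_on {0..} \<gamma>" "0 \<le> u" "u \<le> v" "\<And>z. u \<le> z \<Longrightarrow> z \<le> v \<Longrightarrow> \<gamma> z \<ge> 0"
  shows "kap \<gamma> \<delta> u \<le> kap \<gamma> \<delta> v"
proof -
  have "0 \<le> kap \<gamma> \<delta> v - kap \<gamma> \<delta> u"
    unfolding kap_diff[OF assms(1-3)] using assms den_pos[OF \<delta>]
    by (intro integral_nonneg kap_integrable) (auto intro!: mult_nonneg_nonneg divide_nonneg_nonneg simp: less_imp_le)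
  then show ?thesis by simp
qed

lemma kap_0 [simp]: "kap \<gamma> \<delta> 0 = 0" by (simp add: kap_def)

text \<open>
  The mass in $[1/8,1/4]$, to the left of the bottleneck, is already bounded below uniformly in
  $\delta$.
\<close>

lemma kap_ge:
  assumes \<gamma>: "continuous_on {0..} \<gamma>" "\<And>z. 0 \<le> z \<Longrightarrow> z \<le> 1 \<Longrightarrow> z \<le> \<gamma> z" and \<delta>1: "\<delta> \<le> 1"
  shows "exp (-512) / 192 \<le> kap \<gamma> \<delta> 1"
proof -
  \<comment> \<open>On $[0,1/4]$ the distance to the bottleneck is at least $1/4$; this gives $1/D \le 2048$ and $A \le 2048/4$.\<close>
  have dl: "1/2048 \<le> den \<delta> z" if "0 \<le> z" "z \<le> 1/4" for z
  proof -
    have "(1/4)\<^sup>2 \<le> (1/2 - z)\<^sup>2" using that by (intro power_mono) auto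
    then have "1/16 \<le> (z - 1/2)\<^sup>2" unfolding power2_commute[of z] by (simp add: power2_eq_square)
    then show ?thesis using den_lower[of z \<delta>] \<delta> \<delta>1 that by argo
  qed
  have du: "den \<delta> z \<le> 3" if "0 \<le> z" "z \<le> 1" for z
  proof -
    have "\<delta> * z powr (1/3) \<le> 1 * 1" using cbrt_le_1[OF that] \<delta> \<delta>1 by (intro mult_mono) auto
    moreover have "lambda_LSW * z powr (1/3) \<ge> 0" by (simp add: lambda_LSW_def)
    ultimately show ?thesis using that by (simp add: den_def)
  qed
  have a: "age \<delta> z \<le> 512" if "0 \<le> z" "z \<le> 1/4" for z
  proof -
    have "age \<delta> z \<le> integral {0..z} (\<lambda>y. 2048)"
      unfolding age_def using that recip_den_integrable[OF \<delta>, of 0 z "\<lambda>_. 1"] den_pos[OF \<delta>] dl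
      by (intro integral_le) (auto simp: field_simps)
    then show ?thesis using that by simp
  qed
  have "integral {1/8..1/4::real} (\<lambda>z. 1/8 * (exp (-512) / 3)) \<le> integral {1/8..1/4} (\<lambda>z. \<gamma> z * (exp (- age \<delta> z) / den \<delta> z))"
  proof (intro integral_le kap_integrable \<gamma>(1))
    fix z :: real assume z: "z \<in> {1/8..1/4}"
    have g: "1/8 \<le> \<gamma> z" using \<gamma>(2)[of z] z by simp
    have "exp (-512) / 3 \<le> exp (- age \<delta> z) / den \<delta> z"
      using a[of z] du[of z] den_pos[OF \<delta>, of z] z by (intro frac_le) auto
    then show "1/8 * (exp (-512) / 3) \<le> \<gamma> z * (exp (- age \<delta> z) / den \<delta> z)"
      using g by (intro mult_mono) auto
  qed auto
  also have "\<dots> = kap \<gamma> \<delta> (1/4) - kap \<gamma> \<delta> (1/8)" using \<gamma> by (simp add: kap_diff)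
  also have "\<dots> \<le> kap \<gamma> \<delta> 1"
  proof -
    have g: "0 \<le> \<gamma> z" if "0 \<le> z" "z \<le> 1" for z using \<gamma>(2)[OF that] that by linarith
    have "kap \<gamma> \<delta> 0 \<le> kap \<gamma> \<delta> (1/8)" "kap \<gamma> \<delta> (1/4) \<le> kap \<gamma> \<delta> 1"
      using g by (intro kap_mono \<gamma>(1); simp)+
    then show ?thesis by simp
  qed
  finally show ?thesis by (simp add: field_simps)
qed

lemma kap_le_1:
  assumes "continuous_on {0..} \<gamma>" "\<And>z. 0 \<le> z \<Longrightarrow> z \<le> 1 \<Longrightarrow> \<gamma> z \<le> 1"
  shows "kap \<gamma> \<delta> 1 \<le> 1"
proof -
  have "kap \<gamma> \<delta> 1 \<le> 1 - exp (- age \<delta> 1)"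
    using kap_diff_le[of \<gamma> 0 1 1] assms \<delta> by simp
  then show ?thesis using exp_gt_zero[of "- age \<delta> 1"] by linarith
qed

lemma K_int_eq:
  assumes \<gamma>: "continuous_on {0..} \<gamma>"
  shows "K_int \<gamma> \<delta> = den \<delta> 1 * exp (age \<delta> 1) * kap \<gamma> \<delta> 1"
proof -
  let ?f = "\<lambda>z. (den \<delta> 1 * exp (age \<delta> 1)) * (\<gamma> z * (exp (- age \<delta> z) / den \<delta> z))"
  have "K_int \<gamma> \<delta> = (LINT z:{0..1}|lebesgue. ?f z)"
    unfolding K_int_def
  proof (intro set_lebesgue_integral_cong, simp, intro allI impI)
    fix z :: real assume z: "z \<in> {0..1}"
    have "(LINT y:{z..1}|lebesgue. a_coef \<delta> y * b_coef \<delta> y) = (age \<delta> 1 - age \<delta> z) + ln (den \<delta> 1) - ln (den \<delta> z)"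
      using z den_pos[OF \<delta>] by (subst integral_a_b) (auto simp: age_diff[OF \<delta>])
    then have "exp (LINT y:{z..1}|lebesgue. a_coef \<delta> y * b_coef \<delta> y)
        = exp (age \<delta> 1) * exp (- age \<delta> z) * den \<delta> 1 / den \<delta> z"
      using z den_pos[OF \<delta>, of 1] den_pos[OF \<delta>, of z] by (simp add: exp_add exp_diff exp_minus divide_inverse)
    then show "\<gamma> z * exp (LINT y:{z..1}|lebesgue. a_coef \<delta> y * b_coef \<delta> y) = ?f z" by simp
  qed
  also have "\<dots> = integral {0..1} ?f"
    using \<gamma> by (intro set_lebesgue_integral_eq_integral absolutely_integrable_continuous_real
       continuous_on_mult_left continuous_on_subset[OF continuous_on_mass_density]) auto
  also have "\<dots> = den \<delta> 1 * exp (age \<delta> 1) * kap \<gamma> \<delta> 1"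
    unfolding Henstock_Kurzweil_Integration.integral_mult_right kap_def ..
  finally show ?thesis .
qed

end

section \<open>Self-convolution in exponentially weighted spaces\<close>

lemma lborel_reflect: "distr lborel borel (\<lambda>y. c - y) = (lborel :: real measure)"
  using lborel_real_affine[of "-1" c] by (simp add: density_1)

lemma half_line_sets_lebesgue: "{0::real..} \<in> sets lebesgue" and interval_sets_lebesgue: "{a..b::real} \<in> sets lebesgue"
  by (auto intro!: sets_completionI_sets)

lemma borel_measurable_lebesgue_on_iff:
  fixes f :: "real \<Rightarrow> real"
  assumes "S \<in> sets lebesgue"
  shows "f \<in> borel_measurable (lebesgue_on S) \<longleftrightarrow> (\<lambda>x. indicator S x *\<^sub>R f x) \<in> borel_measurable lebesgue"
  using assms by (intro borel_measurable_restrict_space_iff) auto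

text \<open>
  For a Lebesgue measurable function the integrand $\Phi(\xi-y)\Phi(y)$ need not be measurable in the
  product sense. A Borel representative repairs this, and since reflections preserve null sets it
  represents the integrand for every single $\xi$, not only for almost every one.
\<close>

lemma conv_borel_representative:
  fixes \<Phi> :: "real \<Rightarrow> real"
  assumes \<Phi>: "\<Phi> \<in> borel_measurable (lebesgue_on {0..})"
  obtains F where "F \<in> borel_measurable borel"
    "\<And>\<xi>. \<xi> \<ge> 0 \<Longrightarrow> AE y in lborel. indicator {0..\<xi>} y *\<^sub>R (\<Phi> (\<xi> - y) * \<Phi> y) = F (\<xi> - y) * F y"
proof -
  define f where "f = (\<lambda>z. indicator {0..} z *\<^sub>R \<Phi> z)"
  have "f \<in> borel_measurable lebesgue"
    unfolding f_def by (rule borel_measurable_lebesgue_on_iff[OF half_line_sets_lebesgue, THEN iffD1, OF \<Phi>])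
  then obtain F where F: "F \<in> borel_measurable lborel" "AE y in lborel. f y = F y"
    using completion_ex_borel_measurable_real by blast
  show ?thesis
  proof (rule that[of F])
    show "F \<in> borel_measurable borel" using F(1) by simp
    fix \<xi> :: real assume \<xi>: "\<xi> \<ge> 0"
    have "AE y in distr lborel borel (\<lambda>y. \<xi> - y). f y = F y" using F(2) unfolding lborel_reflect .
    then have "AE y in lborel. f (\<xi> - y) = F (\<xi> - y)" by (rule AE_distrD[rotated]) simp
    with F(2) show "AE y in lborel. indicator {0..\<xi>} y *\<^sub>R (\<Phi> (\<xi> - y) * \<Phi> y) = F (\<xi> - y) * F y"
    proof eventually_elim
      case (elim y)
      have "indicator {0..\<xi>} y *\<^sub>R (\<Phi> (\<xi> - y) * \<Phi> y) = f (\<xi> - y) * f y"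
        by (auto simp: f_def indicator_def)
      then show ?case using elim by simp
    qed
  qed
qed

lemma conv_eq_borel:
  assumes \<Phi>: "\<Phi> \<in> borel_measurable (lebesgue_on {0..})"
  shows "\<exists>h\<in>borel_measurable borel. \<forall>\<xi>\<ge>0. conv \<Phi> \<Phi> \<xi> = h \<xi>"
proof -
  obtain F where F [measurable]: "F \<in> borel_measurable borel"
    and AE: "\<And>\<xi>. \<xi> \<ge> 0 \<Longrightarrow> AE y in lborel. indicator {0..\<xi>} y *\<^sub>R (\<Phi> (\<xi> - y) * \<Phi> y) = F (\<xi> - y) * F y"
    using conv_borel_representative[OF \<Phi>] by blast
  define h where "h \<xi> = 1/2 * (\<integral>y. F (\<xi> - y) * F y \<partial>lborel)" for \<xi>
  have "h \<in> borel_measurable borel" unfolding h_def by measurable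
  moreover have "conv \<Phi> \<Phi> \<xi> = h \<xi>" if "\<xi> \<ge> 0" for \<xi>
  proof -
    have "(\<integral>y. indicator {0..\<xi>} y *\<^sub>R (\<Phi> (\<xi> - y) * \<Phi> y) \<partial>lebesgue) = (\<integral>y. F (\<xi> - y) * F y \<partial>lebesgue)"
    proof (rule integral_cong_AE)
      have m: "(\<lambda>y. F (\<xi> - y) * F y) \<in> borel_measurable lebesgue" by (intro measurable_completion) measurable
      have "AE y in lebesgue. F (\<xi> - y) * F y = indicator {0..\<xi>} y *\<^sub>R (\<Phi> (\<xi> - y) * \<Phi> y)"
        using AE_completion[OF AE[OF that]] by (auto elim: eventually_mono)
      from borel_measurable_AE[OF m this]
      show "(\<lambda>y. indicator {0..\<xi>} y *\<^sub>R (\<Phi> (\<xi> - y) * \<Phi> y)) \<in> borel_measurable lebesgue" .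
      show "(\<lambda>y. F (\<xi> - y) * F y) \<in> borel_measurable lebesgue" by (rule m)
      show "AE y in lebesgue. indicator {0..\<xi>} y *\<^sub>R (\<Phi> (\<xi> - y) * \<Phi> y) = F (\<xi> - y) * F y"
        by (rule AE_completion[OF AE[OF that]])
    qed
    also have "\<dots> = (\<integral>y. F (\<xi> - y) * F y \<partial>lborel)" by (intro integral_completion) measurable
    finally show ?thesis by (simp add: conv_def h_def set_lebesgue_integral_def)
  qed
  ultimately show ?thesis by blast
qed

lemma conv_measurable:
  assumes \<Phi>: "\<Phi> \<in> borel_measurable (lebesgue_on {0..})"
  shows "conv \<Phi> \<Phi> \<in> borel_measurable (lebesgue_on {0..})"
proof -
  obtain h where h: "h \<in> borel_measurable borel" "\<And>\<xi>. \<xi> \<ge> 0 \<Longrightarrow> conv \<Phi> \<Phi> \<xi> = h \<xi>"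
    using conv_eq_borel[OF \<Phi>] by blast
  have "h \<in> borel_measurable (lebesgue_on {0..})"
    using measurable_completion[of h lborel borel] h(1) by (intro measurable_restrict_space1) auto
  then show ?thesis by (subst measurable_cong[where g = h]) (auto simp: h(2))
qed

text \<open>
  Exponential weights are compatible with convolution: $e^{-\beta(\xi-y)} e^{-\beta y}$ does not depend
  on $y$.
\<close>

lemma conv_integrand_bound:
  fixes \<Phi>1 \<Phi>2 :: "real \<Rightarrow> real"
  assumes "\<And>z. z \<ge> 0 \<Longrightarrow> \<bar>\<Phi>1 z\<bar> \<le> S1 * exp (- \<beta> * z)" "\<And>z. z \<ge> 0 \<Longrightarrow> \<bar>\<Phi>2 z\<bar> \<le> S2 * exp (- \<beta> * z)" "y \<in> {0..\<xi>}"
  shows "\<bar>\<Phi>1 (\<xi> - y) * \<Phi>2 y\<bar> \<le> S1 * S2 * exp (- \<beta> * \<xi>)"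
proof -
  have "\<bar>\<Phi>1 (\<xi> - y) * \<Phi>2 y\<bar> \<le> (S1 * exp (- \<beta> * (\<xi> - y))) * (S2 * exp (- \<beta> * y))"
  proof -
    have y: "0 \<le> \<xi> - y" "0 \<le> y" using assms(3) by auto
    show ?thesis
      unfolding abs_mult using assms(1)[OF y(1)] assms(2)[OF y(2)]
      by (rule mult_mono) (use order_trans[OF abs_ge_zero assms(1)[OF y(1)]] in auto)
  qed
  also have "\<dots> = S1 * S2 * (exp (- \<beta> * (\<xi> - y)) * exp (- \<beta> * y))" by simp
  also have "exp (- \<beta> * (\<xi> - y)) * exp (- \<beta> * y) = exp (- \<beta> * \<xi>)" by (simp add: algebra_simps flip: exp_add)
  finally show ?thesis .
qed

text \<open>
  A function that is not integrable has integral $0$ by convention and satisfies the bound trivially.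
\<close>

lemma set_integral_interval_bound:
  fixes f :: "real \<Rightarrow> real"
  assumes "0 \<le> \<xi>" "\<And>y. y \<in> {0..\<xi>} \<Longrightarrow> \<bar>f y\<bar> \<le> c" "0 \<le> c"
  shows "\<bar>LINT y:{0..\<xi>}|lebesgue. f y\<bar> \<le> c * \<xi>"
proof (cases "set_integrable lebesgue {0..\<xi>} f")
  case True
  have "\<bar>integral {0..\<xi>} f\<bar> \<le> c * \<xi>"
    using integral_norm_bound_integral[OF set_lebesgue_integral_eq_integral(1)[OF True], of "\<lambda>_. c"] assms integrable_const_ivl[of c 0 \<xi>]
    by (simp add: mult.commute)
  then show ?thesis using set_lebesgue_integral_eq_integral(2)[OF True] by simp
next
  case False
  then show ?thesis using assms by (simp add: set_lebesgue_integral_def set_integrable_def not_integrable_integral_eq)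
qed

lemma conv_bound:
  assumes "\<And>z. z \<ge> 0 \<Longrightarrow> \<bar>\<Phi>1 z\<bar> \<le> S1 * exp (- \<beta> * z)" "\<And>z. z \<ge> 0 \<Longrightarrow> \<bar>\<Phi>2 z\<bar> \<le> S2 * exp (- \<beta> * z)"
    "0 \<le> S1" "0 \<le> S2" "0 \<le> \<xi>"
  shows "\<bar>conv \<Phi>1 \<Phi>2 \<xi>\<bar> \<le> S1 * S2 / 2 * (\<xi> * exp (- \<beta> * \<xi>))"
proof -
  have "\<bar>LINT y:{0..\<xi>}|lebesgue. \<Phi>1 (\<xi> - y) * \<Phi>2 y\<bar> \<le> (S1 * S2 * exp (- \<beta> * \<xi>)) * \<xi>"
    using assms conv_integrand_bound[of \<Phi>1 S1 \<beta> \<Phi>2 S2] by (intro set_integral_interval_bound) auto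
  then show ?thesis by (simp add: conv_def mult_ac)
qed

lemma conv_integrand_integrable:
  fixes \<Phi> :: "real \<Rightarrow> real"
  assumes \<Phi>: "\<Phi> \<in> borel_measurable (lebesgue_on {0..})"
    and b: "\<And>z. z \<ge> 0 \<Longrightarrow> \<bar>\<Phi> z\<bar> \<le> S * exp (- \<beta> * z)" and "0 \<le> \<xi>"
  shows "set_integrable lebesgue {0..\<xi>} (\<lambda>y. \<Phi> (\<xi> - y) * \<Phi> y)"
proof -
  obtain F where F [measurable]: "F \<in> borel_measurable borel"
    and AE: "\<And>\<xi>. \<xi> \<ge> 0 \<Longrightarrow> AE y in lborel. indicator {0..\<xi>} y *\<^sub>R (\<Phi> (\<xi> - y) * \<Phi> y) = F (\<xi> - y) * F y"
    using conv_borel_representative[OF \<Phi>] by blast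
  have m: "(\<lambda>y. F (\<xi> - y) * F y) \<in> borel_measurable lebesgue" by (intro measurable_completion) measurable
  have "AE y in lebesgue. F (\<xi> - y) * F y = indicator {0..\<xi>} y *\<^sub>R (\<Phi> (\<xi> - y) * \<Phi> y)"
    using AE_completion[OF AE[OF assms(3)]] by (auto elim: eventually_mono)
  from borel_measurable_AE[OF m this]
  have "(\<lambda>y. \<Phi> (\<xi> - y) * \<Phi> y) \<in> borel_measurable (lebesgue_on {0..\<xi>})"
    by (rule borel_measurable_lebesgue_on_iff[OF interval_sets_lebesgue, THEN iffD2])
  then show ?thesis
  proof (rule measurable_bounded_by_integrable_imp_absolutely_integrable[where g = "\<lambda>_. S * S * exp (- \<beta> * \<xi>)"])
    show "norm (\<Phi> (\<xi> - y) * \<Phi> y) \<le> S * S * exp (- \<beta> * \<xi>)" if "y \<in> {0..\<xi>}" for y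
      unfolding real_norm_def by (rule conv_integrand_bound[OF b b that])
  qed auto
qed

lemma conv_diff_bound:
  assumes \<Phi>: "\<Phi> \<in> borel_measurable (lebesgue_on {0..})" and \<Psi>: "\<Psi> \<in> borel_measurable (lebesgue_on {0..})"
    and b\<Phi>: "\<And>z. z \<ge> 0 \<Longrightarrow> \<bar>\<Phi> z\<bar> \<le> S * exp (- \<beta> * z)" and b\<Psi>: "\<And>z. z \<ge> 0 \<Longrightarrow> \<bar>\<Psi> z\<bar> \<le> S * exp (- \<beta> * z)"
    and d: "\<And>z. z \<ge> 0 \<Longrightarrow> \<bar>\<Phi> z - \<Psi> z\<bar> \<le> r * exp (- \<beta> * z)"
    and pos: "0 \<le> S" "0 \<le> r" "0 \<le> \<xi>"
  shows "\<bar>conv \<Phi> \<Phi> \<xi> - conv \<Psi> \<Psi> \<xi>\<bar> \<le> S * r * (\<xi> * exp (- \<beta> * \<xi>))"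
proof -
  have "conv \<Phi> \<Phi> \<xi> - conv \<Psi> \<Psi> \<xi> = 1/2 * (LINT y:{0..\<xi>}|lebesgue. \<Phi> (\<xi> - y) * \<Phi> y - \<Psi> (\<xi> - y) * \<Psi> y)"
    using set_integral_diff(2)[OF conv_integrand_integrable[OF \<Phi> b\<Phi> pos(3)] conv_integrand_integrable[OF \<Psi> b\<Psi> pos(3)]]
    by (simp add: conv_def algebra_simps)
  moreover have "\<bar>LINT y:{0..\<xi>}|lebesgue. \<Phi> (\<xi> - y) * \<Phi> y - \<Psi> (\<xi> - y) * \<Psi> y\<bar> \<le> (2 * (S * r * exp (- \<beta> * \<xi>))) * \<xi>"
  proof (rule set_integral_interval_bound)
    fix y assume y: "y \<in> {0..\<xi>}"
    \<comment> \<open>One factor is exchanged at a time.\<close>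
    have "\<Phi> (\<xi> - y) * \<Phi> y - \<Psi> (\<xi> - y) * \<Psi> y = (\<Phi> (\<xi> - y) - \<Psi> (\<xi> - y)) * \<Phi> y + \<Psi> (\<xi> - y) * (\<Phi> y - \<Psi> y)"
      by (simp add: algebra_simps)
    moreover have "\<bar>(\<Phi> (\<xi> - y) - \<Psi> (\<xi> - y)) * \<Phi> y\<bar> \<le> r * S * exp (- \<beta> * \<xi>)"
      using conv_integrand_bound[of "\<lambda>z. \<Phi> z - \<Psi> z" r \<beta> \<Phi> S y \<xi>] d b\<Phi> y by simp
    moreover have "\<bar>\<Psi> (\<xi> - y) * (\<Phi> y - \<Psi> y)\<bar> \<le> S * r * exp (- \<beta> * \<xi>)"
      using conv_integrand_bound[of \<Psi> S \<beta> "\<lambda>z. \<Phi> z - \<Psi> z" r y \<xi>] d b\<Psi> y by simp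
    ultimately show "\<bar>\<Phi> (\<xi> - y) * \<Phi> y - \<Psi> (\<xi> - y) * \<Psi> y\<bar> \<le> 2 * (S * r * exp (- \<beta> * \<xi>))"
      by (simp add: mult.commute[of r])
  qed (use pos in auto)
  ultimately show ?thesis by (simp only: abs_mult) (simp add: mult_ac)
qed

section \<open>The LSW profile\<close>

lemma den0_pos_left: "0 \<le> z \<Longrightarrow> z < 1/2 \<Longrightarrow> den 0 z > 0"
  by (rule den0_pos) auto

lemma den0_le_1: "0 \<le> z \<Longrightarrow> z \<le> 1/2 \<Longrightarrow> den 0 z \<le> 1"
  using den0_antimono[of 0 z] by (simp add: den_def)

lemma age0_continuous:
  assumes "w < 1/2"
  shows "continuous_on {0..w} (age 0)"
  unfolding age_def[abs_def] using assms
  by (intro indefinite_integral_continuous_1 integrable_continuous_real continuous_on_recip_den den0_pos_left) auto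

lemma age0_deriv:
  assumes "0 < z" "z < 1/2"
  shows "(age 0 has_real_derivative 1 / den 0 z) (at z)"
proof -
  obtain w where w: "z < w" "w < 1/2" using assms(2) dense by blast
  have "continuous_on {0..w} (\<lambda>y. 1 / den 0 y)"
    using w by (intro continuous_on_recip_den den0_pos_left) auto
  then show ?thesis
    using integral_has_real_derivative[of 0 w "\<lambda>y. 1 / den 0 y" z] at_within_Icc_at[of 0 z w] w assms
    unfolding age_def[abs_def] by simp
qed

lemma age0_nonneg: "0 \<le> z \<Longrightarrow> z < 1/2 \<Longrightarrow> 0 \<le> age 0 z"
  unfolding age_def using den0_pos_left
  by (intro integral_nonneg integrable_continuous_real continuous_on_recip_den) (auto simp: less_imp_le)

lemma age0_mono:
  assumes "0 \<le> z" "z \<le> w" "w < 1/2"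
  shows "age 0 z \<le> age 0 w"
proof (rule DERIV_nonneg_imp_increasing_open[OF assms(2)])
  show "\<exists>d. (age 0 has_real_derivative d) (at x) \<and> 0 \<le> d" if "z < x" "x < w" for x
    using age0_deriv[of x] den0_pos_left[of x] that assms by (intro exI[of _ "1 / den 0 x"]) auto
  show "continuous_on {z..w} (age 0)"
    using assms by (intro continuous_on_subset[OF age0_continuous]) auto
qed

lemma LSW_profile_eq:
  "LSW_profile C z = (if 0 \<le> z \<and> z < 1/2 then C * (exp (- age 0 z) / den 0 z) else 0)"
proof (cases "0 \<le> z \<and> z < 1/2")
  case True
  have "(LINT y:{0..z}|lebesgue. a_coef 0 y * b_coef 0 y) = age 0 z + ln (den 0 z) - ln (den 0 0)"
    unfolding age_def using True by (intro integral_a_b den0_pos_left) auto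
  then have "exp (- (LINT y:{0..z}|lebesgue. a_coef 0 y * b_coef 0 y)) = exp (- age 0 z - ln (den 0 z))"
    by (simp add: den_def[of 0 0])
  also have "\<dots> = exp (- age 0 z) / den 0 z"
    using True den0_pos_left[of z] by (simp add: exp_diff)
  finally show ?thesis using True by (simp add: LSW_profile_def)
qed (auto simp: LSW_profile_def)

lemma b_coef0_nonneg:
  assumes "1/4 \<le> z"
  shows "0 \<le> b_coef 0 z"
proof -
  define q where "q = z powr (2/3)"
  have q: "q > 0" using assms by (simp add: q_def)
  have q3: "q ^ 3 = z\<^sup>2" using assms by (simp add: q_def powr_power powr_numeral)
  have "x0\<^sup>2 / 2 \<le> q"
  proof (rule ccontr)
    assume "\<not> x0\<^sup>2 / 2 \<le> q"
    then have "q ^ 3 \<le> (x0\<^sup>2 / 2) ^ 3" using q by (intro power_mono) auto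
    also have "\<dots> = (x0 ^ 3)\<^sup>2 / 8" by (simp add: power_divide power_mult[symmetric] mult.commute)
    also have "\<dots> = 1/32" unfolding x0_cube by (simp add: power2_eq_square)
    finally have "z\<^sup>2 \<le> 1/32" using q3 by simp
    moreover have "(1/4)\<^sup>2 \<le> z\<^sup>2" using assms by (intro power_mono) auto
    ultimately show False by (simp add: power2_eq_square)
  qed
  then have "x0\<^sup>2 * (1 / q) \<le> 2" using q by (simp add: field_simps)
  moreover have "z powr (-2/3) = 1 / q" using assms by (simp add: q_def powr_minus_divide)
  ultimately show ?thesis by (simp add: b_coef_def lambda_eq)
qed

text \<open>
  As $z \to 1/2$ the denominator tends to $0$, but $e^{-A}$ decays faster: on $[1/4,1/2)$ one has
  $b_0 \ge 0$, so the quotient, whose logarithmic derivative is $-a_0 b_0$, decreases there. To the left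
  of $1/4$ the denominator itself is bounded below.
\<close>

lemma profile_bound:
  assumes "0 \<le> z" "z < 1/2"
  shows "exp (- age 0 z) / den 0 z \<le> 1 / den 0 (1/4)"
proof (cases "z \<le> 1/4")
  case True
  then show ?thesis using assms den0_antimono[of z "1/4"] age0_nonneg[of z] den0_pos_left[of "1/4"]
    by (intro frac_le) auto
next
  case False
  have "exp (- age 0 z) / den 0 z \<le> exp (- age 0 (1/4)) / den 0 (1/4)"
  proof (rule DERIV_nonpos_imp_nonincreasing[of "1/4" z "\<lambda>x. exp (- age 0 x) / den 0 x"])
    show "1/4 \<le> z" using False by simp
    fix x assume x: "1/4 \<le> x" "x \<le> z"
    have pos: "den 0 x > 0" using x assms den0_pos_left[of x] by simp
    have "((\<lambda>x. exp (- age 0 x) / den 0 x) has_real_derivative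
        ((exp (- age 0 x) * (- (1 / den 0 x))) * den 0 x - exp (- age 0 x) * (b_coef 0 x - 1)) / (den 0 x * den 0 x)) (at x)"
      using x assms pos age0_deriv[of x] den_deriv[of x 0]
      by (intro DERIV_divide DERIV_fun_exp DERIV_minus) auto
    moreover have "((exp (- age 0 x) * (- (1 / den 0 x))) * den 0 x - exp (- age 0 x) * (b_coef 0 x - 1)) / (den 0 x * den 0 x) \<le> 0"
    proof -
      have "(exp (- age 0 x) * (- (1 / den 0 x))) * den 0 x - exp (- age 0 x) * (b_coef 0 x - 1) = - (exp (- age 0 x) * b_coef 0 x)"
        using pos by (simp add: field_simps)
      then show ?thesis using b_coef0_nonneg[OF x(1)] pos by (simp add: divide_nonpos_pos)
    qed
    ultimately show "\<exists>y. ((\<lambda>x. exp (- age 0 x) / den 0 x) has_real_derivative y) (at x) \<and> y \<le> 0" by blast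
  qed
  also have "\<dots> \<le> 1 / den 0 (1/4)"
    using age0_nonneg[of "1/4"] den0_pos_left[of "1/4"] by (intro divide_right_mono) auto
  finally show ?thesis .
qed

lemma profile_lower:
  assumes "0 \<le> z" "z \<le> w" "w < 1/2"
  shows "exp (- age 0 w) \<le> exp (- age 0 z) / den 0 z"
proof -
  have "exp (- age 0 w) / 1 \<le> exp (- age 0 z) / den 0 z"
    using assms age0_mono[of z w] den0_le_1[of z] den0_pos_left[of z] by (intro frac_le) auto
  then show ?thesis by simp
qed

lemma LSW_profile_measurable: "LSW_profile C \<in> borel_measurable borel"
proof -
  have "continuous_on {0..<1/2} (\<lambda>z. C * (exp (- age 0 z) / den 0 z))"
  proof -
    have "continuous_on {0..<1/2} (age 0)"
      unfolding continuous_on_eq_continuous_within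
    proof
      fix z :: real assume z: "z \<in> {0..<1/2}"
      then obtain w where w: "z < w" "w < 1/2" using dense[of z "1/2"] by auto
      then have "continuous (at z within {0..w}) (age 0)"
        using age0_continuous[of w] z by (auto simp: continuous_on_eq_continuous_within)
      \<comment> \<open>Continuity is known on compact subintervals only; near $z$ they agree with the half-open one.\<close>
      moreover have "at z within {0..w} = at z within {0..<1/2}"
        using w z at_within_nhd[of z "{..<w}" "{0..w}" "{0..<1/2}"] by force
      ultimately show "continuous (at z within {0..<1/2}) (age 0)" by simp
    qed
    then show ?thesis using den0_pos_left by (intro continuous_intros continuous_on_recip_den) auto
  qed
  then have "(\<lambda>z. if z \<in> {0..<1/2} then C * (exp (- age 0 z) / den 0 z) else 0) \<in> borel_measurable borel"
    by (intro borel_measurable_continuous_on_if) auto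
  moreover have "LSW_profile C = (\<lambda>z. if z \<in> {0..<1/2} then C * (exp (- age 0 z) / den 0 z) else 0)"
    by (auto simp: LSW_profile_eq)
  ultimately show ?thesis by simp
qed

lemma LSW_profile_scale: "LSW_profile C z = C * LSW_profile 1 z"
  by (simp add: LSW_profile_eq)

lemma LSW_profile_1_bounds: "0 \<le> LSW_profile 1 z" "LSW_profile 1 z \<le> 1 / den 0 (1/4)"
  using profile_bound[of z] den0_pos_left[of z] den0_pos_left[of "1/4"] by (auto simp: LSW_profile_eq)

lemma LSW_mass_pos: "(LINT z:{0..}|lebesgue. z * LSW_profile 1 z) > 0"
proof -
  define f where "f z = indicator {0..} z *\<^sub>R (z * LSW_profile 1 z)" for z
  have fb: "0 \<le> f z" "f z \<le> indicator {0..1} z *\<^sub>R (1 / den 0 (1/4))" for z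
  proof -
    show "0 \<le> f z" using LSW_profile_1_bounds[of z] by (auto simp: f_def indicator_def)
    show "f z \<le> indicator {0..1} z *\<^sub>R (1 / den 0 (1/4))"
    proof (cases "0 \<le> z \<and> z < 1/2")
      case True
      then have "z * LSW_profile 1 z \<le> 1 * (1 / den 0 (1/4))"
        using LSW_profile_1_bounds[of z] by (intro mult_mono) auto
      then show ?thesis using True by (simp add: f_def)
    next
      case False
      then show ?thesis using den0_pos_left[of "1/4"] by (auto simp: f_def LSW_profile_eq)
    qed
  qed
  have m: "f \<in> borel_measurable lebesgue"
    using LSW_profile_measurable[of 1] unfolding f_def by (intro measurable_completion) measurable
  have int: "integrable lebesgue f"
  proof (rule Bochner_Integration.integrable_bound[OF _ m])
    show "integrable lebesgue (\<lambda>z::real. indicator {0..1} z *\<^sub>R (1 / den 0 (1/4)))"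
      using absolutely_integrable_on_const[of "{0..1::real}" "1 / den 0 (1/4)"] by (simp add: set_integrable_def)
    show "AE z in lebesgue. norm (f z) \<le> norm (indicator {0..1} z *\<^sub>R (1 / den 0 (1/4)))"
    proof (rule AE_I2)
      fix z
      have "norm (f z) = f z" using fb(1)[of z] by simp
      also note fb(2)[of z]
      also note abs_ge_self
      finally show "norm (f z) \<le> norm (indicator {0..1} z *\<^sub>R (1 / den 0 (1/4)))" by simp
    qed
  qed
  let ?c = "1/8 * exp (- age 0 (1/4))"
  have "(\<integral>z. indicator {1/8..1/4::real} z *\<^sub>R ?c \<partial>lebesgue) \<le> (\<integral>z. f z \<partial>lebesgue)"
  proof (rule integral_mono[OF _ int])
    show "integrable lebesgue (\<lambda>z::real. indicator {1/8..1/4} z *\<^sub>R ?c)"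
      using absolutely_integrable_on_const[of "{1/8..1/4::real}" ?c] by (simp add: set_integrable_def)
    show "indicator {1/8..1/4} z *\<^sub>R ?c \<le> f z" for z
    proof (cases "z \<in> {1/8..1/4}")
      case True
      then have "1/8 * exp (- age 0 (1/4)) \<le> z * (exp (- age 0 z) / den 0 z)"
        using profile_lower[of z "1/4"] by (intro mult_mono) auto
      then show ?thesis using True by (simp add: f_def LSW_profile_eq)
    next
      case False
      then show ?thesis using fb(1)[of z] by simp
    qed
  qed
  moreover have "(\<integral>z. indicator {1/8..1/4} z *\<^sub>R ?c \<partial>(lebesgue :: real measure)) = 1/8 * ?c"
    by simp
  ultimately have "(\<integral>z. f z \<partial>lebesgue) \<ge> 1/8 * ?c" by simp
  then show ?thesis unfolding f_def set_lebesgue_integral_def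
    using less_le_trans[of 0 "1/8 * ?c"] by simp
qed

lemma C_star_pos: "C_star > 0"
proof -
  define J where "J = (LINT z:{0..}|lebesgue. z * LSW_profile 1 z)"
  have J: "J > 0" using LSW_mass_pos by (simp add: J_def)
  have "(LINT z:{0..}|lebesgue. z * LSW_profile C z) = C * J" for C
    unfolding J_def set_lebesgue_integral_def by (subst LSW_profile_scale) (simp add: mult.left_commute[of _ C])
  then have "C_star = (THE C. C * J = 1)" by (simp add: C_star_def)
  also have "\<dots> = 1 / J" using J by (intro the_equality) (auto simp: field_simps)
  finally have "C_star = 1 / J" .
  moreover have "0 < 1 / J" using J by simp
  ultimately show ?thesis by (simp only:)
qed

definition LSW_sup :: real where "LSW_sup = C_star / den 0 (1/4)"

lemma LSW_sup_pos: "LSW_sup > 0"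
  using C_star_pos den0_pos_left[of "1/4"] by (simp add: LSW_sup_def)

lemma Phi_LSW_bounds: "0 \<le> Phi_LSW z" "Phi_LSW z \<le> LSW_sup"
proof -
  have e: "Phi_LSW z = C_star * LSW_profile 1 z" unfolding Phi_LSW_def by (rule LSW_profile_scale)
  show "0 \<le> Phi_LSW z" unfolding e using LSW_profile_1_bounds[of z] C_star_pos by simp
  have "C_star * LSW_profile 1 z \<le> C_star * (1 / den 0 (1/4))"
    using LSW_profile_1_bounds[of z] C_star_pos by (intro mult_left_mono) auto
  then show "Phi_LSW z \<le> LSW_sup" unfolding e by (simp add: LSW_sup_def)
qed

lemma Phi_LSW_zero: "1/2 \<le> z \<Longrightarrow> Phi_LSW z = 0"
  by (simp add: Phi_LSW_def LSW_profile_def)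

lemma Phi_LSW_measurable: "Phi_LSW \<in> borel_measurable borel"
  unfolding Phi_LSW_def by (rule LSW_profile_measurable)

lemma Phi_LSW_measurable_on: "Phi_LSW \<in> borel_measurable (lebesgue_on S)"
  using measurable_completion[of Phi_LSW lborel borel] Phi_LSW_measurable by (intro measurable_restrict_space1) auto

lemma Phi_LSW_lower:
  assumes "0 \<le> z" "z \<le> 7/16"
  shows "C_star * exp (- age 0 (7/16)) \<le> Phi_LSW z"
  using mult_left_mono[OF profile_lower[of z "7/16"], of C_star] assms C_star_pos
  by (simp add: Phi_LSW_def LSW_profile_eq)

definition h_LSW :: "real \<Rightarrow> real" where "h_LSW = conv Phi_LSW Phi_LSW"

text \<open>
  The profile vanishes beyond $1/2$, so it is dominated by every exponential once the constant
  accounts for $[0,1]$.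
\<close>

lemma Phi_LSW_exp_bound:
  assumes "\<beta> > 0" "0 \<le> z"
  shows "\<bar>Phi_LSW z\<bar> \<le> (LSW_sup * exp \<beta>) * exp (- \<beta> * z)"
proof (cases "z \<le> 1")
  case True
  have "LSW_sup * 1 \<le> LSW_sup * exp (\<beta> - \<beta> * z)"
    using True assms LSW_sup_pos mult_left_le[of z \<beta>] by (intro mult_left_mono) auto
  also have "\<dots> = (LSW_sup * exp \<beta>) * exp (- \<beta> * z)" by (simp add: exp_diff exp_minus divide_inverse)
  finally show ?thesis using Phi_LSW_bounds[of z] by simp
next
  case False
  then show ?thesis using Phi_LSW_zero[of z] LSW_sup_pos by simp
qed

lemma h_LSW_nonneg: "0 \<le> h_LSW \<xi>"
  unfolding h_LSW_def conv_def set_lebesgue_integral_def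
  using Phi_LSW_bounds(1) by (simp add: Bochner_Integration.integral_nonneg)

lemma h_LSW_zero:
  assumes "1 \<le> \<xi>"
  shows "h_LSW \<xi> = 0"
proof -
  have "(\<lambda>y. Phi_LSW (\<xi> - y) * Phi_LSW y) = (\<lambda>_. 0)"
  proof
    fix y show "Phi_LSW (\<xi> - y) * Phi_LSW y = 0"
    using Phi_LSW_zero[of y] Phi_LSW_zero[of "\<xi> - y"] assms by (cases "y \<ge> 1/2") auto
  qed
  then show ?thesis by (simp add: h_LSW_def conv_def set_lebesgue_integral_def)
qed

lemma h_LSW_bounded: obtains H where "H > 0" "\<And>\<xi>. 0 \<le> \<xi> \<Longrightarrow> h_LSW \<xi> \<le> H"
proof (rule that[of "LSW_sup * exp 1 * (LSW_sup * exp 1) / 2"])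
  show "LSW_sup * exp 1 * (LSW_sup * exp 1) / 2 > 0" using LSW_sup_pos by simp
  fix \<xi> :: real assume \<xi>: "0 \<le> \<xi>"
  have "\<bar>h_LSW \<xi>\<bar> \<le> LSW_sup * exp 1 * (LSW_sup * exp 1) / 2 * (\<xi> * exp (- 1 * \<xi>))"
    unfolding h_LSW_def using Phi_LSW_exp_bound[of 1] LSW_sup_pos \<xi> by (intro conv_bound) auto
  also have "\<xi> * exp (- 1 * \<xi>) \<le> 1"
  proof -
    have "\<xi> \<le> exp \<xi>" using exp_ge_add_one_self[of \<xi>] by linarith
    then show ?thesis by (simp add: exp_minus field_simps)
  qed
  finally show "h_LSW \<xi> \<le> LSW_sup * exp 1 * (LSW_sup * exp 1) / 2"
    using LSW_sup_pos by (simp add: mult_left_mono)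
qed

lemma h_LSW_lower: obtains m where "m > 0" "\<And>\<xi>. 5/8 \<le> \<xi> \<Longrightarrow> \<xi> \<le> 3/4 \<Longrightarrow> m \<le> h_LSW \<xi>"
proof -
  define p where "p = C_star * exp (- age 0 (7/16))"
  have p: "p > 0" using C_star_pos by (simp add: p_def)
  show ?thesis
  proof (rule that[of "p\<^sup>2 / 32"])
    show "p\<^sup>2 / 32 > 0" using p by simp
    fix \<xi> :: real assume \<xi>: "5/8 \<le> \<xi>" "\<xi> \<le> 3/4"
    \<comment> \<open>For $y \in [3/8, 7/16]$ both $y$ and $\xi - y$ lie in $[0, 7/16]$, where the profile is at least $p$.\<close>
    let ?f = "\<lambda>y. Phi_LSW (\<xi> - y) * Phi_LSW y"
    have si: "set_integrable lebesgue {0..\<xi>} ?f"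
      using Phi_LSW_exp_bound[of 1] \<xi>
      by (intro conv_integrand_integrable[OF Phi_LSW_measurable_on, of "LSW_sup * exp 1" 1]) auto
    have sub: "set_integrable lebesgue {3/8..7/16} ?f"
      using set_integrable_subset[OF si, of "{3/8..7/16}"] \<xi> by auto
    have "integral {3/8..7/16::real} (\<lambda>_. p * p) \<le> integral {3/8..7/16} ?f"
    proof (intro integral_le)
      show "?f integrable_on {3/8..7/16}" using set_lebesgue_integral_eq_integral(1)[OF sub] .
      show "p * p \<le> ?f y" if "y \<in> {3/8..7/16}" for y
        using Phi_LSW_lower[of y] Phi_LSW_lower[of "\<xi> - y"] that \<xi> p unfolding p_def[symmetric]
        by (intro mult_mono) auto
    qed auto
    also have "\<dots> \<le> integral {0..\<xi>} ?f"
      using \<xi> Phi_LSW_bounds(1)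
      by (intro integral_subset_le set_lebesgue_integral_eq_integral(1)[OF sub] set_lebesgue_integral_eq_integral(1)[OF si]) auto
    also have "\<dots> = 2 * h_LSW \<xi>"
      using set_lebesgue_integral_eq_integral(2)[OF si] by (simp add: h_LSW_def conv_def)
    finally show "p\<^sup>2 / 32 \<le> h_LSW \<xi>" by (simp add: power2_eq_square)
  qed
qed

lemma h_LSW_measurable: "h_LSW \<in> borel_measurable (lebesgue_on {0..})"
  unfolding h_LSW_def by (rule conv_measurable[OF Phi_LSW_measurable_on])

section \<open>The amplified LSW source in the limit\<close>

text \<open>
  The limit of $e^{A(\xi) - A(1)}$ as $\delta \to 0$, for $\xi > 1/2$.
\<close>

definition surv :: "real \<Rightarrow> real" where "surv \<xi> = exp (- integral {\<xi>..1} (\<lambda>y. 1 / den 0 y))"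

text \<open>
  The limit of the amplification of the LSW source, relative to $e^{A(1)}$. Only sources beyond $1/2$
  survive in the limit; $1/2$ itself is excluded because $1/D_0$ is not integrable there.
\<close>

definition rho :: real where "rho = integral {1/2<..1} (\<lambda>\<xi>. \<xi> * h_LSW \<xi> * surv \<xi>)"

lemma den0_pos_right: "1/2 < z \<Longrightarrow> den 0 z > 0"
  by (rule den0_pos) auto

lemma den0_half: "den 0 (1/2) = 0"
  by (simp add: den0_factor x0_def)

lemma recip_den0_integrable: "1/2 < u \<Longrightarrow> (\<lambda>y. 1 / den 0 y) integrable_on {u..v}"
  using den0_pos_right by (intro integrable_continuous_real continuous_on_recip_den) auto

lemma surv_pos: "0 < surv \<xi>" by (simp add: surv_def)

lemma surv_le_1: "1/2 < \<xi> \<Longrightarrow> surv \<xi> \<le> 1"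
proof -
  assume "1/2 < \<xi>"
  then have "0 \<le> integral {\<xi>..1} (\<lambda>y. 1 / den 0 y)"
    using den0_pos_right by (intro integral_nonneg recip_den0_integrable) (auto simp: less_imp_le)
  then show ?thesis by (simp add: surv_def)
qed

lemma continuous_on_surv: "continuous_on {1/2<..1} surv"
proof -
  have "continuous (at z within {1/2<..1}) surv" if z: "z \<in> {1/2<..1}" for z
  proof -
    obtain w where w: "1/2 < w" "w < z" using dense[of "1/2" z] z by auto
    have "continuous_on {w..1} (\<lambda>x. integral {x..1} (\<lambda>y. 1 / den 0 y))"
      using recip_den0_integrable[OF w(1)] by (rule indefinite_integral_continuous_1')
    then have "continuous_on {w..1} surv" unfolding surv_def[abs_def] by (intro continuous_intros)
    then have "continuous (at z within {w..1}) surv"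
      using w z by (auto simp: continuous_on_eq_continuous_within)
    moreover have "at z within {w..1} = at z within {1/2<..1}"
      using w z at_within_nhd[of z "{w<..}" "{w..1}" "{1/2<..1}"] by force
    ultimately show ?thesis by simp
  qed
  then show ?thesis by (simp add: continuous_on_eq_continuous_within)
qed

lemma upper_interval_sets: "{1/2<..1::real} \<in> sets lebesgue"
  by (auto intro!: sets_completionI_sets)

lemma h_LSW_measurable_on: "S \<subseteq> {0..} \<Longrightarrow> h_LSW \<in> borel_measurable (lebesgue_on S)"
  using h_LSW_measurable by (rule measurable_restrict_mono)

lemma rho_integrable: "(\<lambda>\<xi>. \<xi> * h_LSW \<xi> * surv \<xi>) absolutely_integrable_on {1/2<..1}"
proof -
  obtain H where H: "H > 0" "\<And>\<xi>. 0 \<le> \<xi> \<Longrightarrow> h_LSW \<xi> \<le> H" using h_LSW_bounded by blast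
  have "continuous_on {1/2<..1::real} (\<lambda>\<xi>. \<xi>)" by (intro continuous_intros)
  then have "(\<lambda>\<xi>. \<xi> * h_LSW \<xi> * surv \<xi>) \<in> borel_measurable (lebesgue_on {1/2<..1})"
  proof -
    have "h_LSW \<in> borel_measurable (lebesgue_on {1/2<..1})" by (rule h_LSW_measurable_on) auto
    moreover have "surv \<in> borel_measurable (lebesgue_on {1/2<..1})"
      by (rule continuous_imp_measurable_on_sets_lebesgue[OF continuous_on_surv upper_interval_sets])
    moreover note continuous_imp_measurable_on_sets_lebesgue[OF \<open>continuous_on {1/2<..1::real} (\<lambda>\<xi>. \<xi>)\<close> upper_interval_sets]
    ultimately show ?thesis by (intro borel_measurable_times)
  qed
  then show ?thesis
  proof (rule measurable_bounded_by_integrable_imp_absolutely_integrable[OF _ upper_interval_sets])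
    show "(\<lambda>_::real. 1 * H * 1) integrable_on {1/2<..1}"
    proof (rule set_lebesgue_integral_eq_integral(1)[OF set_integrable_subset[OF _ upper_interval_sets]])
      show "(\<lambda>_::real. 1 * H * 1) absolutely_integrable_on {1/2..1}"
        by (rule absolutely_integrable_on_const) simp
      show "{1/2<..1::real} \<subseteq> {1/2..1}" by auto
    qed
    show "norm (\<xi> * h_LSW \<xi> * surv \<xi>) \<le> 1 * H * 1" if "\<xi> \<in> {1/2<..1}" for \<xi>
      unfolding real_norm_def abs_mult using that H h_LSW_nonneg[of \<xi>] surv_le_1[of \<xi>] surv_pos[of \<xi>]
      by (intro mult_mono) auto
  qed
qed

lemma rho_pos: "rho > 0"
proof -
  obtain m where m: "m > 0" "\<And>\<xi>. 5/8 \<le> \<xi> \<Longrightarrow> \<xi> \<le> 3/4 \<Longrightarrow> m \<le> h_LSW \<xi>" using h_LSW_lower by blast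
  have int: "(\<lambda>\<xi>. \<xi> * h_LSW \<xi> * surv \<xi>) integrable_on {1/2<..1}"
    using set_lebesgue_integral_eq_integral(1)[OF rho_integrable] .
  have sub: "(\<lambda>\<xi>. \<xi> * h_LSW \<xi> * surv \<xi>) integrable_on {5/8..3/4}"
  proof (rule set_lebesgue_integral_eq_integral(1)[OF set_integrable_subset[OF rho_integrable]])
    show "{5/8..3/4::real} \<in> sets lebesgue" by (rule interval_sets_lebesgue)
    show "{5/8..3/4::real} \<subseteq> {1/2<..1}" by auto
  qed
  have sm: "surv (5/8) \<le> surv \<xi>" if "\<xi> \<in> {5/8..3/4}" for \<xi>
  proof -
    have "integral {\<xi>..1} (\<lambda>y. 1 / den 0 y) \<le> integral {5/8..1} (\<lambda>y. 1 / den 0 y)"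
      using den0_pos_right that
      by (intro integral_subset_le recip_den0_integrable) (auto simp: less_imp_le)
    then show ?thesis by (simp add: surv_def)
  qed
  have "integral {5/8..3/4::real} (\<lambda>_. 5/8 * m * surv (5/8)) \<le> integral {5/8..3/4} (\<lambda>\<xi>. \<xi> * h_LSW \<xi> * surv \<xi>)"
  proof (intro integral_le sub)
    show "5/8 * m * surv (5/8) \<le> \<xi> * h_LSW \<xi> * surv \<xi>" if "\<xi> \<in> {5/8..3/4}" for \<xi>
      using that m(1) m(2)[of \<xi>] sm[OF that] surv_pos[of "5/8"] h_LSW_nonneg[of \<xi>]
      by (intro mult_mono mult_nonneg_nonneg) auto
  qed auto
  also have "\<dots> \<le> rho"
    unfolding rho_def
    using h_LSW_nonneg surv_pos by (intro integral_subset_le sub int) (auto intro!: mult_nonneg_nonneg simp: less_imp_le)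
  finally have "1/8 * (5/8 * m * surv (5/8)) \<le> rho" by simp
  moreover have "0 < 1/8 * (5/8 * m * surv (5/8))" using m surv_pos by simp
  ultimately show ?thesis by linarith
qed

lemma R0_eq: "R0 h_LSW = rho / den 0 1"
proof -
  have eq: "indicator {1/2..1} \<xi> *\<^sub>R (\<xi> * a_coef 0 \<xi> * h_LSW \<xi> * exp (- (LINT y:{\<xi>..1}|lebesgue. a_coef 0 y * b_coef 0 y)))
      = inverse (den 0 1) * (indicator {1/2<..1} \<xi> *\<^sub>R (\<xi> * h_LSW \<xi> * surv \<xi>))" for \<xi>
  proof (cases "\<xi> \<in> {1/2<..1}")
    case True
    have pos: "den 0 \<xi> > 0" "den 0 1 > 0" using den0_pos_right[of \<xi>] den0_pos_right[of 1] True by auto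
    have "(LINT y:{\<xi>..1}|lebesgue. a_coef 0 y * b_coef 0 y) = integral {\<xi>..1} (\<lambda>y. 1 / den 0 y) + ln (den 0 1) - ln (den 0 \<xi>)"
      using True den0_pos_right by (intro integral_a_b) auto
    then have "- (LINT y:{\<xi>..1}|lebesgue. a_coef 0 y * b_coef 0 y) = - integral {\<xi>..1} (\<lambda>y. 1 / den 0 y) + ln (den 0 \<xi>) - ln (den 0 1)"
      by linarith
    then have "exp (- (LINT y:{\<xi>..1}|lebesgue. a_coef 0 y * b_coef 0 y)) = exp (- integral {\<xi>..1} (\<lambda>y. 1 / den 0 y) + ln (den 0 \<xi>) - ln (den 0 1))"
      by (rule arg_cong)
    also have "\<dots> = surv \<xi> * den 0 \<xi> / den 0 1" using pos by (simp only: exp_add exp_diff exp_ln surv_def)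
    finally have E: "exp (- (LINT y:{\<xi>..1}|lebesgue. a_coef 0 y * b_coef 0 y)) = surv \<xi> * den 0 \<xi> / den 0 1" .
    have "indicator {1/2..1} \<xi> = (1::real)" "indicator {1/2<..1} \<xi> = (1::real)" using True by auto
    moreover have "x * (1 / d) * h * (s * d / e) = inverse e * (x * h * s)" if "d > 0" for x d h s e :: real
      using that by (simp add: divide_inverse)
    ultimately show ?thesis unfolding E unfolding a_coef_den[of 0 \<xi>] using pos(1) by simp
  next
    case False
    \<comment> \<open>At $1/2$ the value of $a_0$ is $1/0 = 0$, so the closed and the half-open interval give the same integrand.\<close>
    show ?thesis
    proof (cases "\<xi> = 1/2")
      case True
      then have "a_coef 0 \<xi> = 0" using den0_half by (simp only: a_coef_den) simp
      moreover have "indicator {1/2<..1} \<xi> = (0::real)" using False by (rule indicator_simps(2))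
      ultimately show ?thesis by simp
    next
      case F: False
      with False have "\<xi> \<notin> {1/2..1}" "\<xi> \<notin> {1/2<..1}" by auto
      then show ?thesis by simp
    qed
  qed
  have "R0 h_LSW = (\<integral>\<xi>. inverse (den 0 1) * (indicator {1/2<..1} \<xi> *\<^sub>R (\<xi> * h_LSW \<xi> * surv \<xi>)) \<partial>lebesgue)"
    unfolding R0_def set_lebesgue_integral_def[of _ "{1/2..1}"]
    by (rule Bochner_Integration.integral_cong[OF refl eq])
  also have "\<dots> = inverse (den 0 1) * (LINT \<xi>:{1/2<..1}|lebesgue. \<xi> * h_LSW \<xi> * surv \<xi>)"
    unfolding set_lebesgue_integral_def by (rule integral_mult_right_zero)
  finally show ?thesis
    unfolding set_lebesgue_integral_eq_integral(2)[OF rho_integrable] rho_def[symmetric]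
    by (simp only: divide_inverse mult.commute)
qed

section \<open>Response to a single source\<close>

text \<open>
  The exponent of the integrating factor: $\psi$ is a multiple of $e^{-phase}/D$.
\<close>

definition phase :: "real \<Rightarrow> real \<Rightarrow> real \<Rightarrow> real \<Rightarrow> real" where
  "phase \<epsilon> \<epsilon>t \<delta> z = (1 - \<epsilon>) * age \<delta> z - \<epsilon>t * amass \<delta> z"

text \<open>
  The $\gamma$-moment of the response to a source at $\xi$, apart from the factor $\xi$ of the source
  term; integrating it against $\xi h(\xi)$ gives the $\gamma$-moment of the solution.
\<close>

definition green :: "(real \<Rightarrow> real) \<Rightarrow> real \<Rightarrow> real \<Rightarrow> real \<Rightarrow> real \<Rightarrow> real" where
  "green \<gamma> \<delta> \<epsilon> \<epsilon>t \<xi> = integral {0..\<xi>} (\<lambda>z. \<gamma> z / den \<delta> z * exp (phase \<epsilon> \<epsilon>t \<delta> \<xi> - phase \<epsilon> \<epsilon>t \<delta> z))"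

definition moment :: "(real \<Rightarrow> real) \<Rightarrow> real \<Rightarrow> (real \<Rightarrow> real) \<Rightarrow> real \<Rightarrow> real \<Rightarrow> real" where
  "moment \<gamma> \<delta> h \<epsilon> \<epsilon>t = integral {0..} (\<lambda>\<xi>. \<xi> * h \<xi> * green \<gamma> \<delta> \<epsilon> \<epsilon>t \<xi>)"

definition weight_mass :: "real \<Rightarrow> real" where
  "weight_mass \<beta> = (max 1 (24 / \<beta>)) ^ 6 * (2 / \<beta>)"

lemma weight_mass_pos: "\<beta> > 0 \<Longrightarrow> weight_mass \<beta> > 0"
  by (simp add: weight_mass_def)

text \<open>
  The constant comes from $1 + \xi \le c\,(1 + \beta\xi/24) \le c\,e^{\beta\xi/24}$, raised to the
  sixth power. A sixth power suffices for all polynomial factors that occur below.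
\<close>

lemma polynomial_weight_bound:
  fixes \<beta> \<xi> :: real
  assumes "\<beta> > 0" "\<xi> \<ge> 0"
  shows "(1 + \<xi>) ^ 6 * exp (- (3/4 * \<beta>) * \<xi>) \<le> (max 1 (24 / \<beta>)) ^ 6 * exp (- (\<beta>/2) * \<xi>)"
proof -
  define c where "c = max 1 (24 / \<beta>)"
  have "1 \<le> c" "24 / \<beta> \<le> c" by (auto simp: c_def)
  then have "24 \<le> c * \<beta>" using assms(1) by (simp add: field_simps)
  then have "24 * \<xi> \<le> c * \<beta> * \<xi>" using assms(2) by (intro mult_right_mono) auto
  then have "1 + \<xi> \<le> c * (1 + \<beta> * \<xi> / 24)" using \<open>1 \<le> c\<close> by (simp add: algebra_simps)
  also have "\<dots> \<le> c * exp (\<beta> * \<xi> / 24)" using \<open>1 \<le> c\<close> by (intro mult_left_mono) auto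
  finally have "(1 + \<xi>) ^ 6 \<le> (c * exp (\<beta> * \<xi> / 24)) ^ 6" using assms by (intro power_mono) auto
  also have "\<dots> = c ^ 6 * exp (\<beta> * \<xi> / 4)" by (simp add: power_mult_distrib flip: exp_of_nat_mult)
  finally have "(1 + \<xi>) ^ 6 * exp (- (3/4 * \<beta>) * \<xi>) \<le> c ^ 6 * exp (\<beta> * \<xi> / 4) * exp (- (3/4 * \<beta>) * \<xi>)"
    by (intro mult_right_mono) auto
  also have "\<dots> = c ^ 6 * exp (\<beta> * \<xi> / 4 + - (3/4 * \<beta>) * \<xi>)" by (simp only: exp_add mult.assoc)
  also have "\<beta> * \<xi> / 4 + - (3/4 * \<beta>) * \<xi> = - (\<beta>/2) * \<xi>" by (simp add: field_simps)
  finally show ?thesis by (simp add: c_def)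
qed

lemma weighted_integral:
  fixes f :: "real \<Rightarrow> real"
  assumes \<beta>: "\<beta> > 0" and f: "f \<in> borel_measurable (lebesgue_on {0..})" and "A \<ge> 0"
    and b: "\<And>\<xi>. 0 \<le> \<xi> \<Longrightarrow> \<bar>f \<xi>\<bar> \<le> A * ((1 + \<xi>) ^ 6 * exp (- (3/4 * \<beta>) * \<xi>))"
  shows "f absolutely_integrable_on {0..}" "\<bar>integral {0..} f\<bar> \<le> A * weight_mass \<beta>"
proof -
  define c where "c = (max 1 (24 / \<beta>)) ^ 6"
  have I: "((\<lambda>\<xi>. (A * c) * exp (- (\<beta>/2) * \<xi>)) has_integral (A * c) * (exp (- (\<beta>/2) * 0) / (\<beta>/2))) {0..}"
    using \<beta> by (intro has_integral_mult_right has_integral_exp_minus_to_infinity) auto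
  have b': "norm (f \<xi>) \<le> (A * c) * exp (- (\<beta>/2) * \<xi>)" if "\<xi> \<in> {0..}" for \<xi>
  proof -
    have "\<bar>f \<xi>\<bar> \<le> A * ((1 + \<xi>) ^ 6 * exp (- (3/4 * \<beta>) * \<xi>))" using b that by simp
    also have "\<dots> \<le> A * (c * exp (- (\<beta>/2) * \<xi>))"
      using polynomial_weight_bound[OF \<beta>, of \<xi>] that \<open>A \<ge> 0\<close> unfolding c_def by (intro mult_left_mono) auto
    finally show ?thesis by (simp add: mult.assoc)
  qed
  show abs: "f absolutely_integrable_on {0..}"
    using I by (intro measurable_bounded_by_integrable_imp_absolutely_integrable[OF f half_line_sets_lebesgue _ b']) auto
  have "norm (integral {0..} f) \<le> integral {0..} (\<lambda>\<xi>. (A * c) * exp (- (\<beta>/2) * \<xi>))"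
    using I by (intro integral_norm_bound_integral b' set_lebesgue_integral_eq_integral(1)[OF abs]) auto
  also have "\<dots> = A * weight_mass \<beta>" using integral_unique[OF I] by (simp add: c_def weight_mass_def)
  finally show "\<bar>integral {0..} f\<bar> \<le> A * weight_mass \<beta>" by simp
qed

lemma exp_diff_abs_le:
  fixes u v w :: real
  assumes "u \<le> w" "v \<le> w"
  shows "\<bar>exp u - exp v\<bar> \<le> \<bar>u - v\<bar> * exp w"
proof -
  have *: "exp v - exp u \<le> (v - u) * exp w" if "u \<le> v" "v \<le> w" for u v :: real
  proof -
    have "exp v - exp u = exp v * (1 - exp (u - v))" by (simp add: exp_diff algebra_simps)
    also have "\<dots> \<le> exp v * (v - u)"
    proof (rule mult_left_mono)
      show "1 - exp (u - v) \<le> v - u" using exp_ge_add_one_self[of "u - v"] by linarith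
    qed simp
    also have "\<dots> \<le> exp w * (v - u)" using that by (intro mult_right_mono) auto
    finally show ?thesis by (simp add: mult.commute)
  qed
  show ?thesis
  proof (cases "u \<le> v")
    case True
    then have "exp u \<le> exp v" by simp
    then show ?thesis using True *[of u v] assms by simp
  next
    case False
    then have "exp v \<le> exp u" by simp
    then show ?thesis using False *[of v u] assms by simp
  qed
qed

lemma continuous_on_phase: "\<delta> > 0 \<Longrightarrow> continuous_on {0..} (phase \<epsilon> \<epsilon>t \<delta>)"
  unfolding phase_def[abs_def] by (intro continuous_intros continuous_on_age continuous_on_amass)

text \<open>
  The assumptions cover both moments that occur, $\gamma(z) = z$ and $\gamma(z) = 1$.
\<close>

locale test_weight =
  fixes \<delta> :: real and \<gamma> :: "real \<Rightarrow> real"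
  assumes \<delta>: "\<delta> > 0" and \<gamma>_cont: "continuous_on {0..} \<gamma>"
    and \<gamma>_nonneg: "\<And>z. 0 \<le> z \<Longrightarrow> 0 \<le> \<gamma> z" and \<gamma>_le: "\<And>z. 0 \<le> z \<Longrightarrow> \<gamma> z \<le> 1 + z"
begin

lemma continuous_on_source:
  "continuous_on {0..} (\<lambda>z. \<gamma> z / den \<delta> z * exp (- phase \<epsilon> \<epsilon>t \<delta> z))"
  using den_pos[OF \<delta>] by (intro continuous_intros continuous_on_recip_den continuous_on_phase[OF \<delta>] \<gamma>_cont) auto

lemma green_eq:
  "green \<gamma> \<delta> \<epsilon> \<epsilon>t \<xi> = exp (phase \<epsilon> \<epsilon>t \<delta> \<xi>) * integral {0..\<xi>} (\<lambda>z. \<gamma> z / den \<delta> z * exp (- phase \<epsilon> \<epsilon>t \<delta> z))"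
proof -
  have "green \<gamma> \<delta> \<epsilon> \<epsilon>t \<xi> = integral {0..\<xi>} (\<lambda>z. exp (phase \<epsilon> \<epsilon>t \<delta> \<xi>) * (\<gamma> z / den \<delta> z * exp (- phase \<epsilon> \<epsilon>t \<delta> z)))"
    unfolding green_def by (intro integral_cong) (simp add: exp_diff exp_minus divide_inverse)
  then show ?thesis unfolding Henstock_Kurzweil_Integration.integral_mult_right .
qed

lemma continuous_on_green: "continuous_on {0..} (green \<gamma> \<delta> \<epsilon> \<epsilon>t)"
  unfolding green_eq[abs_def]
  by (intro continuous_intros continuous_on_phase[OF \<delta>] indefinite_integral_half_line(1) continuous_on_source)

lemma green_integrable:
  assumes "\<xi> \<ge> 0"
  shows "(\<lambda>z. \<gamma> z / den \<delta> z * exp (phase \<epsilon> \<epsilon>t \<delta> \<xi> - phase \<epsilon> \<epsilon>t \<delta> z)) integrable_on {0..\<xi>}"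
proof -
  have "continuous_on {0..\<xi>} (\<lambda>z. \<gamma> z / den \<delta> z * exp (phase \<epsilon> \<epsilon>t \<delta> \<xi> - phase \<epsilon> \<epsilon>t \<delta> z))"
    using den_pos[OF \<delta>] continuous_on_subset[OF continuous_on_phase[OF \<delta>], of "{0..\<xi>}"]
      continuous_on_subset[OF \<gamma>_cont, of "{0..\<xi>}"]
    by (intro continuous_intros continuous_on_recip_den) auto
  then show ?thesis by (rule integrable_continuous_real)
qed

lemma green_free_integrable:
  "(\<lambda>z. \<gamma> z / den \<delta> z * exp (age \<delta> \<xi> - age \<delta> z)) integrable_on {0..\<xi>}"
  and green_free: "integral {0..\<xi>} (\<lambda>z. \<gamma> z / den \<delta> z * exp (age \<delta> \<xi> - age \<delta> z)) = exp (age \<delta> \<xi>) * kap \<gamma> \<delta> \<xi>"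
proof -
  have eq: "(\<lambda>z. \<gamma> z / den \<delta> z * exp (age \<delta> \<xi> - age \<delta> z)) = (\<lambda>z. exp (age \<delta> \<xi>) * (\<gamma> z * (exp (- age \<delta> z) / den \<delta> z)))"
    by (simp add: fun_eq_iff exp_diff exp_minus divide_inverse)
  show "(\<lambda>z. \<gamma> z / den \<delta> z * exp (age \<delta> \<xi> - age \<delta> z)) integrable_on {0..\<xi>}"
    unfolding eq using kap_integrable[OF \<delta> \<gamma>_cont, of 0 \<xi>] by (intro integrable_on_mult_right) auto
  show "integral {0..\<xi>} (\<lambda>z. \<gamma> z / den \<delta> z * exp (age \<delta> \<xi> - age \<delta> z)) = exp (age \<delta> \<xi>) * kap \<gamma> \<delta> \<xi>"
    unfolding eq Henstock_Kurzweil_Integration.integral_mult_right kap_def ..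
qed

lemma phase_diff:
  "phase \<epsilon> \<epsilon>t \<delta> \<xi> - phase \<epsilon> \<epsilon>t \<delta> z
     = (age \<delta> \<xi> - age \<delta> z) - (\<epsilon> * (age \<delta> \<xi> - age \<delta> z) + \<epsilon>t * (amass \<delta> \<xi> - amass \<delta> z))"
  by (simp add: phase_def algebra_simps)

lemma phase_diff_le:
  assumes "0 \<le> \<epsilon>" "0 \<le> \<epsilon>t" "0 \<le> z" "z \<le> \<xi>"
  shows "phase \<epsilon> \<epsilon>t \<delta> \<xi> - phase \<epsilon> \<epsilon>t \<delta> z \<le> age \<delta> \<xi> - age \<delta> z"
proof -
  have "0 \<le> \<epsilon> * (age \<delta> \<xi> - age \<delta> z)" "0 \<le> \<epsilon>t * (amass \<delta> \<xi> - amass \<delta> z)"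
    using assms age_mono[OF \<delta>, of z \<xi>] amass_mono[OF \<delta>, of z \<xi>] by auto
  then show ?thesis unfolding phase_diff by linarith
qed

lemma green_nonneg: "0 \<le> \<xi> \<Longrightarrow> 0 \<le> green \<gamma> \<delta> \<epsilon> \<epsilon>t \<xi>"
  unfolding green_def using den_pos[OF \<delta>] \<gamma>_nonneg
  by (intro integral_nonneg green_integrable) (auto simp: less_imp_le)

text \<open>
  Positive parameters only decrease the exponent, so the case $\varepsilon = \tilde\varepsilon = 0$,
  which is explicit, is an upper bound.
\<close>

lemma green_le_free:
  assumes "0 \<le> \<epsilon>" "0 \<le> \<epsilon>t" "0 \<le> \<xi>"
  shows "green \<gamma> \<delta> \<epsilon> \<epsilon>t \<xi> \<le> exp (age \<delta> \<xi>) * kap \<gamma> \<delta> \<xi>"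
  unfolding green_free[symmetric] green_def
proof (intro integral_le green_integrable green_free_integrable)
  fix z assume z: "z \<in> {0..\<xi>}"
  then have "exp (phase \<epsilon> \<epsilon>t \<delta> \<xi> - phase \<epsilon> \<epsilon>t \<delta> z) \<le> exp (age \<delta> \<xi> - age \<delta> z)"
    using phase_diff_le assms by simp
  moreover have "0 \<le> \<gamma> z / den \<delta> z" using z \<gamma>_nonneg[of z] den_pos[OF \<delta>, of z] by simp
  ultimately show "\<gamma> z / den \<delta> z * exp (phase \<epsilon> \<epsilon>t \<delta> \<xi> - phase \<epsilon> \<epsilon>t \<delta> z) \<le> \<gamma> z / den \<delta> z * exp (age \<delta> \<xi> - age \<delta> z)"
    by (intro mult_left_mono)
qed (use assms in auto)

lemma kap_le:
  assumes "0 \<le> \<xi>"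
  shows "kap \<gamma> \<delta> \<xi> \<le> 1 + \<xi>"
proof -
  have "kap \<gamma> \<delta> \<xi> \<le> (1 + \<xi>) * (1 - exp (- age \<delta> \<xi>))"
  proof -
    have "\<gamma> z \<le> 1 + \<xi>" if "0 \<le> z" "z \<le> \<xi>" for z using \<gamma>_le[of z] that by linarith
    from kap_diff_le[OF \<delta> \<gamma>_cont order_refl assms this] show ?thesis using \<delta> by simp
  qed
  also have "\<dots> \<le> (1 + \<xi>) * 1" using assms by (intro mult_left_mono) auto
  finally show ?thesis by simp
qed

lemma green_upper:
  assumes "0 \<le> \<epsilon>" "0 \<le> \<epsilon>t" "0 \<le> \<xi>"
  shows "green \<gamma> \<delta> \<epsilon> \<epsilon>t \<xi> \<le> (1 + \<xi>) * exp (age \<delta> \<xi>)"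
proof -
  note green_le_free[OF assms]
  also have "exp (age \<delta> \<xi>) * kap \<gamma> \<delta> \<xi> \<le> exp (age \<delta> \<xi>) * (1 + \<xi>)"
    using kap_le[OF assms(3)] by (intro mult_left_mono) auto
  also have "\<dots> = (1 + \<xi>) * exp (age \<delta> \<xi>)" by (rule mult.commute)
  finally show ?thesis .
qed

text \<open>
  On $[0,1]$ one has $B \le A \le A(1)$, so the parameters cost at most
  $(\varepsilon + \tilde\varepsilon) A(1)$ in the exponent.
\<close>

lemma green_lower:
  assumes "0 \<le> \<epsilon>" "0 \<le> \<epsilon>t" "0 \<le> \<xi>" "\<xi> \<le> 1" and \<kappa>: "(\<epsilon> + \<epsilon>t) * age \<delta> 1 \<le> \<kappa>"
  shows "exp (- \<kappa>) * (exp (age \<delta> \<xi>) * kap \<gamma> \<delta> \<xi>) \<le> green \<gamma> \<delta> \<epsilon> \<epsilon>t \<xi>"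
proof -
  have "integral {0..\<xi>} (\<lambda>z. exp (- \<kappa>) * (\<gamma> z / den \<delta> z * exp (age \<delta> \<xi> - age \<delta> z))) \<le> green \<gamma> \<delta> \<epsilon> \<epsilon>t \<xi>"
    unfolding green_def
  proof (intro integral_le green_integrable integrable_on_mult_right green_free_integrable)
    fix z assume z: "z \<in> {0..\<xi>}"
    have "age \<delta> \<xi> - age \<delta> z \<le> age \<delta> 1"
      using age_mono[OF \<delta>, of \<xi> 1] age_nonneg[OF \<delta>, of z] z assms by simp
    moreover have "amass \<delta> \<xi> - amass \<delta> z \<le> age \<delta> 1"
      using amass_mono[OF \<delta>, of \<xi> 1] amass_nonneg[OF \<delta>, of z] amass_le[OF \<delta>, of 1] z assms by simp
    ultimately have "\<epsilon> * (age \<delta> \<xi> - age \<delta> z) + \<epsilon>t * (amass \<delta> \<xi> - amass \<delta> z) \<le> \<epsilon> * age \<delta> 1 + \<epsilon>t * age \<delta> 1"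
      using assms by (intro add_mono mult_left_mono) auto
    then have "- \<kappa> + (age \<delta> \<xi> - age \<delta> z) \<le> phase \<epsilon> \<epsilon>t \<delta> \<xi> - phase \<epsilon> \<epsilon>t \<delta> z"
      unfolding phase_diff using \<kappa> by (simp add: algebra_simps)
    then have "exp (- \<kappa>) * exp (age \<delta> \<xi> - age \<delta> z) \<le> exp (phase \<epsilon> \<epsilon>t \<delta> \<xi> - phase \<epsilon> \<epsilon>t \<delta> z)"
      unfolding exp_add[symmetric] by simp
    moreover have "0 \<le> \<gamma> z / den \<delta> z" using z \<gamma>_nonneg[of z] den_pos[OF \<delta>, of z] by simp
    ultimately have "\<gamma> z / den \<delta> z * (exp (- \<kappa>) * exp (age \<delta> \<xi> - age \<delta> z)) \<le> \<gamma> z / den \<delta> z * exp (phase \<epsilon> \<epsilon>t \<delta> \<xi> - phase \<epsilon> \<epsilon>t \<delta> z)"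
      by (intro mult_left_mono)
    then show "exp (- \<kappa>) * (\<gamma> z / den \<delta> z * exp (age \<delta> \<xi> - age \<delta> z)) \<le> \<gamma> z / den \<delta> z * exp (phase \<epsilon> \<epsilon>t \<delta> \<xi> - phase \<epsilon> \<epsilon>t \<delta> z)"
      by (simp only: mult.left_commute)
  qed (use assms in auto)
  then show ?thesis unfolding Henstock_Kurzweil_Integration.integral_mult_right green_free .
qed

text \<open>
  The exponent is affine in the parameters, with slopes $A(\xi) - A(z) \le A(\xi)$ and
  $B(\xi) - B(z) \le \xi A(\xi)$.
\<close>

lemma green_lipschitz:
  assumes "0 \<le> \<epsilon>" "0 \<le> \<epsilon>t" "0 \<le> \<epsilon>'" "0 \<le> \<epsilon>t'" "0 \<le> \<xi>"
  shows "\<bar>green \<gamma> \<delta> \<epsilon> \<epsilon>t \<xi> - green \<gamma> \<delta> \<epsilon>' \<epsilon>t' \<xi>\<bar>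
    \<le> (\<bar>\<epsilon> - \<epsilon>'\<bar> + \<bar>\<epsilon>t - \<epsilon>t'\<bar>) * ((1 + \<xi>)\<^sup>2 * (age \<delta> \<xi> * exp (age \<delta> \<xi>)))"
proof -
  define d where "d = \<bar>\<epsilon> - \<epsilon>'\<bar> + \<bar>\<epsilon>t - \<epsilon>t'\<bar>"
  define c where "c = d * ((1 + \<xi>) * age \<delta> \<xi>)"
  have c: "0 \<le> c" using assms age_nonneg[OF \<delta>] by (simp add: c_def d_def)
  let ?diff = "\<lambda>z. \<gamma> z / den \<delta> z * exp (phase \<epsilon> \<epsilon>t \<delta> \<xi> - phase \<epsilon> \<epsilon>t \<delta> z)
      - \<gamma> z / den \<delta> z * exp (phase \<epsilon>' \<epsilon>t' \<delta> \<xi> - phase \<epsilon>' \<epsilon>t' \<delta> z)"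
  have eq: "green \<gamma> \<delta> \<epsilon> \<epsilon>t \<xi> - green \<gamma> \<delta> \<epsilon>' \<epsilon>t' \<xi> = integral {0..\<xi>} ?diff"
    unfolding green_def using assms by (intro Henstock_Kurzweil_Integration.integral_diff[symmetric] green_integrable)
  have "norm (integral {0..\<xi>} ?diff) \<le> integral {0..\<xi>} (\<lambda>z. c * (\<gamma> z / den \<delta> z * exp (age \<delta> \<xi> - age \<delta> z)))"
  proof (intro integral_norm_bound_integral Henstock_Kurzweil_Integration.integrable_diff green_integrable
      integrable_on_mult_right green_free_integrable assms)
    fix z assume z: "z \<in> {0..\<xi>}"
    define a b where "a = age \<delta> \<xi> - age \<delta> z" and "b = amass \<delta> \<xi> - amass \<delta> z"
    have a: "0 \<le> a" "a \<le> age \<delta> \<xi>" using age_mono[OF \<delta>, of z \<xi>] age_nonneg[OF \<delta>, of z] z by (auto simp: a_def)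
    have b: "0 \<le> b" "b \<le> \<xi> * age \<delta> \<xi>"
      using amass_mono[OF \<delta>, of z \<xi>] amass_nonneg[OF \<delta>, of z] amass_le[OF \<delta>, of \<xi>] z by (auto simp: b_def)
    have ab: "a \<le> (1 + \<xi>) * age \<delta> \<xi>" "b \<le> (1 + \<xi>) * age \<delta> \<xi>"
    proof -
      have "0 \<le> \<xi> * age \<delta> \<xi>" "0 \<le> age \<delta> \<xi>" using assms age_nonneg[OF \<delta>, of \<xi>] by auto
      moreover have "(1 + \<xi>) * age \<delta> \<xi> = age \<delta> \<xi> + \<xi> * age \<delta> \<xi>" by (simp add: distrib_right)
      ultimately show "a \<le> (1 + \<xi>) * age \<delta> \<xi>" "b \<le> (1 + \<xi>) * age \<delta> \<xi>" using a b by linarith+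
    qed
    let ?u = "phase \<epsilon> \<epsilon>t \<delta> \<xi> - phase \<epsilon> \<epsilon>t \<delta> z" and ?v = "phase \<epsilon>' \<epsilon>t' \<delta> \<xi> - phase \<epsilon>' \<epsilon>t' \<delta> z"
    have E: "?u - ?v = (\<epsilon>' - \<epsilon>) * a + (\<epsilon>t' - \<epsilon>t) * b"
      unfolding phase_diff a_def[symmetric] b_def[symmetric] by (simp add: algebra_simps)
    have "\<bar>?u - ?v\<bar> \<le> \<bar>(\<epsilon>' - \<epsilon>) * a\<bar> + \<bar>(\<epsilon>t' - \<epsilon>t) * b\<bar>"
      unfolding E by (rule abs_triangle_ineq)
    also have "\<dots> = \<bar>\<epsilon>' - \<epsilon>\<bar> * a + \<bar>\<epsilon>t' - \<epsilon>t\<bar> * b"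
      unfolding abs_mult abs_of_nonneg[OF a(1)] abs_of_nonneg[OF b(1)] ..
    also have "\<dots> \<le> \<bar>\<epsilon>' - \<epsilon>\<bar> * ((1 + \<xi>) * age \<delta> \<xi>) + \<bar>\<epsilon>t' - \<epsilon>t\<bar> * ((1 + \<xi>) * age \<delta> \<xi>)"
      using ab by (intro add_mono mult_left_mono) auto
    also have "\<dots> = c" by (simp only: c_def d_def abs_minus_commute[of \<epsilon>' \<epsilon>] abs_minus_commute[of \<epsilon>t' \<epsilon>t] distrib_right)
    finally have uv: "\<bar>?u - ?v\<bar> \<le> c" .
    have "\<bar>exp ?u - exp ?v\<bar> \<le> \<bar>?u - ?v\<bar> * exp a"
    proof (rule exp_diff_abs_le)
      show "?u \<le> a" "?v \<le> a" unfolding a_def using assms z by (intro phase_diff_le; simp)+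
    qed
    also have "\<dots> \<le> c * exp a" using uv by (intro mult_right_mono) auto
    finally have e: "\<bar>exp ?u - exp ?v\<bar> \<le> c * exp a" .
    have g: "0 \<le> \<gamma> z / den \<delta> z" using z \<gamma>_nonneg[of z] den_pos[OF \<delta>, of z] by simp
    have "norm (\<gamma> z / den \<delta> z * exp ?u - \<gamma> z / den \<delta> z * exp ?v) = \<gamma> z / den \<delta> z * \<bar>exp ?u - exp ?v\<bar>"
      unfolding right_diff_distrib[symmetric] real_norm_def abs_mult abs_of_nonneg[OF g] ..
    also have "\<dots> \<le> \<gamma> z / den \<delta> z * (c * exp a)" using e g by (rule mult_left_mono)
    finally show "norm (\<gamma> z / den \<delta> z * exp ?u - \<gamma> z / den \<delta> z * exp ?v) \<le> c * (\<gamma> z / den \<delta> z * exp (age \<delta> \<xi> - age \<delta> z))"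
      unfolding a_def mult.left_commute[of c] .
  qed
  also have "\<dots> = c * (exp (age \<delta> \<xi>) * kap \<gamma> \<delta> \<xi>)"
    by (simp only: Henstock_Kurzweil_Integration.integral_mult_right green_free)
  also have "\<dots> \<le> c * (exp (age \<delta> \<xi>) * (1 + \<xi>))"
    using c kap_le[OF assms(5)] by (intro mult_left_mono) auto
  also have "\<dots> = d * ((1 + \<xi>)\<^sup>2 * (age \<delta> \<xi> * exp (age \<delta> \<xi>)))"
    by (simp add: c_def power2_eq_square mult_ac)
  finally show ?thesis unfolding eq d_def real_norm_def .
qed

end

section \<open>The homogeneous solution and the moments\<close>

text \<open>
  The solution $\psi$ without its normalisation.
\<close>

definition profile :: "real \<Rightarrow> real \<Rightarrow> real \<Rightarrow> real \<Rightarrow> real" where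
  "profile \<epsilon> \<epsilon>t \<delta> z = (if z < 0 then 0 else exp (- phase \<epsilon> \<epsilon>t \<delta> z) / den \<delta> z)"

context
  fixes \<delta> :: real assumes \<delta>: "\<delta> > 0"
begin

lemma phase_deriv:
  assumes "z > 0"
  shows "(phase \<epsilon> \<epsilon>t \<delta> has_real_derivative (1 - \<epsilon> - \<epsilon>t * z) / den \<delta> z) (at z)"
proof -
  have "(phase \<epsilon> \<epsilon>t \<delta> has_real_derivative (1 - \<epsilon>) * (1 / den \<delta> z) - \<epsilon>t * (z / den \<delta> z)) (at z)"
    unfolding phase_def[abs_def] by (intro DERIV_diff DERIV_cmult age_deriv[OF \<delta> assms] amass_deriv[OF \<delta> assms])
  then show ?thesis by (simp add: diff_divide_distrib)
qed

lemma profile_pos: "0 \<le> z \<Longrightarrow> profile \<epsilon> \<epsilon>t \<delta> z > 0"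
  using den_pos[OF \<delta>] by (simp add: profile_def)

lemma continuous_on_profile: "continuous_on {0..} (profile \<epsilon> \<epsilon>t \<delta>)"
proof -
  have "continuous_on {0..} (\<lambda>z. exp (- phase \<epsilon> \<epsilon>t \<delta> z) / den \<delta> z)"
    using den_pos[OF \<delta>] by (intro continuous_on_recip_den continuous_intros continuous_on_phase[OF \<delta>]) auto
  then show ?thesis by (rule continuous_on_eq) (simp add: profile_def)
qed

lemma profile_deriv:
  assumes z: "z > 0"
  shows "(profile \<epsilon> \<epsilon>t \<delta> has_real_derivative - a_coef \<delta> z * (b_coef \<delta> z - \<epsilon>t * z - \<epsilon>) * profile \<epsilon> \<epsilon>t \<delta> z) (at z)"
proof -
  have pos: "den \<delta> z > 0" using den_pos[OF \<delta>] z by simp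
  define E where "E = exp (- phase \<epsilon> \<epsilon>t \<delta> z)"
  have "((\<lambda>z. exp (- phase \<epsilon> \<epsilon>t \<delta> z) / den \<delta> z) has_real_derivative
      ((E * (- ((1 - \<epsilon> - \<epsilon>t * z) / den \<delta> z))) * den \<delta> z - E * (b_coef \<delta> z - 1)) / (den \<delta> z * den \<delta> z)) (at z)"
    unfolding E_def using pos by (intro DERIV_divide DERIV_fun_exp DERIV_minus phase_deriv den_deriv z) auto
  moreover have "((E * (- ((1 - \<epsilon> - \<epsilon>t * z) / D))) * D - E * (b - 1)) / (D * D) = - (1 / D) * (b - \<epsilon>t * z - \<epsilon>) * (E / D)"
    if "D > 0" for D b
  proof -
    have "(E * (- ((1 - \<epsilon> - \<epsilon>t * z) / D))) * D = - E * (1 - \<epsilon> - \<epsilon>t * z)" using that by simp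
    then have "(E * (- ((1 - \<epsilon> - \<epsilon>t * z) / D))) * D - E * (b - 1) = - (b - \<epsilon>t * z - \<epsilon>) * E"
      by (simp add: algebra_simps)
    then have "((E * (- ((1 - \<epsilon> - \<epsilon>t * z) / D))) * D - E * (b - 1)) / (D * D) = (- (b - \<epsilon>t * z - \<epsilon>) * E) / (D * D)"
      by (rule arg_cong)
    moreover have "(- w * E) / (D * D) = - (1 / D) * w * (E / D)" for w by simp
    ultimately show ?thesis by (simp only:)
  qed
  ultimately have "((\<lambda>z. exp (- phase \<epsilon> \<epsilon>t \<delta> z) / den \<delta> z) has_real_derivative
      - (1 / den \<delta> z) * (b_coef \<delta> z - \<epsilon>t * z - \<epsilon>) * (E / den \<delta> z)) (at z)"
    using pos by simp
  moreover have "E / den \<delta> z = profile \<epsilon> \<epsilon>t \<delta> z" using z by (simp add: profile_def E_def)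
  ultimately have D: "((\<lambda>z. exp (- phase \<epsilon> \<epsilon>t \<delta> z) / den \<delta> z) has_real_derivative
      - a_coef \<delta> z * (b_coef \<delta> z - \<epsilon>t * z - \<epsilon>) * profile \<epsilon> \<epsilon>t \<delta> z) (at z)"
    by (simp only: a_coef_den)
  have ev: "\<forall>\<^sub>F x in nhds z. exp (- phase \<epsilon> \<epsilon>t \<delta> x) / den \<delta> x = profile \<epsilon> \<epsilon>t \<delta> x"
    using eventually_nhds_in_open[of "{0<..}" z] z by (auto simp: profile_def elim: eventually_mono)
  from DERIV_cong_ev[OF refl ev refl, THEN iffD1, OF D] show ?thesis .
qed

lemma profile_mass_pos: "(LINT z:{0..1}|lebesgue. z * profile \<epsilon> \<epsilon>t \<delta> z) > 0"
proof -
  have c: "continuous_on {0..1} (\<lambda>z. z * profile \<epsilon> \<epsilon>t \<delta> z)"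
    by (intro continuous_intros continuous_on_subset[OF continuous_on_profile]) auto
  have eq: "(LINT z:{0..1}|lebesgue. z * profile \<epsilon> \<epsilon>t \<delta> z) = integral {0..1} (\<lambda>z. z * profile \<epsilon> \<epsilon>t \<delta> z)"
    using c by (intro set_lebesgue_integral_eq_integral(2) absolutely_integrable_continuous_real)
  have nn: "0 \<le> z * profile \<epsilon> \<epsilon>t \<delta> z" if "z \<in> {0..1}" for z
    using that profile_pos[of z \<epsilon> \<epsilon>t] by simp
  have "integral {0..1} (\<lambda>z. z * profile \<epsilon> \<epsilon>t \<delta> z) \<noteq> 0"
  proof
    assume "integral {0..1} (\<lambda>z. z * profile \<epsilon> \<epsilon>t \<delta> z) = 0"
    then have "\<forall>z\<in>{0..1}. z * profile \<epsilon> \<epsilon>t \<delta> z = 0"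
      using integral_eq_0_iff[OF c _ nn] by simp
    then have "1 * profile \<epsilon> \<epsilon>t \<delta> 1 = 0" by (rule bspec) simp
    then show False using profile_pos[of 1 \<epsilon> \<epsilon>t] by simp
  qed
  moreover have "integral {0..1} (\<lambda>z. z * profile \<epsilon> \<epsilon>t \<delta> z) \<ge> 0"
    by (intro integral_nonneg integrable_continuous_real c nn)
  ultimately show ?thesis unfolding eq by simp
qed

text \<open>
  The equation is linear, so the quotient of two solutions has derivative zero on $(0,\infty)$; by
  continuity it is also constant up to $0$.
\<close>

lemma is_psi_multiple:
  assumes \<psi>: "is_psi \<epsilon> \<epsilon>t \<delta> \<psi>"
  shows "\<exists>k. \<forall>z. \<psi> z = k * profile \<epsilon> \<epsilon>t \<delta> z"
proof -
  have cont: "continuous_on {0..} \<psi>" and der: "\<And>z. z > 0 \<Longrightarrow> (\<psi> has_real_derivative - a_coef \<delta> z * (b_coef \<delta> z - \<epsilon>t * z - \<epsilon>) * \<psi> z) (at z)"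
    and neg: "\<And>z. z < 0 \<Longrightarrow> \<psi> z = 0"
    using \<psi> unfolding is_psi_def by auto
  have const: "\<psi> z / profile \<epsilon> \<epsilon>t \<delta> z = \<psi> 0 / profile \<epsilon> \<epsilon>t \<delta> 0" if z: "z > 0" for z
  proof (rule DERIV_isconst_end[OF z])
    show "continuous_on {0..z} (\<lambda>z. \<psi> z / profile \<epsilon> \<epsilon>t \<delta> z)"
    proof (intro continuous_on_divide continuous_on_subset[OF cont] continuous_on_subset[OF continuous_on_profile])
      show "\<forall>y\<in>{0..z}. profile \<epsilon> \<epsilon>t \<delta> y \<noteq> 0"
        using profile_pos by (metis atLeastAtMost_iff less_irrefl)
    qed auto
    fix x assume x: "0 < x" "x < z"
    define q where "q = - a_coef \<delta> x * (b_coef \<delta> x - \<epsilon>t * x - \<epsilon>)"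
    have "((\<lambda>z. \<psi> z / profile \<epsilon> \<epsilon>t \<delta> z) has_real_derivative
       ((q * \<psi> x) * profile \<epsilon> \<epsilon>t \<delta> x - \<psi> x * (q * profile \<epsilon> \<epsilon>t \<delta> x)) / (profile \<epsilon> \<epsilon>t \<delta> x * profile \<epsilon> \<epsilon>t \<delta> x)) (at x)"
      unfolding q_def using der[OF x(1)] profile_deriv[OF x(1)] profile_pos[of x \<epsilon> \<epsilon>t] x
      by (intro DERIV_divide) auto
    then show "((\<lambda>z. \<psi> z / profile \<epsilon> \<epsilon>t \<delta> z) has_real_derivative 0) (at x)" by (simp add: mult_ac)
  qed
  have "\<psi> z = \<psi> 0 / profile \<epsilon> \<epsilon>t \<delta> 0 * profile \<epsilon> \<epsilon>t \<delta> z" for z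
  proof (cases z "0::real" rule: linorder_cases)
    case less
    then show ?thesis using neg by (simp add: profile_def)
  next
    case equal
    then show ?thesis using profile_pos[of 0 \<epsilon> \<epsilon>t] by simp
  next
    case greater
    then have "profile \<epsilon> \<epsilon>t \<delta> z \<noteq> 0" using profile_pos[of z \<epsilon> \<epsilon>t] by simp
    then have "\<psi> z = \<psi> z / profile \<epsilon> \<epsilon>t \<delta> z * profile \<epsilon> \<epsilon>t \<delta> z" by simp
    then show ?thesis unfolding const[OF greater] .
  qed
  then show ?thesis by blast
qed

lemma psi_eq: "\<exists>c>0. \<forall>z. psi \<epsilon> \<epsilon>t \<delta> z = c * profile \<epsilon> \<epsilon>t \<delta> z"
proof -
  define N where "N = (LINT z:{0..1}|lebesgue. z * profile \<epsilon> \<epsilon>t \<delta> z)"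
  have N: "N > 0" unfolding N_def by (rule profile_mass_pos)
  have mass: "(LINT z:{0..1}|lebesgue. z * (k * profile \<epsilon> \<epsilon>t \<delta> z)) = k * N" for k
  proof -
    have "(LINT z:{0..1}|lebesgue. z * (k * profile \<epsilon> \<epsilon>t \<delta> z)) = (LINT z:{0..1}|lebesgue. k * (z * profile \<epsilon> \<epsilon>t \<delta> z))"
      by (simp only: mult.left_commute)
    then show ?thesis unfolding N_def by (simp only: set_integral_mult_right)
  qed
  let ?\<psi> = "\<lambda>z. (1 / N) * profile \<epsilon> \<epsilon>t \<delta> z"
  have ex: "is_psi \<epsilon> \<epsilon>t \<delta> ?\<psi>"
    unfolding is_psi_def
  proof (intro conjI allI impI)
    show "continuous_on {0..} ?\<psi>" by (intro continuous_intros continuous_on_profile)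
    show "(LINT z:{0..1}|lebesgue. z * ?\<psi> z) = 1" unfolding mass using N by simp
    fix z :: real
    show "z < 0 \<Longrightarrow> ?\<psi> z = 0" by (simp add: profile_def)
    assume "z > 0"
    from DERIV_cmult[OF profile_deriv[OF this], of "1 / N"]
    show "(?\<psi> has_real_derivative - a_coef \<delta> z * (b_coef \<delta> z - \<epsilon>t * z - \<epsilon>) * ?\<psi> z) (at z)"
      by (simp only: mult.left_commute)
  qed
  have "psi \<epsilon> \<epsilon>t \<delta> = ?\<psi>"
    unfolding psi_def
  proof (rule the_equality)
    show "is_psi \<epsilon> \<epsilon>t \<delta> ?\<psi>" by (rule ex)
    fix \<psi> assume \<psi>: "is_psi \<epsilon> \<epsilon>t \<delta> \<psi>"
    from is_psi_multiple[OF this] obtain k where k: "\<And>z. \<psi> z = k * profile \<epsilon> \<epsilon>t \<delta> z" by blast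
    have "k * N = (LINT z:{0..1}|lebesgue. z * \<psi> z)" unfolding k mass ..
    also have "\<dots> = 1" using \<psi> unfolding is_psi_def by blast
    finally have "k = 1 / N" using N by (simp add: field_simps)
    then show "\<psi> = ?\<psi>" using k by auto
  qed
  then show ?thesis using N by (intro exI[of _ "1 / N"]) simp
qed

text \<open>
  The normalising constant cancels, and the factor $a_\delta(\xi)$ cancels against the $1/D(\xi)$ in
  $\psi(\xi)$.
\<close>

lemma psi_kernel:
  assumes "0 \<le> z" "0 \<le> \<xi>"
  shows "a_coef \<delta> \<xi> * (psi \<epsilon> \<epsilon>t \<delta> z / psi \<epsilon> \<epsilon>t \<delta> \<xi>) = exp (phase \<epsilon> \<epsilon>t \<delta> \<xi> - phase \<epsilon> \<epsilon>t \<delta> z) / den \<delta> z"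
proof -
  obtain c where c: "c > 0" "\<And>z. psi \<epsilon> \<epsilon>t \<delta> z = c * profile \<epsilon> \<epsilon>t \<delta> z" using psi_eq by blast
  have "psi \<epsilon> \<epsilon>t \<delta> z / psi \<epsilon> \<epsilon>t \<delta> \<xi> = profile \<epsilon> \<epsilon>t \<delta> z / profile \<epsilon> \<epsilon>t \<delta> \<xi>"
    unfolding c(2) using c(1) by simp
  also have "\<dots> = (exp (- phase \<epsilon> \<epsilon>t \<delta> z) / den \<delta> z) * (den \<delta> \<xi> * exp (phase \<epsilon> \<epsilon>t \<delta> \<xi>))"
    using assms by (simp add: profile_def exp_minus divide_inverse)
  also have "\<dots> = exp (phase \<epsilon> \<epsilon>t \<delta> \<xi> - phase \<epsilon> \<epsilon>t \<delta> z) / den \<delta> z * den \<delta> \<xi>"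
    by (simp add: exp_diff exp_minus divide_inverse)
  finally show ?thesis using den_pos[OF \<delta> assms(2)] by (simp add: a_coef_den)
qed

end

context test_weight
begin

text \<open>
  Of the decay $e^{-\beta\xi}$ of the source, the factor $e^{A(\xi)}$ consumes at most $e^{\beta\xi/4}$;
  the rest controls all polynomial factors.
\<close>

lemma green_moment_integrable:
  assumes \<beta>: "\<beta> > 0" and K: "\<And>z. z \<ge> 0 \<Longrightarrow> age \<delta> z \<le> age \<delta> 1 + K + \<beta>/4 * z"
    and h: "h \<in> borel_measurable (lebesgue_on {0..})"
    and hb: "\<And>\<xi>. 0 \<le> \<xi> \<Longrightarrow> \<bar>h \<xi>\<bar> \<le> S * (\<xi> * exp (- \<beta> * \<xi>))" and S: "S \<ge> 0"
    and \<epsilon>: "0 \<le> \<epsilon>" "0 \<le> \<epsilon>t"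
  shows "(\<lambda>\<xi>. \<xi> * h \<xi> * green \<gamma> \<delta> \<epsilon> \<epsilon>t \<xi>) absolutely_integrable_on {0..}"
    and "\<bar>moment \<gamma> \<delta> h \<epsilon> \<epsilon>t\<bar> \<le> S * exp (age \<delta> 1 + K) * weight_mass \<beta>"
proof -
  have m: "(\<lambda>\<xi>. \<xi> * h \<xi> * green \<gamma> \<delta> \<epsilon> \<epsilon>t \<xi>) \<in> borel_measurable (lebesgue_on {0..})"
    by (intro borel_measurable_times h continuous_imp_measurable_on_sets_lebesgue continuous_on_green
        half_line_sets_lebesgue continuous_on_id)
  have b: "\<bar>\<xi> * h \<xi> * green \<gamma> \<delta> \<epsilon> \<epsilon>t \<xi>\<bar> \<le> S * exp (age \<delta> 1 + K) * ((1 + \<xi>) ^ 6 * exp (- (3/4 * \<beta>) * \<xi>))"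
    if \<xi>: "0 \<le> \<xi>" for \<xi>
  proof -
    have "\<bar>\<xi> * h \<xi> * green \<gamma> \<delta> \<epsilon> \<epsilon>t \<xi>\<bar> = \<xi> * \<bar>h \<xi>\<bar> * green \<gamma> \<delta> \<epsilon> \<epsilon>t \<xi>"
      using \<xi> green_nonneg[OF \<xi>, of \<epsilon> \<epsilon>t] by (simp add: abs_mult)
    also have "\<dots> \<le> (1 + \<xi>) * (S * ((1 + \<xi>) * exp (- \<beta> * \<xi>))) * ((1 + \<xi>) * exp (age \<delta> 1 + K + \<beta>/4 * \<xi>))"
    proof (intro mult_mono)
      have "S * (\<xi> * exp (- \<beta> * \<xi>)) \<le> S * ((1 + \<xi>) * exp (- \<beta> * \<xi>))"
        using S by (intro mult_left_mono mult_right_mono) auto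
      then show "\<bar>h \<xi>\<bar> \<le> S * ((1 + \<xi>) * exp (- \<beta> * \<xi>))" using hb[OF \<xi>] by simp
      have "(1 + \<xi>) * exp (age \<delta> \<xi>) \<le> (1 + \<xi>) * exp (age \<delta> 1 + K + \<beta>/4 * \<xi>)"
        using K[OF \<xi>] \<xi> by (intro mult_left_mono) auto
      then show "green \<gamma> \<delta> \<epsilon> \<epsilon>t \<xi> \<le> (1 + \<xi>) * exp (age \<delta> 1 + K + \<beta>/4 * \<xi>)"
        using green_upper[OF \<epsilon> \<xi>] by (rule order_trans[rotated])
    qed (use \<xi> S green_nonneg[OF \<xi>] in auto)
    also have "\<dots> = S * ((1 + \<xi>) ^ 3 * (exp (- \<beta> * \<xi>) * exp (age \<delta> 1 + K + \<beta>/4 * \<xi>)))"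
      by (simp only: power3_eq_cube mult_ac)
    also have "exp (- \<beta> * \<xi>) * exp (age \<delta> 1 + K + \<beta>/4 * \<xi>) = exp (age \<delta> 1 + K) * exp (- (3/4 * \<beta>) * \<xi>)"
      unfolding exp_add[symmetric] by (rule arg_cong[of _ _ exp]) (simp add: field_simps)
    also have "S * ((1 + \<xi>) ^ 3 * (exp (age \<delta> 1 + K) * exp (- (3/4 * \<beta>) * \<xi>)))
        \<le> S * ((1 + \<xi>) ^ 6 * (exp (age \<delta> 1 + K) * exp (- (3/4 * \<beta>) * \<xi>)))"
      using S \<xi> by (intro mult_left_mono mult_right_mono power_increasing) auto
    finally show ?thesis by (simp only: mult_ac)
  qed
  show "(\<lambda>\<xi>. \<xi> * h \<xi> * green \<gamma> \<delta> \<epsilon> \<epsilon>t \<xi>) absolutely_integrable_on {0..}"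
    by (rule weighted_integral(1)[OF \<beta> m _ b]) (use S in auto)
  show "\<bar>moment \<gamma> \<delta> h \<epsilon> \<epsilon>t\<bar> \<le> S * exp (age \<delta> 1 + K) * weight_mass \<beta>"
    unfolding moment_def by (rule weighted_integral(2)[OF \<beta> m _ b]) (use S in auto)
qed

text \<open>
  By \<open>green_lipschitz\<close> the difference carries one additional travel time compared with the
  moment itself; it is at most $A\,(1+\xi)$.
\<close>

lemma moment_lipschitz:
  assumes \<beta>: "\<beta> > 0" and K: "\<And>z. z \<ge> 0 \<Longrightarrow> age \<delta> z \<le> age \<delta> 1 + K + \<beta>/4 * z"
    and h: "h \<in> borel_measurable (lebesgue_on {0..})"
    and hb: "\<And>\<xi>. 0 \<le> \<xi> \<Longrightarrow> \<bar>h \<xi>\<bar> \<le> S * (\<xi> * exp (- \<beta> * \<xi>))" and S: "S \<ge> 0"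
    and \<epsilon>: "0 \<le> \<epsilon>" "0 \<le> \<epsilon>t" "0 \<le> \<epsilon>'" "0 \<le> \<epsilon>t'"
    and A: "age \<delta> 1 + K + \<beta>/4 \<le> A"
  shows "\<bar>moment \<gamma> \<delta> h \<epsilon> \<epsilon>t - moment \<gamma> \<delta> h \<epsilon>' \<epsilon>t'\<bar>
     \<le> (\<bar>\<epsilon> - \<epsilon>'\<bar> + \<bar>\<epsilon>t - \<epsilon>t'\<bar>) * (A * S * exp (age \<delta> 1 + K) * weight_mass \<beta>)"
proof -
  define d where "d = \<bar>\<epsilon> - \<epsilon>'\<bar> + \<bar>\<epsilon>t - \<epsilon>t'\<bar>"
  define f where "f \<xi> = \<xi> * h \<xi> * green \<gamma> \<delta> \<epsilon> \<epsilon>t \<xi> - \<xi> * h \<xi> * green \<gamma> \<delta> \<epsilon>' \<epsilon>t' \<xi>" for \<xi>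
  have i1: "(\<lambda>\<xi>. \<xi> * h \<xi> * green \<gamma> \<delta> \<epsilon> \<epsilon>t \<xi>) absolutely_integrable_on {0..}"
    by (rule green_moment_integrable(1)[OF \<beta> K h hb S \<epsilon>(1,2)])
  have i2: "(\<lambda>\<xi>. \<xi> * h \<xi> * green \<gamma> \<delta> \<epsilon>' \<epsilon>t' \<xi>) absolutely_integrable_on {0..}"
    by (rule green_moment_integrable(1)[OF \<beta> K h hb S \<epsilon>(3,4)])
  have eq: "moment \<gamma> \<delta> h \<epsilon> \<epsilon>t - moment \<gamma> \<delta> h \<epsilon>' \<epsilon>t' = integral {0..} f"
    unfolding moment_def f_def
    by (intro Henstock_Kurzweil_Integration.integral_diff[symmetric] set_lebesgue_integral_eq_integral(1) i1 i2)
  have A0: "0 \<le> A"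
    using A K[of 1] age_nonneg[OF \<delta>, of 1] by simp
  have m: "f \<in> borel_measurable (lebesgue_on {0..})"
    unfolding f_def
    by (intro borel_measurable_diff borel_measurable_times h continuous_imp_measurable_on_sets_lebesgue continuous_on_green
        half_line_sets_lebesgue continuous_on_id)
  have b: "\<bar>f \<xi>\<bar> \<le> d * (A * S * exp (age \<delta> 1 + K)) * ((1 + \<xi>) ^ 6 * exp (- (3/4 * \<beta>) * \<xi>))"
    if \<xi>: "0 \<le> \<xi>" for \<xi>
  proof -
    let ?g = "green \<gamma> \<delta> \<epsilon> \<epsilon>t \<xi> - green \<gamma> \<delta> \<epsilon>' \<epsilon>t' \<xi>"
    have "\<bar>f \<xi>\<bar> = \<bar>\<xi> * h \<xi> * ?g\<bar>" by (simp only: f_def right_diff_distrib)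
    also have "\<dots> = \<xi> * \<bar>h \<xi>\<bar> * \<bar>?g\<bar>" unfolding abs_mult using \<xi> by simp
    also have "\<dots> \<le> (1 + \<xi>) * (S * ((1 + \<xi>) * exp (- \<beta> * \<xi>))) * (d * ((1 + \<xi>)\<^sup>2 * ((A * (1 + \<xi>)) * exp (age \<delta> 1 + K + \<beta>/4 * \<xi>))))"
    proof (intro mult_mono)
      have "S * (\<xi> * exp (- \<beta> * \<xi>)) \<le> S * ((1 + \<xi>) * exp (- \<beta> * \<xi>))"
        using S by (intro mult_left_mono mult_right_mono) auto
      then show "\<bar>h \<xi>\<bar> \<le> S * ((1 + \<xi>) * exp (- \<beta> * \<xi>))" using hb[OF \<xi>] by simp
      have "age \<delta> \<xi> \<le> age \<delta> 1 + K + \<beta>/4 * \<xi>" by (rule K[OF \<xi>])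
      also have "\<dots> \<le> (age \<delta> 1 + K + \<beta>/4) * (1 + \<xi>)"
      proof -
        have "0 \<le> (age \<delta> 1 + K) * \<xi> + \<beta>/4" using K[of 0] age_nonneg[OF \<delta>, of 1] \<xi> \<beta> \<delta> by simp
        moreover have "(s + t) * (1 + x) = s + t * x + (s * x + t)" for s t x :: real by (simp add: algebra_simps)
        ultimately show ?thesis by simp
      qed
      also have "\<dots> \<le> A * (1 + \<xi>)" using A \<xi> by (intro mult_right_mono) auto
      finally have a: "age \<delta> \<xi> \<le> A * (1 + \<xi>)" .
      have "age \<delta> \<xi> * exp (age \<delta> \<xi>) \<le> (A * (1 + \<xi>)) * exp (age \<delta> 1 + K + \<beta>/4 * \<xi>)"
        using a K[OF \<xi>] age_nonneg[OF \<delta> \<xi>] by (intro mult_mono) auto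
      then have "d * ((1 + \<xi>)\<^sup>2 * (age \<delta> \<xi> * exp (age \<delta> \<xi>))) \<le> d * ((1 + \<xi>)\<^sup>2 * ((A * (1 + \<xi>)) * exp (age \<delta> 1 + K + \<beta>/4 * \<xi>)))"
        unfolding d_def by (intro mult_left_mono) auto
      then show "\<bar>?g\<bar> \<le> d * ((1 + \<xi>)\<^sup>2 * ((A * (1 + \<xi>)) * exp (age \<delta> 1 + K + \<beta>/4 * \<xi>)))"
        using green_lipschitz[OF \<epsilon> \<xi>] unfolding d_def by (rule order_trans[rotated])
    qed (use \<xi> S in auto)
    also have "\<dots> = d * (A * S) * ((1 + \<xi>) ^ 5 * (exp (- \<beta> * \<xi>) * exp (age \<delta> 1 + K + \<beta>/4 * \<xi>)))"
    proof -
      have "(1 + \<xi>) ^ 5 = (1 + \<xi>) * (1 + \<xi>) * (1 + \<xi>)\<^sup>2 * (1 + \<xi>)" by (simp add: eval_nat_numeral)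
      then show ?thesis by (simp only: mult_ac)
    qed
    also have "exp (- \<beta> * \<xi>) * exp (age \<delta> 1 + K + \<beta>/4 * \<xi>) = exp (age \<delta> 1 + K) * exp (- (3/4 * \<beta>) * \<xi>)"
      unfolding exp_add[symmetric] by (rule arg_cong[of _ _ exp]) (simp add: field_simps)
    also have "d * (A * S) * ((1 + \<xi>) ^ 5 * (exp (age \<delta> 1 + K) * exp (- (3/4 * \<beta>) * \<xi>)))
        \<le> d * (A * S) * ((1 + \<xi>) ^ 6 * (exp (age \<delta> 1 + K) * exp (- (3/4 * \<beta>) * \<xi>)))"
      using S \<xi> A0 by (intro mult_left_mono mult_right_mono power_increasing) (auto simp: d_def)
    finally show ?thesis by (simp only: mult_ac)
  qed
  have "\<bar>integral {0..} f\<bar> \<le> d * (A * S * exp (age \<delta> 1 + K)) * weight_mass \<beta>"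
    by (rule weighted_integral(2)[OF \<beta> m _ b]) (use S A0 in \<open>auto simp: d_def\<close>)
  then show ?thesis unfolding eq d_def by (simp only: mult.assoc)
qed

text \<open>
  The kernel of the double integral is a product $u(z)\,v(\xi)$ cut off at $z \le \xi$. Integrating
  first over $z$, where $u \ge 0$, shows absolute integrability from that of the single integral; then
  Fubini's theorem applies.
\<close>

lemma moment_eq:
  assumes \<Phi>: "\<Phi> \<in> borel_measurable (lebesgue_on {0..})"
    and int: "(\<lambda>\<xi>. \<xi> * conv \<Phi> \<Phi> \<xi> * green \<gamma> \<delta> \<epsilon> \<epsilon>t \<xi>) absolutely_integrable_on {0..}"
  shows "(LINT z:{0..}|lebesgue. \<gamma> z * I_op \<Phi> \<epsilon> \<epsilon>t \<delta> z) = \<epsilon> * moment \<gamma> \<delta> (conv \<Phi> \<Phi>) \<epsilon> \<epsilon>t"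
proof -
  obtain h where hm: "h \<in> borel_measurable borel" and h: "\<And>\<xi>. \<xi> \<ge> 0 \<Longrightarrow> conv \<Phi> \<Phi> \<xi> = h \<xi>"
    using conv_eq_borel[OF \<Phi>] by blast
  let ?p = "phase \<epsilon> \<epsilon>t \<delta>"
  define u where "u z = indicator {0..} z *\<^sub>R (\<gamma> z / den \<delta> z * exp (- ?p z))" for z
  define e where "e \<xi> = indicator {0..} \<xi> *\<^sub>R exp (?p \<xi>)" for \<xi>
  define v where "v \<xi> = e \<xi> * (\<xi> * h \<xi>)" for \<xi>
  define k where "k \<xi> z = (if z \<le> \<xi> then u z * v \<xi> else 0)" for \<xi> z
  have [measurable]: "u \<in> borel_measurable borel" "e \<in> borel_measurable borel"
    unfolding u_def e_def by (intro borel_measurable_continuous_on_indicator continuous_on_source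
       continuous_on_exp continuous_on_phase[OF \<delta>]; simp)+
  have [measurable]: "v \<in> borel_measurable borel" unfolding v_def using hm by measurable
  have km [measurable]: "case_prod k \<in> borel_measurable (lborel \<Otimes>\<^sub>M lborel)"
    unfolding k_def[abs_def] by measurable
  have u0: "0 \<le> u z" for z
    using \<gamma>_nonneg[of z] den_pos[OF \<delta>, of z]
    by (auto simp: u_def indicator_def intro!: mult_nonneg_nonneg divide_nonneg_pos)
  define U where "U \<xi> = integral {0..\<xi>} (\<lambda>z. \<gamma> z / den \<delta> z * exp (- ?p z))" for \<xi>
  have uI: "integrable lborel (\<lambda>z. if z \<le> \<xi> then u z else 0)" "(\<integral>z. (if z \<le> \<xi> then u z else 0) \<partial>lborel) = U \<xi>" for \<xi>
  proof -
    have eq: "(\<lambda>z. if z \<le> \<xi> then u z else 0) = (\<lambda>z. indicator {0..\<xi>} z *\<^sub>R (\<gamma> z / den \<delta> z * exp (- ?p z)))"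
      by (auto simp: u_def indicator_def fun_eq_iff)
    have ai: "(\<lambda>z. \<gamma> z / den \<delta> z * exp (- ?p z)) absolutely_integrable_on {0..\<xi>}"
      by (intro absolutely_integrable_continuous_real continuous_on_subset[OF continuous_on_source]) auto
    have m: "(\<lambda>z. if z \<le> \<xi> then u z else 0) \<in> borel_measurable lborel" by measurable
    have "integrable lebesgue (\<lambda>z. if z \<le> \<xi> then u z else 0)"
      using ai unfolding eq set_integrable_def .
    then show "integrable lborel (\<lambda>z. if z \<le> \<xi> then u z else 0)"
      using integrable_completion[OF m] by simp
    have "(\<integral>z. (if z \<le> \<xi> then u z else 0) \<partial>lborel) = (\<integral>z. (if z \<le> \<xi> then u z else 0) \<partial>lebesgue)"
      using integral_completion[OF m] by simp
    also have "\<dots> = U \<xi>"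
      using set_lebesgue_integral_eq_integral(2)[OF ai] unfolding eq set_lebesgue_integral_def U_def .
    finally show "(\<integral>z. (if z \<le> \<xi> then u z else 0) \<partial>lborel) = U \<xi>" .
  qed
  have kU: "(\<lambda>z. k \<xi> z) = (\<lambda>z. v \<xi> * (if z \<le> \<xi> then u z else 0))" for \<xi>
    by (auto simp: k_def fun_eq_iff)
  have kUn: "(\<lambda>z. norm (k \<xi> z)) = (\<lambda>z. \<bar>v \<xi>\<bar> * (if z \<le> \<xi> then u z else 0))" for \<xi>
    using u0 by (auto simp: k_def fun_eq_iff abs_mult)
  have vU: "v \<xi> * U \<xi> = indicator {0..} \<xi> *\<^sub>R (\<xi> * conv \<Phi> \<Phi> \<xi> * green \<gamma> \<delta> \<epsilon> \<epsilon>t \<xi>)" for \<xi>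
    using h[of \<xi>] by (auto simp: v_def e_def U_def green_eq indicator_def)
  have Um [measurable]: "U \<in> borel_measurable borel"
  proof -
    have "(\<lambda>\<xi>. \<integral>z. (if z \<le> \<xi> then u z else 0) \<partial>lborel) \<in> borel_measurable lborel"
      by measurable
    then show ?thesis unfolding uI(2) by simp
  qed
  have vUi: "integrable lborel (\<lambda>\<xi>. v \<xi> * U \<xi>)"
  proof -
    have m: "(\<lambda>\<xi>. v \<xi> * U \<xi>) \<in> borel_measurable lborel" by measurable
    have "integrable lebesgue (\<lambda>\<xi>. v \<xi> * U \<xi>)" using int unfolding vU set_integrable_def .
    then show ?thesis using integrable_completion[OF m] by simp
  qed
  have U0: "0 \<le> U \<xi>" for \<xi>
    unfolding uI(2)[symmetric] using u0 by (intro Bochner_Integration.integral_nonneg) auto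
  have kint: "integrable (lborel \<Otimes>\<^sub>M lborel) (case_prod k)"
  proof (rule lborel_pair.Fubini_integrable[OF km])
    have "(\<lambda>\<xi>. \<integral>z. norm (case_prod k (\<xi>, z)) \<partial>lborel) = (\<lambda>\<xi>. norm (v \<xi> * U \<xi>))"
    proof
      fix \<xi>
      have "(\<integral>z. norm (case_prod k (\<xi>, z)) \<partial>lborel) = (\<integral>z. \<bar>v \<xi>\<bar> * (if z \<le> \<xi> then u z else 0) \<partial>lborel)"
        unfolding prod.case kUn ..
      also have "\<dots> = \<bar>v \<xi>\<bar> * U \<xi>" by (simp only: integral_mult_right_zero uI(2))
      also have "\<dots> = norm (v \<xi> * U \<xi>)" using U0[of \<xi>] by (simp add: abs_mult)
      finally show "(\<integral>z. norm (case_prod k (\<xi>, z)) \<partial>lborel) = norm (v \<xi> * U \<xi>)" .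
    qed
    then show "integrable lborel (\<lambda>\<xi>. \<integral>z. norm (case_prod k (\<xi>, z)) \<partial>lborel)"
      using integrable_norm[OF vUi] by simp
    show "AE \<xi> in lborel. integrable lborel (\<lambda>z. case_prod k (\<xi>, z))"
      using uI(1) by (intro AE_I2) (simp add: kU)
  qed
  have inner: "indicator {0..} z *\<^sub>R (\<gamma> z * I_op \<Phi> \<epsilon> \<epsilon>t \<delta> z) = \<epsilon> * (\<integral>\<xi>. k \<xi> z \<partial>lborel)" for z
  proof (cases "0 \<le> z")
    case True
    have m: "(\<lambda>\<xi>. k \<xi> z) \<in> borel_measurable lborel" unfolding k_def by measurable
    have pt: "\<gamma> z * (indicator {z..} \<xi> *\<^sub>R (\<xi> * a_coef \<delta> \<xi> * (psi \<epsilon> \<epsilon>t \<delta> z / psi \<epsilon> \<epsilon>t \<delta> \<xi>) * conv \<Phi> \<Phi> \<xi>)) = k \<xi> z" for \<xi>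
    proof (cases "z \<le> \<xi>")
      case le: True
      then have \<xi>: "0 \<le> \<xi>" using True by simp
      have "\<gamma> z * (\<xi> * a_coef \<delta> \<xi> * (psi \<epsilon> \<epsilon>t \<delta> z / psi \<epsilon> \<epsilon>t \<delta> \<xi>) * conv \<Phi> \<Phi> \<xi>)
          = \<gamma> z * (\<xi> * (a_coef \<delta> \<xi> * (psi \<epsilon> \<epsilon>t \<delta> z / psi \<epsilon> \<epsilon>t \<delta> \<xi>)) * h \<xi>)"
        using h[OF \<xi>] by simp
      also have "\<dots> = k \<xi> z"
        unfolding psi_kernel[OF \<delta> True \<xi>] using le True \<xi>
        by (simp add: k_def u_def v_def e_def exp_diff exp_minus divide_inverse)
      finally show ?thesis using le by simp
    qed (simp add: k_def)
    have "\<gamma> z * I_op \<Phi> \<epsilon> \<epsilon>t \<delta> z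
      = \<epsilon> * (\<gamma> z * (LINT \<xi>:{z..}|lebesgue. \<xi> * a_coef \<delta> \<xi> * (psi \<epsilon> \<epsilon>t \<delta> z / psi \<epsilon> \<epsilon>t \<delta> \<xi>) * conv \<Phi> \<Phi> \<xi>))"
      by (simp add: I_op_def)
    also have "\<gamma> z * (LINT \<xi>:{z..}|lebesgue. \<xi> * a_coef \<delta> \<xi> * (psi \<epsilon> \<epsilon>t \<delta> z / psi \<epsilon> \<epsilon>t \<delta> \<xi>) * conv \<Phi> \<Phi> \<xi>)
       = (\<integral>\<xi>. k \<xi> z \<partial>lebesgue)"
      unfolding set_lebesgue_integral_def[of _ "{z..}"] integral_mult_right_zero[symmetric] pt ..
    also have "\<dots> = (\<integral>\<xi>. k \<xi> z \<partial>lborel)" by (rule integral_completion[OF m])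
    finally show ?thesis using True by simp
  next
    case False
    then have "(\<lambda>\<xi>. k \<xi> z) = (\<lambda>_. 0)" by (auto simp: k_def u_def)
    then show ?thesis using False by simp
  qed
  have "(LINT z:{0..}|lebesgue. \<gamma> z * I_op \<Phi> \<epsilon> \<epsilon>t \<delta> z) = (\<integral>z. \<epsilon> * (\<integral>\<xi>. k \<xi> z \<partial>lborel) \<partial>lebesgue)"
    unfolding set_lebesgue_integral_def[of _ "{0..}"] inner ..
  also have "\<dots> = \<epsilon> * (\<integral>z. (\<integral>\<xi>. k \<xi> z \<partial>lborel) \<partial>lebesgue)" by (rule integral_mult_right_zero)
  also have "(\<integral>z. (\<integral>\<xi>. k \<xi> z \<partial>lborel) \<partial>lebesgue) = (\<integral>z. (\<integral>\<xi>. k \<xi> z \<partial>lborel) \<partial>lborel)"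
    by (rule integral_completion) measurable
  also have "\<dots> = (\<integral>\<xi>. (\<integral>z. k \<xi> z \<partial>lborel) \<partial>lborel)" by (rule lborel_pair.Fubini_integral[OF kint])
  also have "\<dots> = (\<integral>\<xi>. v \<xi> * U \<xi> \<partial>lborel)" unfolding kU by (simp add: uI(2))
  also have "\<dots> = (\<integral>\<xi>. v \<xi> * U \<xi> \<partial>lebesgue)" by (rule integral_completion[symmetric]) measurable
  also have "\<dots> = moment \<gamma> \<delta> (conv \<Phi> \<Phi>) \<epsilon> \<epsilon>t"
    using set_lebesgue_integral_eq_integral(2)[OF int] unfolding vU set_lebesgue_integral_def[of _ "{0..}"] moment_def .
  finally show ?thesis .
qed

end

section \<open>Moments of the LSW source for small parameters\<close>

lemma exp_recip_sqrt_small: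
  assumes "c > 0"
  shows "((\<lambda>\<delta>. exp (- c / sqrt \<delta>) / sqrt \<delta>) \<longlongrightarrow> 0) (at_right 0)"
  using assms by real_asymp

lemma exp_recip_sqrt_tendsto:
  assumes "c > 0"
  shows "((\<lambda>\<delta>. exp (- c / sqrt \<delta>)) \<longlongrightarrow> 0) (at_right 0)"
  using assms by real_asymp

lemma eventually_small_delta: "\<forall>\<^sub>F \<delta> in at_right (0::real). 0 < \<delta> \<and> \<delta> \<le> 1"
  unfolding eventually_at_right_field by (intro exI[of _ 1]) auto

lemma eventually_exp_age_half:
  assumes "\<tau> > 0"
  shows "\<forall>\<^sub>F \<delta> in at_right 0. exp (- age \<delta> (1/2)) \<le> \<tau> \<and> exp (- (age \<delta> 1 - age \<delta> (1/2))) \<le> \<tau>"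
proof -
  define c :: real where "c = arctan (1/2) / 48"
  have c: "c > 0" by (simp add: c_def zero_less_arctan_iff)
  have "\<forall>\<^sub>F \<delta> in at_right 0. exp (- c / sqrt \<delta>) < \<tau>"
    using exp_recip_sqrt_tendsto[OF c] assms by (rule order_tendstoD)
  with eventually_small_delta show ?thesis
  proof eventually_elim
    case (elim \<delta>)
    have "arctan (1/2) / (48 * sqrt \<delta>) = c / sqrt \<delta>" by (simp add: c_def)
    then have "c / sqrt \<delta> \<le> age \<delta> (1/2)" "c / sqrt \<delta> \<le> age \<delta> 1 - age \<delta> (1/2)"
      using age_half_lower[of \<delta>] elim by auto
    then have "exp (- age \<delta> (1/2)) \<le> exp (- c / sqrt \<delta>)" "exp (- (age \<delta> 1 - age \<delta> (1/2))) \<le> exp (- c / sqrt \<delta>)"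
      by auto
    then show ?case using elim(2) by linarith
  qed
qed

lemma h_LSW_times_integrable:
  assumes "0 \<le> a" "continuous_on {a..b} f"
  shows "(\<lambda>\<xi>. \<xi> * h_LSW \<xi> * f \<xi>) absolutely_integrable_on {a..b}"
proof -
  obtain H where H: "H > 0" "\<And>\<xi>. 0 \<le> \<xi> \<Longrightarrow> h_LSW \<xi> \<le> H" using h_LSW_bounded by blast
  have "(\<lambda>\<xi>. h_LSW \<xi> * (\<xi> * f \<xi>)) absolutely_integrable_on {a..b}"
  proof (rule absolutely_integrable_bounded_measurable_product_real)
    show "h_LSW \<in> borel_measurable (lebesgue_on {a..b})" using assms by (intro h_LSW_measurable_on) auto
    show "bounded (h_LSW ` {a..b})"
      unfolding bounded_iff using assms H h_LSW_nonneg by (intro exI[of _ H]) auto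
    show "(\<lambda>\<xi>. \<xi> * f \<xi>) absolutely_integrable_on {a..b}"
      by (intro absolutely_integrable_continuous_real continuous_intros assms)
  qed (rule interval_sets_lebesgue)
  then show ?thesis by (simp only: mult.commute[of _ "h_LSW _"] mult.assoc)
qed

text \<open>
  On $[\xi,1]$ one has $0 \le 1/D_0 - 1/D \le \delta/D_0(\xi)^2$, because $D - D_0 \le \delta$ and $D_0$
  increases beyond $1/2$.
\<close>

lemma survival_comparison:
  assumes \<delta>: "0 < \<delta>" and \<xi>: "1/2 < \<xi>" "\<xi> \<le> 1"
  shows "surv \<xi> \<le> exp (age \<delta> \<xi> - age \<delta> 1)"
    and "exp (age \<delta> \<xi> - age \<delta> 1) \<le> exp (\<delta> / (den 0 \<xi>)\<^sup>2) * surv \<xi>"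
proof -
  have i: "(\<lambda>y. 1 / den \<delta> y) integrable_on {\<xi>..1}" "(\<lambda>y. 1 / den 0 y) integrable_on {\<xi>..1}"
    using recip_den_integrable[OF \<delta>, of \<xi> 1 "\<lambda>_. 1"] recip_den0_integrable[OF \<xi>(1)] \<xi> by auto
  have le: "1 / den \<delta> y \<le> 1 / den 0 y" "1 / den 0 y \<le> 1 / den \<delta> y + \<delta> / (den 0 \<xi>)\<^sup>2" if y: "y \<in> {\<xi>..1}" for y
  proof -
    have p: "0 < den 0 \<xi>" "den 0 \<xi> \<le> den 0 y" "0 < den 0 y" "den 0 y \<le> den \<delta> y" "den \<delta> y - den 0 y \<le> \<delta>"
      using y \<xi> \<delta> den0_pos_right[of \<xi>] den0_mono[of \<xi> y] den0_pos_right[of y] den_mono_delta[of 0 \<delta> y]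
        cbrt_le_1[of y] den_eq_den0[of \<delta> y] by (auto intro!: mult_left_le)
    then show "1 / den \<delta> y \<le> 1 / den 0 y" by (intro divide_left_mono) auto
    have "1 / den 0 y - 1 / den \<delta> y = (den \<delta> y - den 0 y) / (den 0 y * den \<delta> y)"
      using p by (simp add: diff_frac_eq)
    also have "\<dots> \<le> \<delta> / (den 0 \<xi> * den 0 \<xi>)"
      using p \<delta> by (intro frac_le mult_mono) auto
    finally show "1 / den 0 y \<le> 1 / den \<delta> y + \<delta> / (den 0 \<xi>)\<^sup>2" by (simp add: power2_eq_square)
  qed
  have a: "age \<delta> \<xi> - age \<delta> 1 = - integral {\<xi>..1} (\<lambda>y. 1 / den \<delta> y)"
    using age_diff[OF \<delta>, of \<xi> 1] \<xi> by simp
  have "integral {\<xi>..1} (\<lambda>y. 1 / den \<delta> y) \<le> integral {\<xi>..1} (\<lambda>y. 1 / den 0 y)"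
    by (intro integral_le i le)
  then show "surv \<xi> \<le> exp (age \<delta> \<xi> - age \<delta> 1)" unfolding surv_def a by simp
  have "integral {\<xi>..1} (\<lambda>y. 1 / den 0 y) \<le> integral {\<xi>..1} (\<lambda>y. 1 / den \<delta> y + \<delta> / (den 0 \<xi>)\<^sup>2)"
    by (intro integral_le i le integrable_add) auto
  also have "\<dots> = integral {\<xi>..1} (\<lambda>y. 1 / den \<delta> y) + (1 - \<xi>) * (\<delta> / (den 0 \<xi>)\<^sup>2)"
    using \<xi> by (subst Henstock_Kurzweil_Integration.integral_add[OF i(1)]) auto
  also have "(1 - \<xi>) * (\<delta> / (den 0 \<xi>)\<^sup>2) \<le> 1 * (\<delta> / (den 0 \<xi>)\<^sup>2)"
    using \<xi> \<delta> by (intro mult_right_mono) auto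
  finally have "age \<delta> \<xi> - age \<delta> 1 \<le> \<delta> / (den 0 \<xi>)\<^sup>2 + - integral {\<xi>..1} (\<lambda>y. 1 / den 0 y)"
    unfolding a by simp
  then show "exp (age \<delta> \<xi> - age \<delta> 1) \<le> exp (\<delta> / (den 0 \<xi>)\<^sup>2) * surv \<xi>"
    unfolding surv_def exp_add[symmetric] by simp
qed

text \<open>
  The amplification of the LSW source at positive $\delta$, relative to $e^{A(1)}$; its limit is
  \<open>rho\<close>.
\<close>

definition surviving :: "real \<Rightarrow> real" where
  "surviving \<delta> = integral {0..1} (\<lambda>\<xi>. \<xi> * h_LSW \<xi> * exp (age \<delta> \<xi> - age \<delta> 1))"

lemma surviving_integrable:
  assumes "0 < \<delta>" "0 \<le> a"
  shows "(\<lambda>\<xi>. \<xi> * h_LSW \<xi> * exp (age \<delta> \<xi> - age \<delta> 1)) integrable_on {a..b}"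
  using assms
  by (intro set_lebesgue_integral_eq_integral(1) h_LSW_times_integrable continuous_intros
      continuous_on_subset[OF continuous_on_age]) auto

lemma rho_tail_integrable:
  assumes "1/2 < s"
  shows "(\<lambda>\<xi>. \<xi> * h_LSW \<xi> * surv \<xi>) integrable_on {s..1}"
proof (rule set_lebesgue_integral_eq_integral(1)[OF set_integrable_subset[OF rho_integrable interval_sets_lebesgue]])
  show "{s..1} \<subseteq> {1/2<..1}" using assms by auto
qed

text \<open>
  The range of integration is split at $1/2$ and at a point $s$ slightly beyond it. Below $1/2$ the
  second half of the bottleneck makes the integrand exponentially small, $[1/2,s]$ is short, and on
  $[s,1]$ the denominators converge uniformly.
\<close>

lemma surviving_upper:
  assumes \<sigma>: "\<sigma> > 0"
  shows "\<forall>\<^sub>F \<delta> in at_right 0. surviving \<delta> \<le> rho + \<sigma>"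
proof -
  obtain H where H: "H > 0" "\<And>\<xi>. 0 \<le> \<xi> \<Longrightarrow> h_LSW \<xi> \<le> H" using h_LSW_bounded by blast
  define s where "s = 1/2 + min (1/4) (\<sigma> / (4 * H))"
  have s: "1/2 < s" "s < 1" "H * (s - 1/2) \<le> \<sigma> / 4"
  proof -
    have "0 < min (1/4) (\<sigma> / (4 * H))" "min (1/4) (\<sigma> / (4 * H)) \<le> 1/4" using \<sigma> H by auto
    then show "1/2 < s" "s < 1" unfolding s_def by linarith+
    have "H * (s - 1/2) \<le> H * (\<sigma> / (4 * H))" using H by (intro mult_left_mono) (auto simp: s_def)
    then show "H * (s - 1/2) \<le> \<sigma> / 4" using H by simp
  qed
  define d where "d = den 0 s"
  have d: "d > 0" using den0_pos_right[OF s(1)] by (simp add: d_def)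
  have "((\<lambda>\<delta>. rho * exp (\<delta> / d\<^sup>2)) \<longlongrightarrow> rho * exp (0 / d\<^sup>2)) (at_right 0)"
    by (intro tendsto_intros) (use d in auto)
  then have "\<forall>\<^sub>F \<delta> in at_right 0. rho * exp (\<delta> / d\<^sup>2) < rho + \<sigma> / 2"
    using \<sigma> by (intro order_tendstoD(2)[of _ "rho * exp (0 / d\<^sup>2)"]) auto
  moreover have "\<forall>\<^sub>F \<delta> in at_right 0. exp (- age \<delta> (1/2)) \<le> \<sigma> / (4 * H) \<and> exp (- (age \<delta> 1 - age \<delta> (1/2))) \<le> \<sigma> / (4 * H)"
    using \<sigma> H by (intro eventually_exp_age_half) auto
  ultimately show ?thesis using eventually_small_delta
  proof eventually_elim
    case (elim \<delta>)
    then have \<delta>: "0 < \<delta>" by simp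
    let ?f = "\<lambda>\<xi>. \<xi> * h_LSW \<xi> * exp (age \<delta> \<xi> - age \<delta> 1)"
    have fle: "?f \<xi> \<le> 1 * H * c" if "0 \<le> \<xi>" "\<xi> \<le> 1" "exp (age \<delta> \<xi> - age \<delta> 1) \<le> c" for \<xi> c
      using that H(2)[of \<xi>] H(1) h_LSW_nonneg[of \<xi>] by (intro mult_mono) auto
    have "integral {0..1/2} ?f \<le> integral {0..1/2::real} (\<lambda>_. 1 * H * (\<sigma> / (4 * H)))"
    proof (intro integral_le surviving_integrable \<delta>)
      fix \<xi> :: real assume \<xi>: "\<xi> \<in> {0..1/2}"
      then have "age \<delta> \<xi> - age \<delta> 1 \<le> - (age \<delta> 1 - age \<delta> (1/2))" using age_mono[OF \<delta>, of \<xi> "1/2"] by simp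
      then have "exp (age \<delta> \<xi> - age \<delta> 1) \<le> exp (- (age \<delta> 1 - age \<delta> (1/2)))" by simp
      also have "\<dots> \<le> \<sigma> / (4 * H)" using elim(2) by simp
      finally show "?f \<xi> \<le> 1 * H * (\<sigma> / (4 * H))" using \<xi> by (intro fle) auto
    qed auto
    also have "\<dots> \<le> \<sigma> / 4" using H \<sigma> by simp
    finally have I1: "integral {0..1/2} ?f \<le> \<sigma> / 4" .
    have "integral {1/2..s} ?f \<le> integral {1/2..s::real} (\<lambda>_. 1 * H * 1)"
    proof (intro integral_le surviving_integrable \<delta> fle)
      fix \<xi> :: real assume \<xi>: "\<xi> \<in> {1/2..s}"
      then show "exp (age \<delta> \<xi> - age \<delta> 1) \<le> 1" using age_mono[OF \<delta>, of \<xi> 1] s by simp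
    qed (use s in auto)
    also have "\<dots> = H * (s - 1/2)" using s by simp
    also have "\<dots> \<le> \<sigma> / 4" by (rule s(3))
    finally have I2: "integral {1/2..s} ?f \<le> \<sigma> / 4" .
    have "integral {s..1} ?f \<le> integral {s..1} (\<lambda>\<xi>. exp (\<delta> / d\<^sup>2) * (\<xi> * h_LSW \<xi> * surv \<xi>))"
    proof (intro integral_le surviving_integrable \<delta> integrable_on_mult_right rho_tail_integrable s)
      fix \<xi> assume \<xi>: "\<xi> \<in> {s..1}"
      then have "d \<le> den 0 \<xi>" unfolding d_def using s by (intro den0_mono) auto
      then have "\<delta> / (den 0 \<xi>)\<^sup>2 \<le> \<delta> / d\<^sup>2" using d \<delta> by (intro divide_left_mono power_mono mult_pos_pos zero_less_power) auto
      then have "exp (\<delta> / (den 0 \<xi>)\<^sup>2) * surv \<xi> \<le> exp (\<delta> / d\<^sup>2) * surv \<xi>"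
        using surv_pos[of \<xi>] by (intro mult_right_mono) auto
      then have "exp (age \<delta> \<xi> - age \<delta> 1) \<le> exp (\<delta> / d\<^sup>2) * surv \<xi>"
        using survival_comparison(2)[OF \<delta>, of \<xi>] \<xi> s by simp
      then have "\<xi> * h_LSW \<xi> * exp (age \<delta> \<xi> - age \<delta> 1) \<le> \<xi> * h_LSW \<xi> * (exp (\<delta> / d\<^sup>2) * surv \<xi>)"
        using \<xi> s h_LSW_nonneg[of \<xi>] by (intro mult_left_mono) auto
      then show "?f \<xi> \<le> exp (\<delta> / d\<^sup>2) * (\<xi> * h_LSW \<xi> * surv \<xi>)" by (simp only: mult.left_commute)
    qed (use s in auto)
    also have "\<dots> = exp (\<delta> / d\<^sup>2) * integral {s..1} (\<lambda>\<xi>. \<xi> * h_LSW \<xi> * surv \<xi>)"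
      by (rule Henstock_Kurzweil_Integration.integral_mult_right)
    also have "integral {s..1} (\<lambda>\<xi>. \<xi> * h_LSW \<xi> * surv \<xi>) \<le> rho"
      unfolding rho_def using s h_LSW_nonneg surv_pos
      by (intro integral_subset_le rho_tail_integrable set_lebesgue_integral_eq_integral(1)[OF rho_integrable])
         (auto intro!: mult_nonneg_nonneg simp: less_imp_le)
    finally have I3: "integral {s..1} ?f \<le> exp (\<delta> / d\<^sup>2) * rho" by simp
    have "integral {0..1/2} ?f + integral {1/2..1} ?f = surviving \<delta>"
      unfolding surviving_def by (rule Henstock_Kurzweil_Integration.integral_combine) (auto intro!: surviving_integrable \<delta>)
    moreover have "integral {1/2..s} ?f + integral {s..1} ?f = integral {1/2..1} ?f"
      using s by (intro Henstock_Kurzweil_Integration.integral_combine surviving_integrable \<delta>) auto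
    ultimately show ?case using I1 I2 I3 elim(1) by (simp add: mult.commute)
  qed
qed

locale unit_test_weight = test_weight +
  assumes \<gamma>_ge_id: "\<And>z. 0 \<le> z \<Longrightarrow> z \<le> 1 \<Longrightarrow> z \<le> \<gamma> z" and \<gamma>_le_1: "\<And>z. 0 \<le> z \<Longrightarrow> z \<le> 1 \<Longrightarrow> \<gamma> z \<le> 1"
    and \<delta>_le: "\<delta> \<le> 1"
begin

lemma moment_LSW:
  "moment \<gamma> \<delta> h_LSW \<epsilon> \<epsilon>t = integral {0..1} (\<lambda>\<xi>. \<xi> * h_LSW \<xi> * green \<gamma> \<delta> \<epsilon> \<epsilon>t \<xi>)"
proof -
  have "moment \<gamma> \<delta> h_LSW \<epsilon> \<epsilon>t = integral {0..} (\<lambda>\<xi>. if \<xi> \<in> {0..1} then \<xi> * h_LSW \<xi> * green \<gamma> \<delta> \<epsilon> \<epsilon>t \<xi> else 0)"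
    unfolding moment_def by (intro integral_cong) (simp add: h_LSW_zero)
  also have "\<dots> = integral ({0..} \<inter> {0..1}) (\<lambda>\<xi>. \<xi> * h_LSW \<xi> * green \<gamma> \<delta> \<epsilon> \<epsilon>t \<xi>)"
    by (simp only: integral_restrict_Int Int_commute)
  also have "{0..} \<inter> {0..1::real} = {0..1}" by auto
  finally show ?thesis .
qed

lemma green_LSW_integrable:
  "0 \<le> a \<Longrightarrow> (\<lambda>\<xi>. \<xi> * h_LSW \<xi> * green \<gamma> \<delta> \<epsilon> \<epsilon>t \<xi>) absolutely_integrable_on {a..b}"
  by (intro h_LSW_times_integrable continuous_on_subset[OF continuous_on_green]) auto

lemma moment_LSW_upper:
  assumes "0 \<le> \<epsilon>" "0 \<le> \<epsilon>t"
  shows "moment \<gamma> \<delta> h_LSW \<epsilon> \<epsilon>t \<le> exp (age \<delta> 1) * kap \<gamma> \<delta> 1 * surviving \<delta>"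
proof -
  have "moment \<gamma> \<delta> h_LSW \<epsilon> \<epsilon>t \<le> integral {0..1} (\<lambda>\<xi>. (exp (age \<delta> 1) * kap \<gamma> \<delta> 1) * (\<xi> * h_LSW \<xi> * exp (age \<delta> \<xi> - age \<delta> 1)))"
    unfolding moment_LSW
  proof (intro integral_le set_lebesgue_integral_eq_integral(1)[OF green_LSW_integrable] integrable_on_mult_right surviving_integrable \<delta>)
    fix \<xi> :: real assume \<xi>: "\<xi> \<in> {0..1}"
    have "green \<gamma> \<delta> \<epsilon> \<epsilon>t \<xi> \<le> exp (age \<delta> \<xi>) * kap \<gamma> \<delta> \<xi>" using assms \<xi> by (intro green_le_free) auto
    also have "\<dots> \<le> exp (age \<delta> \<xi>) * kap \<gamma> \<delta> 1"
      using \<xi> \<gamma>_nonneg by (intro mult_left_mono kap_mono \<delta> \<gamma>_cont) auto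
    also have "exp (age \<delta> \<xi>) = exp (age \<delta> 1) * exp (age \<delta> \<xi> - age \<delta> 1)" by (simp add: exp_diff)
    finally have "\<xi> * h_LSW \<xi> * green \<gamma> \<delta> \<epsilon> \<epsilon>t \<xi> \<le> \<xi> * h_LSW \<xi> * (exp (age \<delta> 1) * exp (age \<delta> \<xi> - age \<delta> 1) * kap \<gamma> \<delta> 1)"
      using \<xi> h_LSW_nonneg[of \<xi>] by (intro mult_left_mono) auto
    then show "\<xi> * h_LSW \<xi> * green \<gamma> \<delta> \<epsilon> \<epsilon>t \<xi> \<le> (exp (age \<delta> 1) * kap \<gamma> \<delta> 1) * (\<xi> * h_LSW \<xi> * exp (age \<delta> \<xi> - age \<delta> 1))"
      by (simp only: mult_ac)
  qed auto
  then show ?thesis unfolding Henstock_Kurzweil_Integration.integral_mult_right surviving_def .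
qed

text \<open>
  Only sources beyond $1/2$ and response below $1/2$ are kept. Since $D$ increases with $\delta$,
  $e^{A(\xi)-A(1)}$ is at least its limit, and therefore the bound holds with \<open>rho\<close> itself.
\<close>

lemma moment_LSW_lower:
  assumes "0 \<le> \<epsilon>" "0 \<le> \<epsilon>t" and \<kappa>: "(\<epsilon> + \<epsilon>t) * age \<delta> 1 \<le> \<kappa>"
  shows "exp (- \<kappa>) * (exp (age \<delta> 1) * kap \<gamma> \<delta> (1/2) * rho) \<le> moment \<gamma> \<delta> h_LSW \<epsilon> \<epsilon>t"
proof -
  let ?c = "exp (- \<kappa>) * (exp (age \<delta> 1) * kap \<gamma> \<delta> (1/2))"
  have sub: "{1/2<..1::real} \<subseteq> {0..1}" by auto
  have i: "(\<lambda>\<xi>. \<xi> * h_LSW \<xi> * green \<gamma> \<delta> \<epsilon> \<epsilon>t \<xi>) integrable_on {1/2<..1}"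
    using green_LSW_integrable[of 0 1 \<epsilon> \<epsilon>t]
    by (intro set_lebesgue_integral_eq_integral(1)[OF set_integrable_subset[OF _ upper_interval_sets sub]]) simp
  have k0: "0 \<le> kap \<gamma> \<delta> (1/2)"
    using kap_mono[OF \<delta> \<gamma>_cont, of 0 "1/2"] \<gamma>_nonneg \<delta> by simp
  have "?c * rho = integral {1/2<..1} (\<lambda>\<xi>. ?c * (\<xi> * h_LSW \<xi> * surv \<xi>))"
    unfolding rho_def by (rule Henstock_Kurzweil_Integration.integral_mult_right[symmetric])
  also have "\<dots> \<le> integral {1/2<..1} (\<lambda>\<xi>. \<xi> * h_LSW \<xi> * green \<gamma> \<delta> \<epsilon> \<epsilon>t \<xi>)"
  proof (intro integral_le i integrable_on_mult_right set_lebesgue_integral_eq_integral(1)[OF rho_integrable])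
    fix \<xi> :: real assume \<xi>: "\<xi> \<in> {1/2<..1}"
    have "surv \<xi> * kap \<gamma> \<delta> (1/2) \<le> exp (age \<delta> \<xi> - age \<delta> 1) * kap \<gamma> \<delta> \<xi>"
    proof (rule mult_mono)
      show "surv \<xi> \<le> exp (age \<delta> \<xi> - age \<delta> 1)" using survival_comparison(1)[OF \<delta>] \<xi> by simp
      show "kap \<gamma> \<delta> (1/2) \<le> kap \<gamma> \<delta> \<xi>" using \<xi> \<gamma>_nonneg by (intro kap_mono \<delta> \<gamma>_cont) auto
    qed (use k0 in auto)
    then have "exp (- \<kappa>) * (exp (age \<delta> 1) * (surv \<xi> * kap \<gamma> \<delta> (1/2)))
        \<le> exp (- \<kappa>) * (exp (age \<delta> 1) * (exp (age \<delta> \<xi> - age \<delta> 1) * kap \<gamma> \<delta> \<xi>))"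
      by (intro mult_left_mono) auto
    also have "\<dots> = exp (- \<kappa>) * (exp (age \<delta> \<xi>) * kap \<gamma> \<delta> \<xi>)" by (simp add: exp_diff)
    also have "\<dots> \<le> green \<gamma> \<delta> \<epsilon> \<epsilon>t \<xi>" using \<xi> \<kappa> assms by (intro green_lower) auto
    finally have "\<xi> * h_LSW \<xi> * (exp (- \<kappa>) * (exp (age \<delta> 1) * (surv \<xi> * kap \<gamma> \<delta> (1/2)))) \<le> \<xi> * h_LSW \<xi> * green \<gamma> \<delta> \<epsilon> \<epsilon>t \<xi>"
      using \<xi> h_LSW_nonneg[of \<xi>] by (intro mult_left_mono) auto
    then show "?c * (\<xi> * h_LSW \<xi> * surv \<xi>) \<le> \<xi> * h_LSW \<xi> * green \<gamma> \<delta> \<epsilon> \<epsilon>t \<xi>" by (simp only: mult_ac)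
  qed
  also have "\<dots> \<le> moment \<gamma> \<delta> h_LSW \<epsilon> \<epsilon>t"
    unfolding moment_LSW using h_LSW_nonneg green_nonneg
    by (intro integral_subset_le i set_lebesgue_integral_eq_integral(1)[OF green_LSW_integrable] sub) (auto intro!: mult_nonneg_nonneg)
  finally show ?thesis by (simp only: mult.assoc)
qed

text \<open>
  The upper and the lower bound differ by the factor $e^{-\kappa}$, by the mass
  $kap(1) - kap(1/2) \le e^{-A(1/2)}$ beyond the middle of the bottleneck, and by the error of
  \<open>surviving_upper\<close>; each of them is at most of order $\tau$.
\<close>

lemma moment_LSW_sandwich:
  assumes "0 \<le> \<epsilon>" "0 \<le> \<epsilon>t" and \<tau>: "0 < \<tau>" "\<tau> \<le> 1"
    and \<kappa>: "(\<epsilon> + \<epsilon>t) * age \<delta> 1 \<le> \<tau> / 2"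
    and half: "exp (- age \<delta> (1/2)) \<le> \<tau> / 2 * (exp (-512) / 192)"
    and surv: "surviving \<delta> \<le> rho + \<tau> * rho"
  shows "(1 - \<tau>) * (exp (age \<delta> 1) * kap \<gamma> \<delta> 1 * rho) \<le> moment \<gamma> \<delta> h_LSW \<epsilon> \<epsilon>t"
    and "moment \<gamma> \<delta> h_LSW \<epsilon> \<epsilon>t \<le> (1 + \<tau>) * (exp (age \<delta> 1) * kap \<gamma> \<delta> 1 * rho)"
proof -
  have k1: "exp (-512) / 192 \<le> kap \<gamma> \<delta> 1" by (rule kap_ge[OF \<delta> \<gamma>_cont \<gamma>_ge_id \<delta>_le])
  have k1p: "0 < kap \<gamma> \<delta> 1" by (rule less_le_trans[OF _ k1]) simp
  have "kap \<gamma> \<delta> 1 - kap \<gamma> \<delta> (1/2) \<le> 1 * (exp (- age \<delta> (1/2)) - exp (- age \<delta> 1))"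
    using \<gamma>_le_1 by (intro kap_diff_le \<delta> \<gamma>_cont) auto
  also have "\<dots> \<le> exp (- age \<delta> (1/2))" by simp
  also have "\<dots> \<le> \<tau> / 2 * kap \<gamma> \<delta> 1"
    using half mult_left_mono[OF k1, of "\<tau> / 2"] \<tau> by linarith
  finally have "(1 - \<tau> / 2) * kap \<gamma> \<delta> 1 \<le> kap \<gamma> \<delta> (1/2)" by (simp add: algebra_simps)
  moreover have "1 - \<tau> / 2 \<le> exp (- (\<tau> / 2))" using exp_ge_add_one_self[of "- (\<tau> / 2)"] by simp
  ultimately have "(1 - \<tau> / 2) * ((1 - \<tau> / 2) * kap \<gamma> \<delta> 1) \<le> exp (- (\<tau> / 2)) * kap \<gamma> \<delta> (1/2)"
    using \<tau> k1p by (intro mult_mono) auto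
  moreover have "(1 - \<tau>) * kap \<gamma> \<delta> 1 \<le> ((1 - \<tau> / 2) * (1 - \<tau> / 2)) * kap \<gamma> \<delta> 1"
    using k1p by (intro mult_right_mono) (auto simp: algebra_simps)
  ultimately have "(1 - \<tau>) * kap \<gamma> \<delta> 1 \<le> exp (- (\<tau> / 2)) * kap \<gamma> \<delta> (1/2)" by (simp add: mult.assoc)
  then have "((1 - \<tau>) * kap \<gamma> \<delta> 1) * (exp (age \<delta> 1) * rho) \<le> (exp (- (\<tau> / 2)) * kap \<gamma> \<delta> (1/2)) * (exp (age \<delta> 1) * rho)"
    using rho_pos by (intro mult_right_mono) auto
  also have "\<dots> = exp (- (\<tau> / 2)) * (exp (age \<delta> 1) * kap \<gamma> \<delta> (1/2) * rho)" by (simp only: mult_ac)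
  also have "\<dots> \<le> moment \<gamma> \<delta> h_LSW \<epsilon> \<epsilon>t" by (rule moment_LSW_lower[OF assms(1,2) \<kappa>])
  finally show "(1 - \<tau>) * (exp (age \<delta> 1) * kap \<gamma> \<delta> 1 * rho) \<le> moment \<gamma> \<delta> h_LSW \<epsilon> \<epsilon>t"
    by (simp only: mult_ac)
  have "moment \<gamma> \<delta> h_LSW \<epsilon> \<epsilon>t \<le> exp (age \<delta> 1) * kap \<gamma> \<delta> 1 * surviving \<delta>"
    by (rule moment_LSW_upper[OF assms(1,2)])
  also have "\<dots> \<le> exp (age \<delta> 1) * kap \<gamma> \<delta> 1 * (rho + \<tau> * rho)"
    using surv k1p by (intro mult_left_mono) auto
  also have "\<dots> = (1 + \<tau>) * (exp (age \<delta> 1) * kap \<gamma> \<delta> 1 * rho)" by (simp add: algebra_simps)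
  finally show "moment \<gamma> \<delta> h_LSW \<epsilon> \<epsilon>t \<le> (1 + \<tau>) * (exp (age \<delta> 1) * kap \<gamma> \<delta> 1 * rho)" .
qed

end

section \<open>The compatibility conditions as a contraction\<close>

text \<open>
  The two equations say that $(e,t)$ is a fixed point of $(e,t) \mapsto (1/m_1, m_0/m_1^2)$. The
  normalised quantities $E m_1$ and $E^2 m_0 / E_t$ lie in $[9/10, 11/10]$, and since
  $(11/10)/(9/10)^2 < 2$ and $(9/10)/(11/10)^2 > 1/2$, the map sends the whole square $(0,w]^2$ into
  the box of the conclusion. The smallness assumption makes it a contraction with constant $1/2$ on
  that box.
\<close>

lemma compatibility_fixed_point:
  fixes m1 m0 :: "real \<Rightarrow> real \<Rightarrow> real"
  assumes E: "0 < E" "2 * E \<le> w" and Et: "0 < Et" "2 * Et \<le> w" and \<Lambda>: "0 \<le> \<Lambda>"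
    and m1: "\<And>e t. 0 < e \<Longrightarrow> e \<le> w \<Longrightarrow> 0 < t \<Longrightarrow> t \<le> w \<Longrightarrow> 9/10 \<le> E * m1 e t \<and> E * m1 e t \<le> 11/10"
    and m0: "\<And>e t. 0 < e \<Longrightarrow> e \<le> w \<Longrightarrow> 0 < t \<Longrightarrow> t \<le> w \<Longrightarrow> 9/10 * Et \<le> E\<^sup>2 * m0 e t \<and> E\<^sup>2 * m0 e t \<le> 11/10 * Et"
    and lip1: "\<And>e t e' t'. 0 < e \<Longrightarrow> 0 < t \<Longrightarrow> 0 < e' \<Longrightarrow> 0 < t' \<Longrightarrow> \<bar>m1 e t - m1 e' t'\<bar> \<le> (\<bar>e - e'\<bar> + \<bar>t - t'\<bar>) * \<Lambda>"
    and lip0: "\<And>e t e' t'. 0 < e \<Longrightarrow> 0 < t \<Longrightarrow> 0 < e' \<Longrightarrow> 0 < t' \<Longrightarrow> \<bar>m0 e t - m0 e' t'\<bar> \<le> (\<bar>e - e'\<bar> + \<bar>t - t'\<bar>) * \<Lambda>"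
    and small: "\<Lambda> * (6 * E\<^sup>2 + 8 * (E * Et)) \<le> 1/2"
  shows "\<exists>e t. 0 < e \<and> 0 < t \<and> (e * m1 e t = 1 \<and> e\<^sup>2 * m0 e t = t) \<and>
      1/2 * E \<le> e \<and> e \<le> 2 * E \<and> 1/2 * Et \<le> t \<and> t \<le> 2 * Et \<and>
      (\<forall>e' t'. 0 < e' \<and> e' \<le> w \<and> 0 < t' \<and> t' \<le> w \<and> e' * m1 e' t' = 1 \<and> e'\<^sup>2 * m0 e' t' = t' \<longrightarrow> e' = e \<and> t' = t)"
proof -
  define a where "a e t = E * m1 e t" for e t
  define c where "c e t = E\<^sup>2 * m0 e t" for e t
  define F where "F = (\<lambda>(e, t). (E / a e t, c e t / (a e t)\<^sup>2))"
  define U where "U = {1/2 * E..2 * E} \<times> {1/2 * Et..2 * Et}"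
  have UD: "0 < e" "e \<le> w" "0 < t" "t \<le> w" if "(e, t) \<in> U" for e t
    using that E Et by (auto simp: U_def)
  have ab: "9/10 \<le> a e t" "a e t \<le> 11/10" "9/10 * Et \<le> c e t" "c e t \<le> 11/10 * Et"
    if "0 < e" "e \<le> w" "0 < t" "t \<le> w" for e t
    using m1[OF that] m0[OF that] by (auto simp: a_def c_def)
  have solution_iff: "e * m1 e t = 1 \<and> e\<^sup>2 * m0 e t = t \<longleftrightarrow> F (e, t) = (e, t)"
    if D: "0 < e" "e \<le> w" "0 < t" "t \<le> w" for e t
  proof -
    have ap: "a e t \<noteq> 0" using ab[OF D] by auto
    have 1: "e * m1 e t = 1 \<longleftrightarrow> E / a e t = e"
      using E ap by (auto simp: a_def field_simps)
    have 2: "c e t / (a e t)\<^sup>2 = e\<^sup>2 * m0 e t" if "E / a e t = e"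
    proof -
      have "c e t / (a e t)\<^sup>2 = (E / a e t)\<^sup>2 * m0 e t" by (simp add: c_def power_divide)
      then show ?thesis unfolding that .
    qed
    show ?thesis using 1 2 by (auto simp: F_def)
  qed
  have FU: "F (e, t) \<in> U" if D: "0 < e" "e \<le> w" "0 < t" "t \<le> w" for e t
  proof -
    note ab = ab[OF D]
    define x y where "x = E / a e t" and "y = c e t / (a e t)\<^sup>2"
    have "E / (11/10) \<le> x" "x \<le> E / (9/10)"
      unfolding x_def using ab E by (intro divide_left_mono mult_pos_pos; simp)+
    moreover have "(9/10 * Et) / (11/10)\<^sup>2 \<le> y" "y \<le> (11/10 * Et) / (9/10)\<^sup>2"
      unfolding y_def using ab Et by (intro frac_le power_mono; simp)+
    ultimately have "(x, y) \<in> U" using E Et by (simp add: U_def power2_eq_square)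
    then show ?thesis by (simp add: F_def x_def y_def)
  qed
  have contraction: "dist (F p) (F q) \<le> 1/2 * dist p q" if "p \<in> U" "q \<in> U" for p q
  proof -
    obtain e t e' t' where pq: "p = (e, t)" "q = (e', t')" by (cases p, cases q) auto
    note D = UD[OF \<open>p \<in> U\<close>[unfolded pq]] and D' = UD[OF \<open>q \<in> U\<close>[unfolded pq]]
    define d where "d = \<bar>e - e'\<bar> + \<bar>t - t'\<bar>"
    have d: "0 \<le> d" "d \<le> 2 * dist p q"
    proof -
      show "0 \<le> d" by (simp add: d_def)
      show "d \<le> 2 * dist p q"
        using dist_fst_le[of p q] dist_snd_le[of p q] by (simp add: d_def pq dist_real_def)
    qed
    let ?a = "a e t" and ?a' = "a e' t'" and ?c = "c e t" and ?c' = "c e' t'"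
    note A = ab[OF D] and A' = ab[OF D']
    have da: "\<bar>?a - ?a'\<bar> \<le> E * (d * \<Lambda>)"
    proof -
      have "\<bar>?a - ?a'\<bar> = E * \<bar>m1 e t - m1 e' t'\<bar>"
        using E by (simp add: a_def abs_mult flip: right_diff_distrib)
      then show ?thesis using lip1[OF D(1,3) D'(1,3)] E by (simp add: d_def)
    qed
    have dc: "\<bar>?c - ?c'\<bar> \<le> E\<^sup>2 * (d * \<Lambda>)"
    proof -
      have "\<bar>?c - ?c'\<bar> = E\<^sup>2 * \<bar>m0 e t - m0 e' t'\<bar>"
        by (simp add: c_def abs_mult flip: right_diff_distrib)
      then show ?thesis using lip0[OF D(1,3) D'(1,3)] E by (simp add: d_def)
    qed
    have aa: "81/100 \<le> ?a * ?a'" using mult_mono[of "9/10" ?a "9/10" ?a'] A A' by simp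
    have a2: "81/100 \<le> ?a\<^sup>2" "81/100 \<le> ?a'\<^sup>2"
      using mult_mono[of "9/10" ?a "9/10" ?a] mult_mono[of "9/10" ?a' "9/10" ?a'] A A' by (auto simp: power2_eq_square)
    have "E / ?a - E / ?a' = E * (?a' - ?a) / (?a * ?a')"
      using A A' by (simp add: field_simps)
    then have "\<bar>E / ?a - E / ?a'\<bar> = \<bar>E\<bar> * \<bar>?a - ?a'\<bar> / \<bar>?a * ?a'\<bar>"
      by (simp only: abs_divide abs_mult[of E] abs_minus_commute[of ?a' ?a])
    also have "\<dots> = E * \<bar>?a - ?a'\<bar> / (?a * ?a')" using E aa by simp
    also have "\<dots> \<le> E * (E * (d * \<Lambda>)) / (81/100)"
      using da E aa by (intro frac_le mult_left_mono) auto
    finally have X: "\<bar>E / ?a - E / ?a'\<bar> \<le> 100/81 * (E\<^sup>2 * (d * \<Lambda>))" by (simp add: power2_eq_square)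
    have split: "?c / ?a\<^sup>2 - ?c' / ?a'\<^sup>2 = (?c - ?c') / ?a\<^sup>2 + ?c' * ((?a' - ?a) * (?a' + ?a)) / (?a\<^sup>2 * ?a'\<^sup>2)"
    proof -
      have frac: "(x - y) / A + y * (B - A) / (A * B) = x / A - y / B" if "A > 0" "B > 0" for x y A B :: real
        using that by (simp add: field_simps)
      have fac: "(y - x) * (y + x) = y\<^sup>2 - x\<^sup>2" for x y :: real
        by (simp add: power2_eq_square algebra_simps)
      have pos: "0 < ?a\<^sup>2" "0 < ?a'\<^sup>2" using a2 by linarith+
      show ?thesis unfolding fac by (rule frac[OF pos, symmetric])
    qed
    have "\<bar>?c / ?a\<^sup>2 - ?c' / ?a'\<^sup>2\<bar> \<le> \<bar>(?c - ?c') / ?a\<^sup>2\<bar> + \<bar>?c' * ((?a' - ?a) * (?a' + ?a)) / (?a\<^sup>2 * ?a'\<^sup>2)\<bar>"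
      unfolding split by (rule abs_triangle_ineq)
    also have "\<bar>(?c - ?c') / ?a\<^sup>2\<bar> \<le> (E\<^sup>2 * (d * \<Lambda>)) / (81/100)"
      unfolding abs_divide using dc a2 by (intro frac_le) auto
    also have "\<bar>?c' * ((?a' - ?a) * (?a' + ?a)) / (?a\<^sup>2 * ?a'\<^sup>2)\<bar> \<le> ((11/10 * Et) * ((E * (d * \<Lambda>)) * (22/10))) / (81/100 * (81/100))"
    proof -
      have "\<bar>?c' * ((?a' - ?a) * (?a' + ?a))\<bar> \<le> (11/10 * Et) * ((E * (d * \<Lambda>)) * (22/10))"
        unfolding abs_mult using A A' da E Et \<Lambda> d(1)
        by (intro mult_mono mult_nonneg_nonneg) (auto simp: abs_minus_commute)
      moreover have "81/100 * (81/100) \<le> \<bar>?a\<^sup>2 * ?a'\<^sup>2\<bar>"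
        unfolding abs_mult using a2 by (intro mult_mono) auto
      ultimately show ?thesis unfolding abs_divide by (intro frac_le) auto
    qed
    finally have *: "\<bar>?c / ?a\<^sup>2 - ?c' / ?a'\<^sup>2\<bar> \<le> (E\<^sup>2 * (d * \<Lambda>)) / (81/100) + ((11/10 * Et) * ((E * (d * \<Lambda>)) * (22/10))) / (81/100 * (81/100))"
      by simp
    have Y: "\<bar>?c / ?a\<^sup>2 - ?c' / ?a'\<^sup>2\<bar> \<le> 100/81 * (E\<^sup>2 * (d * \<Lambda>)) + 4 * (E * Et * (d * \<Lambda>))"
    proof -
      define y where "y = E * Et * (d * \<Lambda>)"
      have y: "0 \<le> y" using E Et \<Lambda> d(1) by (simp add: y_def)
      have e1: "((11/10 * Et) * ((E * (d * \<Lambda>)) * (22/10))) / (81/100 * (81/100)) = 24200 / 6561 * y"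
        by (simp add: y_def)
      have e2: "(E\<^sup>2 * (d * \<Lambda>)) / (81/100) = 100/81 * (E\<^sup>2 * (d * \<Lambda>))" by simp
      show ?thesis using * y unfolding e1 e2 y_def[symmetric] by linarith
    qed
    have "dist (F p) (F q) \<le> \<bar>E / ?a - E / ?a'\<bar> + \<bar>?c / ?a\<^sup>2 - ?c' / ?a'\<^sup>2\<bar>"
      unfolding pq F_def prod.case dist_Pair_Pair dist_real_def by (rule sqrt_sum_squares_le_sum) auto
    also have "\<dots> \<le> d * (\<Lambda> * (3 * E\<^sup>2 + 4 * (E * Et)))"
    proof -
      define x y where "x = E\<^sup>2 * (d * \<Lambda>)" and "y = E * Et * (d * \<Lambda>)"
      have "0 \<le> x" using \<Lambda> d(1) by (simp add: x_def)
      moreover have "d * (\<Lambda> * (3 * E\<^sup>2 + 4 * (E * Et))) = 3 * x + 4 * y" by (simp add: x_def y_def algebra_simps)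
      ultimately show ?thesis using X Y unfolding x_def[symmetric] y_def[symmetric] by linarith
    qed
    also have "\<dots> \<le> (2 * dist p q) * (\<Lambda> * (3 * E\<^sup>2 + 4 * (E * Et)))"
      using d \<Lambda> E Et by (intro mult_right_mono) auto
    also have "\<dots> = dist p q * (\<Lambda> * (6 * E\<^sup>2 + 8 * (E * Et)))" by (simp add: algebra_simps)
    also have "\<dots> \<le> dist p q * (1/2)" using small by (intro mult_left_mono) auto
    finally show "dist (F p) (F q) \<le> 1/2 * dist p q" by simp
  qed
  have "\<exists>!p\<in>U. F p = p"
  proof (rule Banach_fix[OF _ _ _ _ _ contraction])
    show "complete U" unfolding U_def
      by (intro compact_imp_complete compact_Times) auto
    have "(E, Et) \<in> U" using E Et by (simp add: U_def)
    then show "U \<noteq> {}" by blast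
    show "F ` U \<subseteq> U"
    proof
      fix p assume "p \<in> F ` U"
      then obtain e t where p: "(e, t) \<in> U" "p = F (e, t)" by auto
      show "p \<in> U" unfolding p(2) by (rule FU[OF UD[OF p(1)]])
    qed
  qed auto
  then obtain e t where p: "(e, t) \<in> U" "F (e, t) = (e, t)" and uniq: "\<And>q. q \<in> U \<Longrightarrow> F q = q \<Longrightarrow> q = (e, t)"
    by (metis surj_pair)
  note D = UD[OF p(1)]
  show ?thesis
  proof (rule exI[of _ e], rule exI[of _ t], intro conjI allI impI)
    show "e * m1 e t = 1" "e\<^sup>2 * m0 e t = t" using solution_iff[OF D] p(2) by auto
    show "1/2 * E \<le> e" "e \<le> 2 * E" "1/2 * Et \<le> t" "t \<le> 2 * Et" using p(1) by (auto simp: U_def)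
    fix e' t' assume *: "0 < e' \<and> e' \<le> w \<and> 0 < t' \<and> t' \<le> w \<and> e' * m1 e' t' = 1 \<and> e'\<^sup>2 * m0 e' t' = t'"
    then have D': "0 < e'" "e' \<le> w" "0 < t'" "t' \<le> w" by auto
    have "F (e', t') = (e', t')" using solution_iff[OF D'] * by blast
    then have "(e', t') = (e, t)" using FU[OF D'] uniq by metis
    then show "e' = e" "t' = t" by auto
  qed (use D in auto)
qed

text \<open>
  Beyond $1$ the weight $z^{\beta_2}$ is at least $1$ and may be dropped; on $[0,1]$ the factor
  $e^{\beta_1}$ compensates the decay of $e^{-\beta_1 z}$.
\<close>

lemma Z_norm_pointwise:
  assumes \<beta>: "\<beta>1 > 0" "\<beta>2 > 1" and \<Phi>: "\<Phi> \<in> Z_space \<beta>1 \<beta>2" and r: "Z_norm \<beta>1 \<beta>2 (\<lambda>z. \<Phi> z - Phi_LSW z) \<le> r" and z: "0 \<le> z"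
  shows "\<bar>\<Phi> z - Phi_LSW z\<bar> \<le> (r * exp \<beta>1) * exp (- \<beta>1 * z)"
proof -
  define f g where "f z = \<bar>\<Phi> z - Phi_LSW z\<bar>" and "g z = \<bar>(\<Phi> z - Phi_LSW z) * exp (\<beta>1 * z) * z powr \<beta>2\<bar>" for z
  have bf: "bdd_above (f ` {0..1})"
  proof -
    obtain M where M: "\<And>z. z \<in> {0..1} \<Longrightarrow> \<bar>\<Phi> z\<bar> \<le> M"
    proof -
      have "bdd_above ((\<lambda>z. \<bar>\<Phi> z\<bar>) ` {0..1})" using \<Phi> by (simp add: Z_space_def)
      then obtain M where "\<forall>y\<in>(\<lambda>z. \<bar>\<Phi> z\<bar>) ` {0..1}. y \<le> M" unfolding bdd_above_def by blast
      then show ?thesis by (intro that[of M]) auto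
    qed
    have "f z \<le> M + LSW_sup" if "z \<in> {0..1}" for z
      using M[OF that] Phi_LSW_bounds[of z] unfolding f_def by linarith
    then show ?thesis by (intro bdd_aboveI2)
  qed
  have bg: "bdd_above (g ` {1..})"
  proof -
    have "g ` {1..} = (\<lambda>z. \<bar>\<Phi> z * exp (\<beta>1 * z) * z powr \<beta>2\<bar>) ` {1..}"
      by (intro image_cong refl) (simp add: g_def Phi_LSW_zero)
    then show ?thesis using \<Phi> by (simp add: Z_space_def)
  qed
  have sum: "(SUP z\<in>{0..1}. f z) + (SUP z\<in>{1..}. g z) \<le> r" using r by (simp add: Z_norm_def f_def g_def)
  have f_le: "f z \<le> (SUP z\<in>{0..1}. f z)" if "z \<in> {0..1}" for z by (rule cSUP_upper[OF that bf])
  have g_le: "g z \<le> (SUP z\<in>{1..}. g z)" if "z \<in> {1..}" for z by (rule cSUP_upper[OF that bg])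
  have "0 \<le> f 0" "0 \<le> g 1" by (auto simp: f_def g_def)
  then have F0: "0 \<le> (SUP z\<in>{0..1}. f z)" and G0: "0 \<le> (SUP z\<in>{1..}. g z)"
    using f_le[of 0] g_le[of 1] by auto
  have r0: "0 \<le> r" using F0 G0 sum by linarith
  have fr: "f z \<le> r" if "z \<in> {0..1}" for z using f_le[OF that] G0 sum by linarith
  have gr: "g z \<le> r" if "z \<in> {1..}" for z using g_le[OF that] F0 sum by linarith
  show ?thesis
  proof (cases "z \<le> 1")
    case True
    have "f z \<le> r * 1" using fr z True by simp
    also have "\<dots> \<le> r * exp (\<beta>1 - \<beta>1 * z)"
      using r0 True z \<beta> mult_left_le[of z \<beta>1] by (intro mult_left_mono) auto
    also have "\<dots> = (r * exp \<beta>1) * exp (- \<beta>1 * z)" by (simp add: exp_diff exp_minus divide_inverse)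
    finally show ?thesis by (simp add: f_def)
  next
    case False
    have "f z * (exp (\<beta>1 * z) * 1) \<le> f z * (exp (\<beta>1 * z) * z powr \<beta>2)"
      using False \<beta> by (intro mult_left_mono ge_one_powr_ge_zero) (auto simp: f_def)
    also have "\<dots> = g z" by (simp add: f_def g_def abs_mult)
    also have "\<dots> \<le> r" using gr False by simp
    finally have "f z \<le> r * exp (- \<beta>1 * z)" by (simp add: exp_minus field_simps)
    also have "\<dots> \<le> (r * exp \<beta>1) * exp (- \<beta>1 * z)"
      using r0 \<beta> by (intro mult_right_mono) (auto simp: mult_le_cancel_left1)
    finally show ?thesis by (simp add: f_def)
  qed
qed

section \<open>Size of the reference parameters\<close>

text \<open>
  The lower bound of \<open>kap_ge\<close>.
\<close>

abbreviation k_min :: real where "k_min \<equiv> exp (-512) / 192"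

lemma unit_test_weight_id: "0 < \<delta> \<Longrightarrow> \<delta> \<le> 1 \<Longrightarrow> unit_test_weight \<delta> (\<lambda>z. z)"
  and unit_test_weight_one: "0 < \<delta> \<Longrightarrow> \<delta> \<le> 1 \<Longrightarrow> unit_test_weight \<delta> (\<lambda>z. 1)"
  by (unfold_locales; auto)+

lemma den_1: "den \<delta> 1 = den 0 1 + \<delta>"
  by (simp add: den_def)

lemma den0_1_pos: "den 0 1 > 0"
  by (rule den0_pos_right) simp

context
  fixes \<delta> :: real assumes \<delta>: "0 < \<delta>" "\<delta> \<le> 1"
begin

lemma kap_id_bounds: "k_min \<le> kap (\<lambda>z. z) \<delta> 1" "kap (\<lambda>z. z) \<delta> 1 \<le> 1"
  and kap_one_bounds: "k_min \<le> kap (\<lambda>z. 1) \<delta> 1" "kap (\<lambda>z. 1) \<delta> 1 \<le> 1"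
  using \<delta> by (intro kap_ge kap_le_1 continuous_intros; simp)+

lemma kap_id_pos: "0 < kap (\<lambda>z. z) \<delta> 1" and kap_one_pos: "0 < kap (\<lambda>z. 1) \<delta> 1"
  by (rule less_le_trans[OF _ kap_id_bounds(1)], simp, rule less_le_trans[OF _ kap_one_bounds(1)], simp)

lemma K1_eq: "K1 \<delta> = den \<delta> 1 * exp (age \<delta> 1) * kap (\<lambda>z. z) \<delta> 1"
  and K2_eq: "K2 \<delta> = den \<delta> 1 * exp (age \<delta> 1) * kap (\<lambda>z. 1) \<delta> 1"
  unfolding K1_def K2_def by (rule K_int_eq[OF \<delta>(1)], intro continuous_intros)+

text \<open>
  The value $D_0(1)$ in $R_0$ and the value $D(1)$ in $K_{1,\delta}$ do not cancel exactly; their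
  quotient $1 + \delta/D_0(1)$ tends to $1$.
\<close>

lemma eps_eq: "eps \<delta> = 1 / (exp (age \<delta> 1) * kap (\<lambda>z. z) \<delta> 1 * rho * (1 + \<delta> / den 0 1))"
proof -
  have "K1 \<delta> * R0 (conv Phi_LSW Phi_LSW) = (den \<delta> 1 * exp (age \<delta> 1) * kap (\<lambda>z. z) \<delta> 1) * (rho / den 0 1)"
    unfolding K1_eq R0_eq[unfolded h_LSW_def] ..
  also have "\<dots> = exp (age \<delta> 1) * kap (\<lambda>z. z) \<delta> 1 * rho * (den \<delta> 1 / den 0 1)"
  proof -
    have "(d * x * k) * (q / e) = x * k * q * (d / e)" for d x k q e :: real by simp
    then show ?thesis .
  qed
  also have "den \<delta> 1 / den 0 1 = 1 + \<delta> / den 0 1"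
    using den0_1_pos unfolding den_1[of \<delta>] by (simp add: add_divide_distrib)
  finally show ?thesis unfolding eps_def by (rule arg_cong[of _ _ "\<lambda>x. 1 / x"])
qed

lemma epst_eq: "epst \<delta> = eps \<delta> * (kap (\<lambda>z. 1) \<delta> 1 / kap (\<lambda>z. z) \<delta> 1)"
proof -
  have "K2 \<delta> / K1 \<delta> = kap (\<lambda>z. 1) \<delta> 1 / kap (\<lambda>z. z) \<delta> 1"
    unfolding K1_eq K2_eq using den_pos[of \<delta> 1] \<delta> by simp
  then show ?thesis by (simp add: epst_def)
qed

lemma eps_pos: "0 < eps \<delta>" and epst_pos: "0 < epst \<delta>"
proof -
  have "0 < 1 + \<delta> / den 0 1" using \<delta> den0_1_pos by (simp add: add_pos_pos)
  then show "0 < eps \<delta>" unfolding eps_eq using kap_id_pos rho_pos by simp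
  then show "0 < epst \<delta>" unfolding epst_eq using kap_id_pos kap_one_pos by simp
qed

lemma eps_le_exp_age: "eps \<delta> * exp (age \<delta> 1) \<le> 1 / (k_min * rho)"
proof -
  have "eps \<delta> * exp (age \<delta> 1) = 1 / (kap (\<lambda>z. z) \<delta> 1 * rho * (1 + \<delta> / den 0 1))"
  proof -
    have "1 / (exp x * k * q * e) * exp x = 1 / (k * q * e)" for x k q e :: real by simp
    then show ?thesis unfolding eps_eq .
  qed
  also have "\<dots> \<le> 1 / (k_min * rho * 1)"
  proof (rule frac_le)
    have "0 \<le> \<delta> / den 0 1" using \<delta> den0_1_pos by simp
    then show "k_min * rho * 1 \<le> kap (\<lambda>z. z) \<delta> 1 * rho * (1 + \<delta> / den 0 1)"
      using kap_id_bounds(1) rho_pos kap_id_pos by (intro mult_mono mult_nonneg_nonneg) auto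
  qed (use rho_pos in auto)
  finally show ?thesis by simp
qed

lemma epst_le_eps: "epst \<delta> \<le> eps \<delta> * (1 / k_min)"
  unfolding epst_eq
proof (rule mult_left_mono)
  show "kap (\<lambda>z. 1) \<delta> 1 / kap (\<lambda>z. z) \<delta> 1 \<le> 1 / k_min"
    by (rule frac_le[OF _ kap_one_bounds(2) _ kap_id_bounds(1)]) auto
  show "0 \<le> eps \<delta>" using eps_pos by simp
qed

lemma epst_ge_eps: "eps \<delta> * k_min \<le> epst \<delta>"
proof -
  have "k_min / 1 \<le> kap (\<lambda>z. 1) \<delta> 1 / kap (\<lambda>z. z) \<delta> 1"
    by (rule frac_le[OF less_imp_le[OF kap_one_pos] kap_one_bounds(1) kap_id_pos kap_id_bounds(2)])
  then have "k_min \<le> kap (\<lambda>z. 1) \<delta> 1 / kap (\<lambda>z. z) \<delta> 1" by simp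
  then show ?thesis unfolding epst_eq by (rule mult_left_mono) (use eps_pos in simp)
qed

lemma eps_upper: "eps \<delta> \<le> 1 / (k_min * rho) * exp (- (arctan (1/2) / 48) / sqrt \<delta>)"
proof -
  have "arctan (1/2) / 48 / sqrt \<delta> \<le> age \<delta> 1"
    using age_half_lower(2)[OF \<delta>] age_nonneg[OF \<delta>(1), of "1/2"] by simp
  then have "exp (- age \<delta> 1) \<le> exp (- (arctan (1/2) / 48) / sqrt \<delta>)" by simp
  then have "1 / (k_min * rho) * exp (- age \<delta> 1) \<le> 1 / (k_min * rho) * exp (- (arctan (1/2) / 48) / sqrt \<delta>)"
    using rho_pos by (intro mult_left_mono) auto
  moreover have "eps \<delta> = (eps \<delta> * exp (age \<delta> 1)) * exp (- age \<delta> 1)"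
    by (simp add: exp_minus)
  moreover have "\<dots> \<le> 1 / (k_min * rho) * exp (- age \<delta> 1)"
    using eps_le_exp_age by (intro mult_right_mono) auto
  ultimately show ?thesis by linarith
qed

lemma eps_lower: "1 / (rho * (1 + 1 / den 0 1)) * exp (- (128 * pi) / sqrt \<delta>) \<le> eps \<delta>"
proof -
  define q where "q = exp (128 * pi / sqrt \<delta>)"
  have t: "0 < 1 + \<delta> / den 0 1" "1 + \<delta> / den 0 1 \<le> 1 + 1 / den 0 1"
  proof -
    have "0 \<le> \<delta> / den 0 1" using \<delta> den0_1_pos by simp
    moreover have "\<delta> / den 0 1 \<le> 1 / den 0 1" using \<delta>(2) den0_1_pos by (rule divide_right_mono[OF _ less_imp_le])
    ultimately show "0 < 1 + \<delta> / den 0 1" "1 + \<delta> / den 0 1 \<le> 1 + 1 / den 0 1" by linarith+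
  qed
  have e: "exp (age \<delta> 1) \<le> q" using age_1_upper[OF \<delta>] by (simp add: q_def)
  have "exp (age \<delta> 1) * kap (\<lambda>z. z) \<delta> 1 \<le> q * 1"
    using kap_id_bounds kap_id_pos e by (intro mult_mono) (auto simp: q_def)
  then have "exp (age \<delta> 1) * kap (\<lambda>z. z) \<delta> 1 * rho \<le> q * 1 * rho"
    using rho_pos by (intro mult_right_mono) auto
  then have le: "exp (age \<delta> 1) * kap (\<lambda>z. z) \<delta> 1 * rho * (1 + \<delta> / den 0 1) \<le> q * 1 * rho * (1 + 1 / den 0 1)"
    by (rule mult_mono) (use t rho_pos in \<open>auto simp: q_def\<close>)
  have pos: "0 < exp (age \<delta> 1) * kap (\<lambda>z. z) \<delta> 1 * rho * (1 + \<delta> / den 0 1)"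
    by (intro mult_pos_pos exp_gt_zero kap_id_pos rho_pos t(1))
  have "1 / (q * 1 * rho * (1 + 1 / den 0 1)) \<le> eps \<delta>"
    unfolding eps_eq by (rule frac_le[OF _ order_refl pos le]) simp
  moreover have "exp (- (128 * pi) / sqrt \<delta>) = inverse q"
    unfolding q_def exp_minus[symmetric] by (rule arg_cong[of _ _ exp]) simp
  moreover have "1 / (rho * s) * inverse q = 1 / (q * 1 * rho * s)" for s
    by (simp add: inverse_eq_divide mult_ac)
  ultimately show ?thesis by metis
qed

end

text \<open>
  Up to constant factors both numbers equal $e^{-A(1)}$, and $A(1)$ lies between multiples of
  $1/\sqrt\delta$.
\<close>

lemma eps_epst_exponentially_small:
  "\<exists>c>0. \<exists>C>0. \<forall>\<delta>\<in>{0<..1}.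
     c * exp (- C / sqrt \<delta>) \<le> eps \<delta> \<and> eps \<delta> \<le> C * exp (- c / sqrt \<delta>) \<and>
     c * exp (- C / sqrt \<delta>) \<le> epst \<delta> \<and> epst \<delta> \<le> C * exp (- c / sqrt \<delta>)"
proof -
  define l where "l = 1 / (rho * (1 + 1 / den 0 1))"
  define u where "u = 1 / (k_min * rho)"
  define g :: real where "g = arctan (1/2) / 48"
  define c where "c = min g (min l (l * k_min))"
  define C where "C = max (128 * pi) (max u (u * (1 / k_min)))"
  have g: "g > 0" by (simp add: g_def zero_less_arctan_iff)
  have l: "l > 0" using rho_pos den0_1_pos by (simp add: l_def add_pos_pos)
  have u: "u > 0" using rho_pos by (simp add: u_def)
  have c: "c > 0" "c \<le> g" "c \<le> l" "c \<le> l * k_min" using g l by (auto simp: c_def)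
  have C: "C > 0" "128 * pi \<le> C" "u \<le> C" "u * (1 / k_min) \<le> C" using pi_gt_zero by (auto simp: C_def less_max_iff_disj)
  show ?thesis
  proof (rule exI[of _ c], rule conjI[OF c(1)], rule exI[of _ C], intro conjI ballI)
    fix \<delta> :: real assume "\<delta> \<in> {0<..1}"
    then have \<delta>: "0 < \<delta>" "\<delta> \<le> 1" by auto
    have ex: "exp (- C / sqrt \<delta>) \<le> exp (- (128 * pi) / sqrt \<delta>)" "exp (- g / sqrt \<delta>) \<le> exp (- c / sqrt \<delta>)"
      using C c \<delta> by (auto intro!: divide_right_mono)
    have lo: "l * exp (- C / sqrt \<delta>) \<le> eps \<delta>"
      using mult_left_mono[OF ex(1), of l] l eps_lower[OF \<delta>] unfolding l_def[symmetric] by linarith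
    have up: "eps \<delta> \<le> u * exp (- c / sqrt \<delta>)"
      using mult_left_mono[OF ex(2), of u] u eps_upper[OF \<delta>] unfolding u_def[symmetric] g_def[symmetric] by linarith
    show "c * exp (- C / sqrt \<delta>) \<le> eps \<delta>"
      using order_trans[OF mult_right_mono[OF c(3) exp_ge_zero] lo] .
    show "eps \<delta> \<le> C * exp (- c / sqrt \<delta>)"
      using order_trans[OF up mult_right_mono[OF C(3) exp_ge_zero]] .
    have "c * exp (- C / sqrt \<delta>) \<le> (l * k_min) * exp (- C / sqrt \<delta>)"
      using c by (intro mult_right_mono) auto
    also have "\<dots> = (l * exp (- C / sqrt \<delta>)) * k_min" by simp
    also have "\<dots> \<le> eps \<delta> * k_min" using lo by (intro mult_right_mono) auto
    also have "\<dots> \<le> epst \<delta>" by (rule epst_ge_eps[OF \<delta>])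
    finally show "c * exp (- C / sqrt \<delta>) \<le> epst \<delta>" .
    have "epst \<delta> \<le> eps \<delta> * (1 / k_min)" by (rule epst_le_eps[OF \<delta>])
    also have "\<dots> \<le> (u * exp (- c / sqrt \<delta>)) * (1 / k_min)" using up by (intro mult_right_mono) auto
    also have "\<dots> = (u * (1 / k_min)) * exp (- c / sqrt \<delta>)" by (simp only: mult_ac)
    also have "\<dots> \<le> C * exp (- c / sqrt \<delta>)" using C by (intro mult_right_mono) auto
    finally show "epst \<delta> \<le> C * exp (- c / sqrt \<delta>)" .
  qed (use c C in auto)
qed

section \<open>Unique solvability\<close>

text \<open>
  Moments are linear in the source, and the source $\Phi*\Phi$ changes by $O(r)$ in the exponentially
  weighted norm.
\<close>

lemma (in test_weight) moment_perturbation: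
  assumes \<beta>: "\<beta> > 0" and K: "\<And>z. z \<ge> 0 \<Longrightarrow> age \<delta> z \<le> age \<delta> 1 + K + \<beta>/4 * z"
    and \<Phi>: "\<Phi> \<in> borel_measurable (lebesgue_on {0..})"
    and b: "\<And>z. z \<ge> 0 \<Longrightarrow> \<bar>\<Phi> z\<bar> \<le> S * exp (- \<beta> * z)"
    and bL: "\<And>z. z \<ge> 0 \<Longrightarrow> \<bar>Phi_LSW z\<bar> \<le> S * exp (- \<beta> * z)"
    and d: "\<And>z. z \<ge> 0 \<Longrightarrow> \<bar>\<Phi> z - Phi_LSW z\<bar> \<le> r * exp (- \<beta> * z)"
    and pos: "0 \<le> S" "0 \<le> r" and \<epsilon>: "0 \<le> \<epsilon>" "0 \<le> \<epsilon>t"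
  shows "\<bar>moment \<gamma> \<delta> (conv \<Phi> \<Phi>) \<epsilon> \<epsilon>t - moment \<gamma> \<delta> h_LSW \<epsilon> \<epsilon>t\<bar> \<le> S * r * exp (age \<delta> 1 + K) * weight_mass \<beta>"
proof -
  let ?h = "conv \<Phi> \<Phi>"
  have SS: "0 \<le> S * S / 2" "0 \<le> S * r" using pos by auto
  have i1: "(\<lambda>\<xi>. \<xi> * ?h \<xi> * green \<gamma> \<delta> \<epsilon> \<epsilon>t \<xi>) absolutely_integrable_on {0..}"
    by (rule green_moment_integrable(1)[OF \<beta> K conv_measurable[OF \<Phi>] conv_bound[OF b b pos(1) pos(1)] SS(1) \<epsilon>])
  have i2: "(\<lambda>\<xi>. \<xi> * h_LSW \<xi> * green \<gamma> \<delta> \<epsilon> \<epsilon>t \<xi>) absolutely_integrable_on {0..}"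
    unfolding h_LSW_def
    by (rule green_moment_integrable(1)[OF \<beta> K conv_measurable[OF Phi_LSW_measurable_on] conv_bound[OF bL bL pos(1) pos(1)] SS(1) \<epsilon>])
  have "moment \<gamma> \<delta> ?h \<epsilon> \<epsilon>t - moment \<gamma> \<delta> h_LSW \<epsilon> \<epsilon>t
      = integral {0..} (\<lambda>\<xi>. \<xi> * ?h \<xi> * green \<gamma> \<delta> \<epsilon> \<epsilon>t \<xi> - \<xi> * h_LSW \<xi> * green \<gamma> \<delta> \<epsilon> \<epsilon>t \<xi>)"
    unfolding moment_def
    by (intro Henstock_Kurzweil_Integration.integral_diff[symmetric] set_lebesgue_integral_eq_integral(1) i1 i2)
  also have "\<dots> = moment \<gamma> \<delta> (\<lambda>\<xi>. ?h \<xi> - h_LSW \<xi>) \<epsilon> \<epsilon>t"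
    unfolding moment_def by (simp only: left_diff_distrib right_diff_distrib)
  finally have eq: "moment \<gamma> \<delta> ?h \<epsilon> \<epsilon>t - moment \<gamma> \<delta> h_LSW \<epsilon> \<epsilon>t = moment \<gamma> \<delta> (\<lambda>\<xi>. ?h \<xi> - h_LSW \<xi>) \<epsilon> \<epsilon>t" .
  have m: "(\<lambda>\<xi>. ?h \<xi> - h_LSW \<xi>) \<in> borel_measurable (lebesgue_on {0..})"
    by (intro borel_measurable_diff conv_measurable[OF \<Phi>] h_LSW_measurable)
  have diff: "\<bar>?h \<xi> - h_LSW \<xi>\<bar> \<le> S * r * (\<xi> * exp (- \<beta> * \<xi>))" if "0 \<le> \<xi>" for \<xi>
    unfolding h_LSW_def by (rule conv_diff_bound[OF \<Phi> Phi_LSW_measurable_on b bL d pos that])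
  show ?thesis unfolding eq by (rule green_moment_integrable(2)[OF \<beta> K m diff SS(2) \<epsilon>])
qed

lemma compatible_iff:
  assumes \<beta>: "\<beta> > 0" and K: "\<And>z. z \<ge> 0 \<Longrightarrow> age \<delta> z \<le> age \<delta> 1 + K + \<beta>/4 * z"
    and \<Phi>: "\<Phi> \<in> borel_measurable (lebesgue_on {0..})"
    and b: "\<And>z. z \<ge> 0 \<Longrightarrow> \<bar>\<Phi> z\<bar> \<le> S * exp (- \<beta> * z)" and S: "0 \<le> S"
    and \<delta>: "0 < \<delta>" "\<delta> \<le> 1" and \<epsilon>: "0 < \<epsilon>" "0 < \<epsilon>t"
  shows "compatible \<Phi> \<delta> \<epsilon> \<epsilon>t \<longleftrightarrow>
     \<epsilon> * moment (\<lambda>z. z) \<delta> (conv \<Phi> \<Phi>) \<epsilon> \<epsilon>t = 1 \<and> \<epsilon>\<^sup>2 * moment (\<lambda>z. 1) \<delta> (conv \<Phi> \<Phi>) \<epsilon> \<epsilon>t = \<epsilon>t"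
proof -
  interpret A: unit_test_weight \<delta> "\<lambda>z. z" using unit_test_weight_id \<delta> by blast
  interpret B: unit_test_weight \<delta> "\<lambda>z. 1" using unit_test_weight_one \<delta> by blast
  have SS: "0 \<le> S * S / 2" using S by simp
  have e: "0 \<le> \<epsilon>" "0 \<le> \<epsilon>t" using \<epsilon> by auto
  note m = conv_measurable[OF \<Phi>] and cb = conv_bound[OF b b S S]
  have "(LINT z:{0..}|lebesgue. z * I_op \<Phi> \<epsilon> \<epsilon>t \<delta> z) = \<epsilon> * moment (\<lambda>z. z) \<delta> (conv \<Phi> \<Phi>) \<epsilon> \<epsilon>t"
    by (rule A.moment_eq[OF \<Phi> A.green_moment_integrable(1)[OF \<beta> K m cb SS e]])
  moreover have "(LINT z:{0..}|lebesgue. I_op \<Phi> \<epsilon> \<epsilon>t \<delta> z) = \<epsilon> * moment (\<lambda>z. 1) \<delta> (conv \<Phi> \<Phi>) \<epsilon> \<epsilon>t"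
    using B.moment_eq[OF \<Phi> B.green_moment_integrable(1)[OF \<beta> K m cb SS e]] by (simp only: mult_1)
  ultimately show ?thesis unfolding compatible_def using \<epsilon> by (simp add: power2_eq_square mult.assoc)
qed

lemma (in unit_test_weight) moment_near_LSW:
  assumes pert: "\<bar>moment \<gamma> \<delta> h \<epsilon> \<epsilon>t - moment \<gamma> \<delta> h_LSW \<epsilon> \<epsilon>t\<bar> \<le> \<tau> * (exp (age \<delta> 1) * k_min * rho)"
    and "0 \<le> \<epsilon>" "0 \<le> \<epsilon>t" and \<tau>: "0 < \<tau>" "\<tau> \<le> 1"
    and \<kappa>: "(\<epsilon> + \<epsilon>t) * age \<delta> 1 \<le> \<tau> / 2"
    and half: "exp (- age \<delta> (1/2)) \<le> \<tau> / 2 * k_min"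
    and surv: "surviving \<delta> \<le> rho + \<tau> * rho"
  shows "(1 - 2 * \<tau>) * (exp (age \<delta> 1) * kap \<gamma> \<delta> 1 * rho) \<le> moment \<gamma> \<delta> h \<epsilon> \<epsilon>t"
    and "moment \<gamma> \<delta> h \<epsilon> \<epsilon>t \<le> (1 + 2 * \<tau>) * (exp (age \<delta> 1) * kap \<gamma> \<delta> 1 * rho)"
proof -
  define Q where "Q = exp (age \<delta> 1) * kap \<gamma> \<delta> 1 * rho"
  have k: "k_min \<le> kap \<gamma> \<delta> 1" by (rule kap_ge[OF \<delta> \<gamma>_cont \<gamma>_ge_id \<delta>_le])
  have "exp (age \<delta> 1) * k_min * rho \<le> Q"
    unfolding Q_def using k rho_pos by (intro mult_right_mono mult_left_mono) auto
  then have "\<tau> * (exp (age \<delta> 1) * k_min * rho) \<le> \<tau> * Q" using \<tau> by (intro mult_left_mono) auto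
  with pert have p: "\<bar>moment \<gamma> \<delta> h \<epsilon> \<epsilon>t - moment \<gamma> \<delta> h_LSW \<epsilon> \<epsilon>t\<bar> \<le> \<tau> * Q" by (rule order_trans)
  note s = moment_LSW_sandwich[OF assms(2,3) \<tau> \<kappa> half surv, folded Q_def]
  have e: "(1 - 2 * \<tau>) * Q = Q - 2 * (\<tau> * Q)" "(1 + 2 * \<tau>) * Q = Q + 2 * (\<tau> * Q)"
    "(1 - \<tau>) * Q = Q - \<tau> * Q" "(1 + \<tau>) * Q = Q + \<tau> * Q"
    by (simp_all add: algebra_simps)
  have "q - 2 * x \<le> M \<and> M \<le> q + 2 * x" if "\<bar>M - N\<bar> \<le> x" "q - x \<le> N" "N \<le> q + x" for M N x q :: real
    using that by linarith
  from this[OF p s[unfolded e]]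
  show "(1 - 2 * \<tau>) * (exp (age \<delta> 1) * kap \<gamma> \<delta> 1 * rho) \<le> moment \<gamma> \<delta> h \<epsilon> \<epsilon>t"
    and "moment \<gamma> \<delta> h \<epsilon> \<epsilon>t \<le> (1 + 2 * \<tau>) * (exp (age \<delta> 1) * kap \<gamma> \<delta> 1 * rho)"
    unfolding Q_def[symmetric] e by blast+
qed

text \<open>
  The tolerances are chosen such that $(98/100)/(101/100) \ge 9/10$ and $102/100 \le 11/10$. For the
  second moment, $K_{2,\delta}/K_{1,\delta}$ is exactly the ratio of the two values of \<open>kap\<close>.
\<close>

lemma normalised_moments:
  assumes \<delta>: "0 < \<delta>" "\<delta> \<le> 1" and small: "\<delta> / den 0 1 \<le> 1/100"
    and m1: "98/100 * (exp (age \<delta> 1) * kap (\<lambda>z. z) \<delta> 1 * rho) \<le> m1" "m1 \<le> 102/100 * (exp (age \<delta> 1) * kap (\<lambda>z. z) \<delta> 1 * rho)"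
    and m0: "98/100 * (exp (age \<delta> 1) * kap (\<lambda>z. 1) \<delta> 1 * rho) \<le> m0" "m0 \<le> 102/100 * (exp (age \<delta> 1) * kap (\<lambda>z. 1) \<delta> 1 * rho)"
  shows "9/10 \<le> eps \<delta> * m1 \<and> eps \<delta> * m1 \<le> 11/10"
    and "9/10 * epst \<delta> \<le> (eps \<delta>)\<^sup>2 * m0 \<and> (eps \<delta>)\<^sup>2 * m0 \<le> 11/10 * epst \<delta>"
proof -
  define E where "E = eps \<delta>"
  define Q1 where "Q1 = exp (age \<delta> 1) * kap (\<lambda>z. z) \<delta> 1 * rho"
  define Q0 where "Q0 = exp (age \<delta> 1) * kap (\<lambda>z. 1) \<delta> 1 * rho"
  define \<theta> where "\<theta> = 1 + \<delta> / den 0 1"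
  have E: "0 < E" "0 < epst \<delta>" using eps_pos[OF \<delta>] epst_pos[OF \<delta>] by (auto simp: E_def)
  have Q1: "0 < Q1" unfolding Q1_def using kap_id_pos[OF \<delta>] rho_pos by simp
  have "0 \<le> \<delta> / den 0 1" using \<delta> den0_1_pos by simp
  then have \<theta>: "1 \<le> \<theta>" "\<theta> \<le> 101/100" using small by (auto simp: \<theta>_def)
  have EQ1: "E * Q1 = 1 / \<theta>"
    unfolding E_def eps_eq[OF \<delta>] Q1_def[symmetric] \<theta>_def[symmetric] using Q1 by simp
  have inv: "100/101 \<le> 1 / \<theta>" "1 / \<theta> \<le> 1" using \<theta> by (auto simp: field_simps)
  have EQ0: "E\<^sup>2 * Q0 = (1 / \<theta>) * epst \<delta>"
  proof -
    have "E * (x * k0 * s) = E * (x * k1 * s) * (k0 / k1)" if "k1 \<noteq> 0" for x k0 k1 s :: real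
      using that by simp
    from this[of "kap (\<lambda>z. z) \<delta> 1" "exp (age \<delta> 1)" "kap (\<lambda>z. 1) \<delta> 1" rho]
    have "E * Q0 = E * Q1 * (kap (\<lambda>z. 1) \<delta> 1 / kap (\<lambda>z. z) \<delta> 1)"
      using kap_id_pos[OF \<delta>] unfolding Q0_def Q1_def by simp
    then have "E\<^sup>2 * Q0 = (E * Q1) * (E * (kap (\<lambda>z. 1) \<delta> 1 / kap (\<lambda>z. z) \<delta> 1))"
      by (simp only: power2_eq_square mult_ac)
    then show ?thesis unfolding EQ1 epst_eq[OF \<delta>] E_def[symmetric] .
  qed
  have "E * (98/100 * Q1) \<le> E * m1" "E * m1 \<le> E * (102/100 * Q1)"
    using m1 E unfolding Q1_def[symmetric] by (auto intro!: mult_left_mono)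
  moreover have "E * (98/100 * Q1) = 98/100 * (1 / \<theta>)" "E * (102/100 * Q1) = 102/100 * (1 / \<theta>)"
    unfolding EQ1[symmetric] by simp_all
  ultimately show "9/10 \<le> eps \<delta> * m1 \<and> eps \<delta> * m1 \<le> 11/10"
    using inv unfolding E_def[symmetric] by linarith
  define q where "q = (1 / \<theta>) * epst \<delta>"
  have "100/101 * epst \<delta> \<le> q" "q \<le> 1 * epst \<delta>"
    unfolding q_def by (rule mult_right_mono[OF inv(1) less_imp_le[OF E(2)]], rule mult_right_mono[OF inv(2) less_imp_le[OF E(2)]])
  moreover have "E\<^sup>2 * (98/100 * Q0) \<le> E\<^sup>2 * m0" "E\<^sup>2 * m0 \<le> E\<^sup>2 * (102/100 * Q0)"
    using m0 E unfolding Q0_def[symmetric] by (auto intro!: mult_left_mono)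
  moreover have "E\<^sup>2 * (98/100 * Q0) = 98/100 * q" "E\<^sup>2 * (102/100 * Q0) = 102/100 * q"
    unfolding q_def EQ0[symmetric] by simp_all
  ultimately show "9/10 * epst \<delta> \<le> (eps \<delta>)\<^sup>2 * m0 \<and> (eps \<delta>)\<^sup>2 * m0 \<le> 11/10 * epst \<delta>"
    using E unfolding E_def[symmetric] by linarith
qed


definition uniquely_solvable :: "(real \<Rightarrow> real) \<Rightarrow> real \<Rightarrow> real \<Rightarrow> bool" where
  "uniquely_solvable \<Phi> \<delta> w \<longleftrightarrow>
     (\<exists>\<epsilon> \<epsilon>t. \<epsilon> > 0 \<and> \<epsilon>t > 0 \<and> compatible \<Phi> \<delta> \<epsilon> \<epsilon>t \<and> (\<epsilon>, \<epsilon>t) \<in> U_set \<delta> \<and>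
        (\<forall>\<epsilon>' \<epsilon>t'. 0 < \<epsilon>' \<and> \<epsilon>' \<le> w \<and> 0 < \<epsilon>t' \<and> \<epsilon>t' \<le> w \<and> compatible \<Phi> \<delta> \<epsilon>' \<epsilon>t' \<longrightarrow>
           \<epsilon>' = \<epsilon> \<and> \<epsilon>t' = \<epsilon>t))"

lemma uniquely_solvable_mono: "uniquely_solvable \<Phi> \<delta> w \<Longrightarrow> w' \<le> w \<Longrightarrow> uniquely_solvable \<Phi> \<delta> w'"
  unfolding uniquely_solvable_def by (meson order_trans)

text \<open>
  The constants are fixed in this order: $\eta$ makes the exponents
  $(\varepsilon + \tilde\varepsilon) A(1)$ at most $\tau/2$, then $r$ makes the perturbation of the moments
  at most $\tau$ times their size, and finally $\delta$ is taken small. There $u$ bounds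
  $\epsilon_\delta\,e^{A(1)}$, and $N\,e^{-g/\sqrt\delta}/\sqrt\delta$ bounds the contraction factor, up to
  the normalisation used in \<open>compatibility_fixed_point\<close>.
\<close>

lemma uniquely_solvable_up_to_sqrt:
  fixes \<beta>1 \<beta>2 :: real
  assumes \<beta>: "\<beta>1 > 0" "\<beta>2 > 1"
  shows "\<exists>r>0. \<exists>\<eta>>0. \<forall>\<^sub>F \<delta> in at_right 0. \<forall>\<Phi>\<in>Z_space \<beta>1 \<beta>2.
      Z_norm \<beta>1 \<beta>2 (\<lambda>z. \<Phi> z - Phi_LSW z) \<le> r \<longrightarrow> uniquely_solvable \<Phi> \<delta> (\<eta> * sqrt \<delta>)"
proof -
  define \<beta> where "\<beta> = \<beta>1"
  have \<beta>p: "\<beta> > 0" "\<beta> / 4 > 0" using \<beta> by (auto simp: \<beta>_def)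
  define \<tau> :: real where "\<tau> = 1/100"
  define km where "km = k_min"
  define \<eta> where "\<eta> = \<tau> / (512 * pi)"
  define S where "S = (LSW_sup + 1) * exp \<beta>"
  define W where "W = weight_mass \<beta>"
  obtain K where K: "K \<ge> 0" "\<And>\<delta> z. \<delta> > 0 \<Longrightarrow> z \<ge> 0 \<Longrightarrow> age \<delta> z \<le> age \<delta> 1 + K + \<beta>/4 * z"
    using age_growth[OF \<beta>p(2)] by metis
  define P where "P = S * exp \<beta> * exp K * W"
  define r where "r = min 1 (\<tau> * km * rho / P)"
  define u where "u = 1 / (km * rho)"
  define g :: real where "g = arctan (1/2) / 48"
  define N where "N = (128 * pi + K + \<beta>/4) * (S * S / 2) * exp K * W * (u * ((6 + 8 * (1 / km)) * u))"
  have \<tau>: "0 < \<tau>" "\<tau> \<le> 1" by (auto simp: \<tau>_def)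
  have km: "0 < km" "km \<le> 1"
  proof -
    show "0 < km" by (simp add: km_def)
    have "exp (-512) \<le> (1::real)" by simp
    then show "km \<le> 1" unfolding km_def by linarith
  qed
  have \<eta>: "0 < \<eta>" using \<tau> by (simp add: \<eta>_def)
  have S: "0 < S" using LSW_sup_pos by (simp add: S_def)
  have W: "0 < W" using weight_mass_pos[OF \<beta>p(1)] by (simp add: W_def)
  have P: "0 < P" using S W by (simp add: P_def)
  have r: "0 < r" "r \<le> 1" "P * r \<le> \<tau> * km * rho"
  proof -
    show "0 < r" "r \<le> 1" using \<tau> km rho_pos P by (auto simp: r_def)
    have "P * r \<le> P * (\<tau> * km * rho / P)" using P by (intro mult_left_mono) (auto simp: r_def)
    then show "P * r \<le> \<tau> * km * rho" using P by simp
  qed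
  have u: "0 < u" using km rho_pos by (simp add: u_def)
  have g: "0 < g" by (simp add: g_def zero_less_arctan_iff)
  have N: "0 < N"
    unfolding N_def using K(1) \<beta>p S W u km
    by (intro mult_pos_pos add_pos_nonneg add_pos_pos divide_pos_pos exp_gt_zero) auto
  have "\<forall>\<^sub>F \<delta> in at_right 0. exp (- g / sqrt \<delta>) / sqrt \<delta> < min (\<eta> * km / (2 * u)) (1 / (2 * N))"
    using exp_recip_sqrt_small[OF g] \<eta> km u N by (intro order_tendstoD(2)) auto
  moreover have "\<forall>\<^sub>F \<delta> in at_right 0. exp (- age \<delta> (1/2)) \<le> \<tau> / 2 * km \<and> exp (- (age \<delta> 1 - age \<delta> (1/2))) \<le> \<tau> / 2 * km"
    using \<tau> km by (intro eventually_exp_age_half) simp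
  moreover have "\<forall>\<^sub>F \<delta> in at_right 0. surviving \<delta> \<le> rho + \<tau> * rho"
    using \<tau> rho_pos by (intro surviving_upper) simp
  moreover have "\<forall>\<^sub>F \<delta> in at_right 0. \<delta> < den 0 1 / 100"
    using den0_1_pos eventually_at_right_field[of "\<lambda>\<delta>. \<delta> < den 0 1 / 100" 0]
    by (auto intro!: exI[of _ "den 0 1 / 100"])
  ultimately have main: "\<forall>\<^sub>F \<delta> in at_right 0. \<forall>\<Phi>\<in>Z_space \<beta>1 \<beta>2.
      Z_norm \<beta>1 \<beta>2 (\<lambda>z. \<Phi> z - Phi_LSW z) \<le> r \<longrightarrow> uniquely_solvable \<Phi> \<delta> (\<eta> * sqrt \<delta>)"
    using eventually_small_delta
  proof eventually_elim
    case (elim \<delta>)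
    then have \<delta>: "0 < \<delta>" "\<delta> \<le> 1" and half: "exp (- age \<delta> (1/2)) \<le> \<tau> / 2 * k_min"
      and surv: "surviving \<delta> \<le> rho + \<tau> * rho" by (auto simp: km_def)
    have \<delta>den: "\<delta> / den 0 1 \<le> 1/100" using elim(4) den0_1_pos by (simp add: field_simps)
    define L where "L = age \<delta> 1"
    define w where "w = \<eta> * sqrt \<delta>"
    define E Et where "E = eps \<delta>" and "Et = epst \<delta>"
    define A where "A = L + K + \<beta>/4"
    define \<Lambda> where "\<Lambda> = A * (S * S / 2) * exp (L + K) * W"
    define x where "x = exp (- g / sqrt \<delta>)"
    have sq: "0 < sqrt \<delta>" "sqrt \<delta> \<le> 1" using \<delta> by auto
    have E: "0 < E" "0 < Et" "E \<le> u * x" "Et \<le> E * (1 / km)" "E * exp L \<le> u"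
      unfolding E_def Et_def u_def x_def g_def km_def L_def
      using eps_pos[OF \<delta>] epst_pos[OF \<delta>] eps_upper[OF \<delta>] epst_le_eps[OF \<delta>] eps_le_exp_age[OF \<delta>] by auto
    have L: "0 \<le> L" "L \<le> 128 * pi / sqrt \<delta>"
      using age_nonneg[OF \<delta>(1), of 1] age_1_upper[OF \<delta>] by (auto simp: L_def)
    have x: "0 < x" "x \<le> \<eta> * km / (2 * u) * sqrt \<delta>" "x / sqrt \<delta> \<le> 1 / (2 * N)"
    proof -
      have x2: "x / sqrt \<delta> < \<eta> * km / (2 * u)" "x / sqrt \<delta> < 1 / (2 * N)" using elim(1) by (auto simp: x_def)
      show "0 < x" by (simp add: x_def)
      show "x \<le> \<eta> * km / (2 * u) * sqrt \<delta>" using x2(1) sq by (simp add: pos_divide_less_eq)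
      show "x / sqrt \<delta> \<le> 1 / (2 * N)" using x2(2) by simp
    qed
    have Ew: "2 * Et \<le> w" "2 * E \<le> w"
    proof -
      have "2 * u * x \<le> 2 * u * (\<eta> * km / (2 * u) * sqrt \<delta>)" using x(2) u by (intro mult_left_mono) auto
      also have "\<dots> = km * w" using u by (simp add: w_def)
      finally have kE: "2 * E \<le> km * w" using E(3) by simp
      have w0: "0 \<le> w" using \<eta> sq by (simp add: w_def)
      have "2 * Et \<le> (2 * E) * (1 / km)" using E(4) by simp
      also have "\<dots> \<le> (km * w) * (1 / km)" using kE km by (intro mult_right_mono) auto
      finally show "2 * Et \<le> w" using km by simp
      have "km * w \<le> 1 * w" using km w0 by (intro mult_right_mono) auto
      then show "2 * E \<le> w" using kE by simp
    qed
    have A0: "0 \<le> A" using L K(1) \<beta>p by (simp add: A_def)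
    have \<Lambda>0: "0 \<le> \<Lambda>" using A0 S W by (simp add: \<Lambda>_def)
    have small: "\<Lambda> * (6 * E\<^sup>2 + 8 * (E * Et)) \<le> 1/2"
    proof -
      define q where "q = (S * S / 2) * exp K * W"
      have q: "0 \<le> q" using S W by (simp add: q_def)
      have AA: "A \<le> (128 * pi + K + \<beta>/4) / sqrt \<delta>"
      proof -
        have "K + \<beta>/4 \<le> (K + \<beta>/4) / sqrt \<delta>"
          using sq K(1) \<beta>p by (simp add: le_divide_eq mult_left_le)
        then show ?thesis using L(2) unfolding A_def by (simp add: add_divide_distrib)
      qed
      have B: "6 * E + 8 * Et \<le> (6 + 8 * (1 / km)) * u * x"
      proof -
        have "6 * E + 8 * Et \<le> 6 * E + 8 * (E * (1 / km))" using E(4) by simp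
        also have "\<dots> = (6 + 8 * (1 / km)) * E" by (simp add: algebra_simps)
        also have "\<dots> \<le> (6 + 8 * (1 / km)) * (u * x)" using E(3) km by (intro mult_left_mono) auto
        finally show ?thesis by (simp only: mult.assoc)
      qed
      have "\<Lambda> * (6 * E\<^sup>2 + 8 * (E * Et)) = A * q * ((E * exp L) * (6 * E + 8 * Et))"
        unfolding \<Lambda>_def q_def by (simp add: exp_add power2_eq_square algebra_simps)
      also have "\<dots> \<le> ((128 * pi + K + \<beta>/4) / sqrt \<delta>) * q * (u * ((6 + 8 * (1 / km)) * u * x))"
        using AA B E A0 q u L K(1) \<beta>p
        by (intro mult_mono mult_nonneg_nonneg) auto
      also have "\<dots> = N * (x / sqrt \<delta>)"
      proof -
        have "(p / s) * (t * e * w) * (c * (v * c * y)) = p * t * e * w * (c * (v * c)) * (y / s)"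
          for p s t e w c v y :: real by (simp only: divide_inverse mult_ac)
        then show ?thesis unfolding N_def q_def .
      qed
      also have "\<dots> \<le> N * (1 / (2 * N))" using x(3) N by (intro mult_left_mono) auto
      finally show ?thesis using N by simp
    qed
    show ?case
    proof (intro ballI impI)
      fix \<Phi> assume \<Phi>: "\<Phi> \<in> Z_space \<beta>1 \<beta>2" and norm: "Z_norm \<beta>1 \<beta>2 (\<lambda>z. \<Phi> z - Phi_LSW z) \<le> r"
      have meas: "\<Phi> \<in> borel_measurable (lebesgue_on {0..})" using \<Phi> by (simp add: Z_space_def)
      have d: "\<bar>\<Phi> z - Phi_LSW z\<bar> \<le> (r * exp \<beta>) * exp (- \<beta> * z)" if "0 \<le> z" for z
        unfolding \<beta>_def by (rule Z_norm_pointwise[OF \<beta> \<Phi> norm that])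
      have bL: "\<bar>Phi_LSW z\<bar> \<le> S * exp (- \<beta> * z)" if "0 \<le> z" for z
      proof -
        have "(LSW_sup * exp \<beta>) * exp (- \<beta> * z) \<le> S * exp (- \<beta> * z)"
          unfolding S_def by (intro mult_right_mono) auto
        then show ?thesis using Phi_LSW_exp_bound[OF \<beta>p(1) that] by linarith
      qed
      have b: "\<bar>\<Phi> z\<bar> \<le> S * exp (- \<beta> * z)" if "0 \<le> z" for z
      proof -
        have "\<bar>\<Phi> z\<bar> \<le> (LSW_sup * exp \<beta>) * exp (- \<beta> * z) + (r * exp \<beta>) * exp (- \<beta> * z)"
          using Phi_LSW_exp_bound[OF \<beta>p(1) that] d[OF that] by linarith
        also have "\<dots> = ((LSW_sup + r) * exp \<beta>) * exp (- \<beta> * z)" by (simp add: algebra_simps)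
        also have "\<dots> \<le> S * exp (- \<beta> * z)"
          unfolding S_def using r by (intro mult_right_mono) auto
        finally show ?thesis .
      qed
      let ?h = "conv \<Phi> \<Phi>"
      let ?m1 = "moment (\<lambda>z. z) \<delta> ?h" and ?m0 = "moment (\<lambda>z. 1) \<delta> ?h"
      interpret I: unit_test_weight \<delta> "\<lambda>z. z" using unit_test_weight_id \<delta> by blast
      interpret J: unit_test_weight \<delta> "\<lambda>z. 1" using unit_test_weight_one \<delta> by blast
      have S0: "0 \<le> S" "0 \<le> S * S / 2" "0 \<le> r * exp \<beta>" using S r by auto
      have pert_small: "S * (r * exp \<beta>) * exp (age \<delta> 1 + K) * weight_mass \<beta> \<le> \<tau> * (exp (age \<delta> 1) * k_min * rho)"
      proof -
        have "S * (r * exp \<beta>) * exp (age \<delta> 1 + K) * weight_mass \<beta> = exp (age \<delta> 1) * (P * r)"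
          by (simp add: P_def W_def exp_add)
        also have "\<dots> \<le> exp (age \<delta> 1) * (\<tau> * km * rho)" using r(3) by (intro mult_left_mono) auto
        finally show ?thesis by (simp add: km_def mult_ac)
      qed
      \<comment> \<open>The value of $\eta$ is made for this step: $2\eta\sqrt\delta \cdot 128\pi/\sqrt\delta = \tau/2$.\<close>
      have \<kappa>: "(e + t) * age \<delta> 1 \<le> \<tau> / 2" if "0 < e" "e \<le> w" "0 < t" "t \<le> w" for e t
      proof -
        have "(e + t) * age \<delta> 1 \<le> (2 * w) * (128 * pi / sqrt \<delta>)"
          using that L unfolding L_def by (intro mult_mono) auto
        also have "\<dots> = \<tau> / 2" using sq by (simp add: w_def \<eta>_def)
        finally show ?thesis .
      qed
      have pert1: "\<bar>?m1 e t - moment (\<lambda>z. z) \<delta> h_LSW e t\<bar> \<le> \<tau> * (exp (age \<delta> 1) * k_min * rho)"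
        and pert0: "\<bar>?m0 e t - moment (\<lambda>z. 1) \<delta> h_LSW e t\<bar> \<le> \<tau> * (exp (age \<delta> 1) * k_min * rho)"
        if "0 < e" "0 < t" for e t
        using I.moment_perturbation[OF \<beta>p(1) K(2)[OF \<delta>(1)] meas b bL d S0(1,3), of e t]
          J.moment_perturbation[OF \<beta>p(1) K(2)[OF \<delta>(1)] meas b bL d S0(1,3), of e t] pert_small that
        by (auto intro: order_trans simp del: times_divide_eq_right)
      have "1 - 2 * \<tau> = 98/100" "1 + 2 * \<tau> = 102/100" by (auto simp: \<tau>_def)
      note near1 = I.moment_near_LSW[OF pert1 _ _ \<tau> \<kappa> half surv, unfolded this]
        and near0 = J.moment_near_LSW[OF pert0 _ _ \<tau> \<kappa> half surv, unfolded this]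
      have box: "9/10 \<le> E * ?m1 e t \<and> E * ?m1 e t \<le> 11/10" "9/10 * Et \<le> E\<^sup>2 * ?m0 e t \<and> E\<^sup>2 * ?m0 e t \<le> 11/10 * Et"
        if D: "0 < e" "e \<le> w" "0 < t" "t \<le> w" for e t
        unfolding E_def Et_def
        using normalised_moments[OF \<delta> \<delta>den near1[OF D(1,3) less_imp_le[OF D(1)] less_imp_le[OF D(3)] D]
          near0[OF D(1,3) less_imp_le[OF D(1)] less_imp_le[OF D(3)] D]] by blast+
      have lip: "\<bar>?m1 e t - ?m1 e' t'\<bar> \<le> (\<bar>e - e'\<bar> + \<bar>t - t'\<bar>) * \<Lambda>" "\<bar>?m0 e t - ?m0 e' t'\<bar> \<le> (\<bar>e - e'\<bar> + \<bar>t - t'\<bar>) * \<Lambda>"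
        if "0 < e" "0 < t" "0 < e'" "0 < t'" for e t e' t'
        unfolding \<Lambda>_def W_def L_def
        using that A_def L_def
        by (intro I.moment_lipschitz J.moment_lipschitz \<beta>p(1) K(2) \<delta> conv_measurable meas conv_bound b S0; simp)+
      from compatibility_fixed_point[where ?m1.0 = ?m1 and ?m0.0 = ?m0, OF E(1) Ew(2) E(2) Ew(1) \<Lambda>0 box lip small]
      obtain e t where et: "0 < e" "0 < t" "e * ?m1 e t = 1 \<and> e\<^sup>2 * ?m0 e t = t"
          "1/2 * E \<le> e" "e \<le> 2 * E" "1/2 * Et \<le> t" "t \<le> 2 * Et"
        and uniq: "\<And>e' t'. 0 < e' \<Longrightarrow> e' \<le> w \<Longrightarrow> 0 < t' \<Longrightarrow> t' \<le> w \<Longrightarrow> e' * ?m1 e' t' = 1 \<and> e'\<^sup>2 * ?m0 e' t' = t' \<Longrightarrow> e' = e \<and> t' = t"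
        by blast
      have comp: "compatible \<Phi> \<delta> e t \<longleftrightarrow> e * ?m1 e t = 1 \<and> e\<^sup>2 * ?m0 e t = t" if "0 < e" "0 < t" for e t
        by (rule compatible_iff[OF \<beta>p(1) K(2)[OF \<delta>(1)] meas b S0(1) \<delta> that])
      show "uniquely_solvable \<Phi> \<delta> (\<eta> * sqrt \<delta>)"
        unfolding uniquely_solvable_def
      proof (rule exI[of _ e], rule exI[of _ t], intro conjI allI impI et(1,2))
        show "compatible \<Phi> \<delta> e t" using comp[OF et(1,2)] et(3) by blast
        show "(e, t) \<in> U_set \<delta>" using et(4-7) by (simp add: U_set_def E_def Et_def)
        fix e' t' assume *: "0 < e' \<and> e' \<le> \<eta> * sqrt \<delta> \<and> 0 < t' \<and> t' \<le> \<eta> * sqrt \<delta> \<and> compatible \<Phi> \<delta> e' t'"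
        then have "e' = e \<and> t' = t" using comp[of e' t'] by (intro uniq) (auto simp: w_def)
        then show "e' = e" "t' = t" by auto
      qed
    qed
  qed
  show ?thesis
    by (rule exI[of _ r], rule conjI[OF r(1)], rule exI[of _ \<eta>], rule conjI[OF \<eta> main])
qed

theorem theorem2p3:
  fixes \<beta>1 \<beta>2 :: real
  assumes "\<beta>1 > 0" and "\<beta>2 > 1"
  shows "(\<exists>r>0. \<forall>\<omega> :: real \<Rightarrow> real.
            (\<forall>\<delta>\<in>{0<..1}. \<omega> \<delta> > 0) \<and> ((\<lambda>\<delta>. \<omega> \<delta> / sqrt \<delta>) \<longlongrightarrow> 0) (at_right 0) \<longrightarrow>
            (\<exists>\<delta>0\<in>{0<..1}. \<forall>\<delta>\<in>{0<..\<delta>0}. \<forall>\<Phi>\<in>Z_space \<beta>1 \<beta>2.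
               Z_norm \<beta>1 \<beta>2 (\<lambda>z. \<Phi> z - Phi_LSW z) \<le> r \<longrightarrow>
               (\<exists>\<epsilon> \<epsilon>t. \<epsilon> > 0 \<and> \<epsilon>t > 0 \<and> compatible \<Phi> \<delta> \<epsilon> \<epsilon>t \<and> (\<epsilon>, \<epsilon>t) \<in> U_set \<delta> \<and>
                  (\<forall>\<epsilon>' \<epsilon>t'. 0 < \<epsilon>' \<and> \<epsilon>' \<le> \<omega> \<delta> \<and> 0 < \<epsilon>t' \<and> \<epsilon>t' \<le> \<omega> \<delta> \<and> compatible \<Phi> \<delta> \<epsilon>' \<epsilon>t' \<longrightarrow>
                     \<epsilon>' = \<epsilon> \<and> \<epsilon>t' = \<epsilon>t))))
       \<and> (\<exists>c>0. \<exists>C>0. \<forall>\<delta>\<in>{0<..1}.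
            c * exp (- C / sqrt \<delta>) \<le> eps \<delta> \<and> eps \<delta> \<le> C * exp (- c / sqrt \<delta>) \<and>
            c * exp (- C / sqrt \<delta>) \<le> epst \<delta> \<and> epst \<delta> \<le> C * exp (- c / sqrt \<delta>))"
  (is "(\<exists>r>0. \<forall>\<omega>. ?small \<omega> \<longrightarrow> ?solvable r \<omega>) \<and> ?sizes")
proof (rule conjI)
  obtain r \<eta> where r: "r > 0" and \<eta>: "\<eta> > 0"
    and main: "\<forall>\<^sub>F \<delta> in at_right 0. \<forall>\<Phi>\<in>Z_space \<beta>1 \<beta>2.
      Z_norm \<beta>1 \<beta>2 (\<lambda>z. \<Phi> z - Phi_LSW z) \<le> r \<longrightarrow> uniquely_solvable \<Phi> \<delta> (\<eta> * sqrt \<delta>)"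
    using uniquely_solvable_up_to_sqrt[OF assms] by blast
  have "?solvable r \<omega>" if \<omega>: "?small \<omega>" for \<omega>
  proof -
    let ?concl = "\<lambda>\<delta>. \<forall>\<Phi>\<in>Z_space \<beta>1 \<beta>2.
      Z_norm \<beta>1 \<beta>2 (\<lambda>z. \<Phi> z - Phi_LSW z) \<le> r \<longrightarrow> uniquely_solvable \<Phi> \<delta> (\<omega> \<delta>)"
    have "\<forall>\<^sub>F \<delta> in at_right 0. \<omega> \<delta> / sqrt \<delta> < \<eta>"
      using \<omega> \<eta> by (intro order_tendstoD(2)) auto
    with main have "\<forall>\<^sub>F \<delta> in at_right 0. ?concl \<delta>"
      using eventually_small_delta
    proof eventually_elim
      case (elim \<delta>)
      have "\<omega> \<delta> \<le> \<eta> * sqrt \<delta>" using elim(2,3) by (simp add: pos_divide_less_eq)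
      then show ?case using elim(1) uniquely_solvable_mono by blast
    qed
    then obtain b where b: "b > 0" "\<And>\<delta>. 0 < \<delta> \<Longrightarrow> \<delta> < b \<Longrightarrow> ?concl \<delta>"
      unfolding eventually_at_right_field by blast
    have "?concl \<delta>" if "\<delta> \<in> {0<..min 1 (b / 2)}" for \<delta>
      using that b(1) by (intro b(2)) auto
    moreover have "min 1 (b / 2) \<in> {0<..1}" using b(1) by auto
    ultimately have "\<exists>\<delta>0\<in>{0<..1}. \<forall>\<delta>\<in>{0<..\<delta>0}. ?concl \<delta>" by blast
    then show ?thesis unfolding uniquely_solvable_def .
  qed
  then show "\<exists>r>0. \<forall>\<omega>. ?small \<omega> \<longrightarrow> ?solvable r \<omega>" using r by blast
qed (rule eps_epst_exponentially_small)

end
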